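(* Let $w$ be a Robinsonian graphon satisfying Assumptions (A1)–(A4), let $\tau\in[0,1)$, $\rho_N=N^{-\tau}$, $G^{(N)}\sim\rho_N w$, and fix $0<\eta<\frac{1-\tau}{3}$. Let $\phi$ be a Fiedler function of $\mathbb{L}$ and $\hat\phi_N$ the step function built from a Fiedler vector of $G^{(N)}$, normalized so that $\|\phi\|=\|\hat\phi_N\|=1$ and $\langle\phi,\hat\phi_N\rangle\ge0$. Then for every $\varepsilon\in(0,1)$ there are a constant $C=C(w)>0$ and an integer $N_0=N_0(w,\tau,\eta,\varepsilon)$ such that for all $N\ge N_0$, $$\mathbb{P}\big(\|\hat\phi_N-\phi\|\le C N^{-3\eta/2}\big)\ge 1-\varepsilon .$$ Moreover, for every $\gamma>1$ there are $C'=C'(w)>0$ and $N_0'=N_0'(w,\tau,\eta,\gamma)$ such that for all $N\ge N_0'$, $\mathbb{P}(\|\hat\phi_N-\phi\|\le C' N^{-3\eta/2})\ge 1-\varepsilon_\gamma(N)$.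
   Context: A graphon is a measurable symmetric $w:[0,1]^2\to[0,1]$; it is Robinsonian if for all $x,y,z$: $y<z<x\Rightarrow w(x,y)\le w(x,z)$ and $x<y<z\Rightarrow w(x,y)\ge w(x,z)$. Degree $d(x)=\int_0^1 w(x,y)dy$; graphon-Laplacian $(\mathbb{L}f)(x)=\int_0^1 w(x,y)(f(x)-f(y))dy$ on $L^2([0,1])$ with inner product $\langle f,g\rangle=\int_0^1 fg$ and norm $\|\cdot\|$; its isolated eigenvalues of finite multiplicity are $0=\lambda_1<\lambda_2<\cdots$, and a Fiedler function is an eigenfunction for $\lambda_2$. Assumptions: (A1) $|w(x,y)-w(x',y')|\le K(|x-x'|+|y-y'|)$ for some $K>0$; (A2) for every $x$, $\partial w(x,y)/\partial x$ exists and is nonzero for a.e. $y$; (A3) $d'$ exists everywhere on $[0,1]$ and $\{d'=0\}$ is countable; (A4) with $\mathcal{H}=\{f:\int_0^1 f=0,\int_0^1 f^2=1\}$, $\inf_{f\in\mathcal{H}}\langle\mathbb{L}f,f\rangle<\inf_x d(x)$. Random graph $G^{(N)}\sim\rho_N w$: vertices $v_i=i/N$, $i\in[N]$; each edge $\{i,j\}$, $i<j$, present independently with probability $\rho_N w(i/N,j/N)$. The Laplacian of a graph with adjacency matrix $A$ is $D-A$, $D$ the diagonal degree matrix; a Fiedler vector is an eigenvector of it for its second-smallest eigenvalue. If $(\hat\phi_i)_{i\in[N]}$ is a Fiedler vector of $G^{(N)}$, the associated step function is $\hat\phi_N(x)=\sum_i\hat\phi_i\mathbf{1}_{\mathcal{I}_i}(x)$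 with $\mathcal{I}_1=[0,1/N]$, $\mathcal{I}_i=((i-1)/N,i/N]$. $\varepsilon_\gamma(N)=\exp(-(\log N)^\gamma)$. *)

theory Defs
  imports "HOL-Probability.Probability" "Jordan_Normal_Form.Char_Poly"
begin

text \<open>Graphons are represented as functions real => real => real; only their values on
  the unit square matter.\<close>

definition graphon :: "(real \<Rightarrow> real \<Rightarrow> real) \<Rightarrow> bool" where
  "graphon w \<longleftrightarrow>
     (\<lambda>(x, y). w x y) \<in> borel_measurable (lebesgue_on ({0..1} \<times> {0..1})) \<and>
     (\<forall>x\<in>{0..1}. \<forall>y\<in>{0..1}. w x y = w y x \<and> 0 \<le> w x y \<and> w x y \<le> 1)"

definition robinsonian :: "(real \<Rightarrow> real \<Rightarrow> real) \<Rightarrow> bool" where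
  "robinsonian w \<longleftrightarrow>
     (\<forall>x\<in>{0..1}. \<forall>y\<in>{0..1}. \<forall>z\<in>{0..1}.
        (y < z \<and> z < x \<longrightarrow> w x y \<le> w x z) \<and> (x < y \<and> y < z \<longrightarrow> w x y \<ge> w x z))"

definition graphon_degree :: "(real \<Rightarrow> real \<Rightarrow> real) \<Rightarrow> real \<Rightarrow> real" where
  "graphon_degree w x = (\<integral>y. w x y \<partial>lebesgue_on {0..1})"

text \<open>Square integrable functions on [0,1] (elements of L2 are represented by functions,
  equality of L2 elements is equality almost everywhere).\<close>

definition L2 :: "(real \<Rightarrow> real) \<Rightarrow> bool" where
  "L2 f \<longleftrightarrow> f \<in> borel_measurable (lebesgue_on {0..1}) \<and>
            integrable (lebesgue_on {0..1}) (\<lambda>x. (f x)\<^sup>2)"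

definition ae_eq01 :: "(real \<Rightarrow> real) \<Rightarrow> (real \<Rightarrow> real) \<Rightarrow> bool" where
  "ae_eq01 f g \<longleftrightarrow> (AE x in lebesgue_on {0..1}. f x = g x)"

definition inner_L2 :: "(real \<Rightarrow> real) \<Rightarrow> (real \<Rightarrow> real) \<Rightarrow> real" where
  "inner_L2 f g = (\<integral>x. f x * g x \<partial>lebesgue_on {0..1})"

definition norm_L2 :: "(real \<Rightarrow> real) \<Rightarrow> real" where
  "norm_L2 f = sqrt (inner_L2 f f)"

definition graphon_lap :: "(real \<Rightarrow> real \<Rightarrow> real) \<Rightarrow> (real \<Rightarrow> real) \<Rightarrow> real \<Rightarrow> real" where
  "graphon_lap w f x = (\<integral>y. w x y * (f x - f y) \<partial>lebesgue_on {0..1})"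

text \<open>Spectrum of the graphon Laplacian on L2: those l for which L - l I is not a bijection
  of L2 (modulo a.e. equality). Since L is bounded, bijectivity gives a bounded inverse.\<close>

definition lap_spectrum :: "(real \<Rightarrow> real \<Rightarrow> real) \<Rightarrow> real set" where
  "lap_spectrum w = {l.
     (\<not> (\<forall>g. L2 g \<longrightarrow> (\<exists>f. L2 f \<and> ae_eq01 (\<lambda>x. graphon_lap w f x - l * f x) g))) \<or>
     (\<exists>f. L2 f \<and> \<not> ae_eq01 f (\<lambda>_. 0) \<and> ae_eq01 (\<lambda>x. graphon_lap w f x - l * f x) (\<lambda>_. 0))}"

definition lap_eigenspace :: "(real \<Rightarrow> real \<Rightarrow> real) \<Rightarrow> real \<Rightarrow> (real \<Rightarrow> real) set" where
  "lap_eigenspace w l = {f. L2 f \<and> ae_eq01 (graphon_lap w f) (\<lambda>x. l * f x)}"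

definition isolated_finite_eigenvalue :: "(real \<Rightarrow> real \<Rightarrow> real) \<Rightarrow> real \<Rightarrow> bool" where
  "isolated_finite_eigenvalue w l \<longleftrightarrow>
     (\<exists>f\<in>lap_eigenspace w l. \<not> ae_eq01 f (\<lambda>_. 0)) \<and>
     (\<exists>B. finite B \<and> B \<subseteq> lap_eigenspace w l \<and>
          (\<forall>f\<in>lap_eigenspace w l. \<exists>c. ae_eq01 f (\<lambda>x. \<Sum>b\<in>B. c b * b x))) \<and>
     (\<exists>e>0. \<forall>m\<in>lap_spectrum w. \<bar>m - l\<bar> < e \<longrightarrow> m = l)"

definition fiedler_value :: "(real \<Rightarrow> real \<Rightarrow> real) \<Rightarrow> real \<Rightarrow> bool" where
  "fiedler_value w l \<longleftrightarrow>
     isolated_finite_eigenvalue w l \<and> card {m. isolated_finite_eigenvalue w m \<and> m < l} = 1"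

definition fiedler_function :: "(real \<Rightarrow> real \<Rightarrow> real) \<Rightarrow> (real \<Rightarrow> real) \<Rightarrow> bool" where
  "fiedler_function w \<phi> \<longleftrightarrow>
     (\<exists>l. fiedler_value w l \<and> \<phi> \<in> lap_eigenspace w l \<and> \<not> ae_eq01 \<phi> (\<lambda>_. 0))"

text \<open>Vertices are 1..N (vertex i sits at i/N). A graph is given by its edge indicator on
  pairs (i,j) with i < j.\<close>

definition edge_slots :: "nat \<Rightarrow> (nat \<times> nat) set" where
  "edge_slots N = {(i, j). 1 \<le> i \<and> i < j \<and> j \<le> N}"

definition random_graph ::
    "nat \<Rightarrow> real \<Rightarrow> (real \<Rightarrow> real \<Rightarrow> real) \<Rightarrow> (nat \<times> nat \<Rightarrow> bool) pmf" where
  "random_graph N \<rho> w =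
     Pi_pmf (edge_slots N) False
       (\<lambda>(i, j). bernoulli_pmf (\<rho> * w (real i / real N) (real j / real N)))"

definition adj :: "(nat \<times> nat \<Rightarrow> bool) \<Rightarrow> nat \<Rightarrow> nat \<Rightarrow> real" where
  "adj E i j = (if i \<noteq> j \<and> E (min i j, max i j) then 1 else 0)"

text \<open>Laplacian D - A; matrix index a (0-based) corresponds to vertex a+1.\<close>

definition graph_laplacian :: "nat \<Rightarrow> (nat \<times> nat \<Rightarrow> bool) \<Rightarrow> real mat" where
  "graph_laplacian N E =
     mat N N (\<lambda>(a, b). if a = b then (\<Sum>c<N. adj E (a + 1) (c + 1))
                         else - adj E (a + 1) (b + 1))"

definition eig_count_less :: "real mat \<Rightarrow> real \<Rightarrow> nat" where
  "eig_count_less A l =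
     (\<Sum>m\<in>{m. poly (char_poly A) m = 0 \<and> m < l}. order m (char_poly A))"

definition eig_count_le :: "real mat \<Rightarrow> real \<Rightarrow> nat" where
  "eig_count_le A l =
     (\<Sum>m\<in>{m. poly (char_poly A) m = 0 \<and> m \<le> l}. order m (char_poly A))"

definition second_smallest_eigenvalue :: "real mat \<Rightarrow> real \<Rightarrow> bool" where
  "second_smallest_eigenvalue A l \<longleftrightarrow>
     eigenvalue A l \<and> eig_count_less A l < 2 \<and> 2 \<le> eig_count_le A l"

definition fiedler_vector :: "real mat \<Rightarrow> real vec \<Rightarrow> bool" where
  "fiedler_vector A v \<longleftrightarrow> (\<exists>l. second_smallest_eigenvalue A l \<and> eigenvector A v l)"

definition step_interval :: "nat \<Rightarrow> nat \<Rightarrow> real set" where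
  "step_interval N i = (if i = 1 then {0..1 / real N} else {(real i - 1) / real N <.. real i / real N})"

text \<open>Step function of a vector (0-based entry a is the value at vertex a+1).\<close>

definition step_fun :: "nat \<Rightarrow> real vec \<Rightarrow> real \<Rightarrow> real" where
  "step_fun N v x = (\<Sum>a<N. v $ a * indicator (step_interval N (a + 1)) x)"

definition eps_gamma :: "real \<Rightarrow> nat \<Rightarrow> real" where
  "eps_gamma \<gamma> N = exp (- (ln (real N) powr \<gamma>))"

definition fiedler_close_event ::
    "nat \<Rightarrow> (real \<Rightarrow> real) \<Rightarrow> real \<Rightarrow> (nat \<times> nat \<Rightarrow> bool) set" where
  "fiedler_close_event N \<phi> r = {E. \<forall>v.
      fiedler_vector (graph_laplacian N E) v \<and> norm_L2 (step_fun N v) = 1 \<and>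
      inner_L2 \<phi> (step_fun N v) \<ge> 0 \<longrightarrow>
      norm_L2 (\<lambda>x. step_fun N v x - \<phi> x) \<le> r}"

end

theory Submission
  imports Defs "HOL-Complex_Analysis.Great_Picard" "HOL-Real_Asymp.Real_Asymp"
begin

text \<open>
  \<open>L\<close> is multiplication by the degree minus a compact operator, so by (A4) the infimum \<open>\<mu>\<close> of its
  form on mean zero functions is attained. An eigenfunction \<open>f\<close> for \<open>\<mu>\<close> is differentiable, and
  the Robinson property makes \<open>(L - \<mu>) q\<close> decreasing for the centred variation \<open>q\<close> of \<open>f\<close>. By
  Chebyshev's inequality \<open>q\<close> is again an eigenfunction for \<open>\<mu>\<close>; comparing the derivatives of \<open>q\<close>
  and \<open>f\<close> gives \<open>f = q\<close> or \<open>f = - q\<close>. By (A2) a nonzero monotone eigenfunction has no critical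
  point, whence \<open>\<mu>\<close> is simple, and compactness yields a spectral gap above \<open>\<mu>\<close>.

  For the graph put \<open>D = N \<rho>\<close>. A Chernoff bound for the row sums and a trace moment bound of
  order \<open>2 k\<close> with \<open>k\<close> about \<open>(log N) powr \<gamma>\<close> for the centred adjacency matrix show that, outside
  an event of probability at most \<open>exp (- (log N) powr \<gamma>)\<close>, the graph Laplacian divided by \<open>D\<close>
  differs from \<open>L\<close> on step functions by at most a multiple of \<open>N powr (- 3 * \<eta> / 2)\<close> in operator
  norm. Testing with a sampled eigenfunction bounds the Fiedler value, and the spectral gap then
  forces the Fiedler vector to be close to the eigenfunction.
\<close>

section \<open>Square integrable functions on the unit interval\<close>

text \<open>The exponent \<open>3 * \<eta> / 2\<close> comes from a trade-off. The allowed error is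
  \<open>s = D * N powr (- 3 * \<eta> / 2)\<close>, while the noise matrices have norm about
  \<open>sqrt D\<close>. The quotient \<open>s / sqrt D\<close> equals
  \<open>N powr ((1 - \<tau> - 3 * \<eta>) / 2)\<close>, a positive power of \<open>N\<close>
  exactly because \<open>\<eta> < (1 - \<tau>) / 3\<close>. This polynomial room lets crude walk
  counts and a simple exponential tail suffice. The final constant depends only on \<open>K\<close>
  and on the spectral gap.

  On the analytic side, \<open>L\<close> is not compact, so no eigenbasis is at hand. All
  compactness arguments run at shifts \<open>m\<close> lying below the degree by a fixed margin,
  where the multiplication part can be inverted. Simplicity of \<open>\<mu>\<close> cannot come from
  positivity, because its eigenfunctions have mean zero and change sign; monotonicity takes the
  place of positivity. The derivative of an eigenfunction is known to be bounded but not continuous,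
  hence the use of gauge integrals and of Henstock's lemma.

  On the graph side, a Fiedler vector depends on the sampled graph, so the comparison of operators
  has to hold for all vectors at once.\<close>

abbreviation unit_measure :: "real measure" where
  "unit_measure \<equiv> lebesgue_on {0..1}"

lemma prob_space_unit: "prob_space unit_measure"
  by (rule prob_spaceI) (simp add: emeasure_restrict_space)

interpretation unit: prob_space unit_measure
  by (rule prob_space_unit)

interpretation unit_pair: pair_sigma_finite unit_measure unit_measure
  by unfold_locales

lemma unit_integral_cong:
  assumes "\<And>x. x \<in> {0..1} \<Longrightarrow> f x = g x"
  shows "integral\<^sup>L unit_measure f = integral\<^sup>L unit_measure g"
  using assms by (intro Bochner_Integration.integral_cong) auto

text \<open>A quadratic polynomial without negative values has nonpositive discriminant. This is the
  common core of Cauchy-Schwarz for the inner product, for the semidefinite form of the shifted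
  Laplacian and for the matrix form later on.\<close>

lemma discriminant_le:
  fixes a b c :: real
  assumes "\<And>t. 0 \<le> a + 2 * t * b + t\<^sup>2 * c"
  shows "b\<^sup>2 \<le> a * c"
proof (cases "c = 0")
  case True
  have "b = 0"
  proof (rule ccontr)
    assume "b \<noteq> 0"
    \<comment> \<open>The affine function \<open>a + 2 * t * b\<close> takes the value -1 at the
      \<open>t\<close> inserted here.\<close>
    then show False
      using assms[of "- (a + 1) / (2 * b)"] True by (simp add: field_simps)
  qed
  then show ?thesis using True by simp
next
  case False
  have "c > 0"
  proof (rule ccontr)
    assume "\<not> c > 0"
    with False have c: "c < 0" by simp
    \<comment> \<open>Large enough for the negative term \<open>t * t * c\<close> to beat the linear
      terms; the summand 1 ensures \<open>t >= 1\<close>, so that \<open>a\<close> can be estimated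
      by \<open>t * \<bar>a\<bar>\<close>.\<close>
    define t where "t = (\<bar>a\<bar> + 2 * \<bar>b\<bar> + 1) / (- c) + 1"
    have t1: "t \<ge> 1" and tc: "t * (- c) = \<bar>a\<bar> + 2 * \<bar>b\<bar> + 1 - c"
      using c by (auto simp: t_def field_simps)
    have "a + 2 * t * b + t\<^sup>2 * c \<le> t * \<bar>a\<bar> + 2 * t * \<bar>b\<bar> - t * (t * (- c))"
    proof -
      have "a \<le> t * \<bar>a\<bar>"
        using t1 mult_right_mono[of 1 t "\<bar>a\<bar>"] by simp
      moreover have "2 * t * b \<le> 2 * t * \<bar>b\<bar>"
        using t1 by (intro mult_left_mono) auto
      ultimately show ?thesis by (simp add: power2_eq_square)
    qed
    also have "\<dots> = t * (c - 1)"
      unfolding tc by (simp add: algebra_simps)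
    also have "\<dots> < 0" using t1 c by (intro mult_pos_neg) auto
    finally show False using assms[of t] by simp
  qed
  then show ?thesis
    using assms[of "- b / c"] by (simp add: field_simps power2_eq_square)
qed

lemma L2_measurable: "L2 f \<Longrightarrow> f \<in> borel_measurable unit_measure"
  by (simp add: L2_def)

lemma L2_integrable_mult:
  assumes "L2 f" "L2 g"
  shows "integrable unit_measure (\<lambda>x. f x * g x)"
proof (rule Bochner_Integration.integrable_bound)
  show "integrable unit_measure (\<lambda>x. (f x)\<^sup>2 + (g x)\<^sup>2)"
    using assms by (auto simp: L2_def)
  show "(\<lambda>x. f x * g x) \<in> borel_measurable unit_measure"
    using assms by (auto simp: L2_def)
  have "\<bar>f x * g x\<bar> \<le> (f x)\<^sup>2 + (g x)\<^sup>2" for x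
  proof -
    have "2 * (\<bar>f x\<bar> * \<bar>g x\<bar>) \<le> (f x)\<^sup>2 + (g x)\<^sup>2"
      using sum_squares_bound[of "\<bar>f x\<bar>" "\<bar>g x\<bar>"] by (simp add: mult.assoc)
    moreover have "0 \<le> \<bar>f x\<bar> * \<bar>g x\<bar>" by simp
    ultimately show ?thesis unfolding abs_mult by linarith
  qed
  then show "AE x in unit_measure. norm (f x * g x) \<le> norm ((f x)\<^sup>2 + (g x)\<^sup>2)"
    by auto
qed

lemma L2_bounded:
  assumes "f \<in> borel_measurable unit_measure" "\<And>x. x \<in> {0..1} \<Longrightarrow> \<bar>f x\<bar> \<le> B"
  shows "L2 f"
proof -
  have "integrable unit_measure (\<lambda>x. (f x)\<^sup>2)"
  proof (rule unit.integrable_const_bound[where B = "B\<^sup>2"])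
    show "AE x in unit_measure. norm ((f x)\<^sup>2) \<le> B\<^sup>2"
    proof (intro AE_I2)
      fix x assume "x \<in> space unit_measure"
      then have "\<bar>f x\<bar>\<^sup>2 \<le> B\<^sup>2" using assms(2)[of x] by (intro power_mono) auto
      then show "norm ((f x)\<^sup>2) \<le> B\<^sup>2" by simp
    qed
  qed (use assms in auto)
  then show ?thesis using assms by (simp add: L2_def)
qed

lemma continuous_measurable_unit:
  "continuous_on {0..1} f \<Longrightarrow> f \<in> borel_measurable unit_measure" for f :: "real \<Rightarrow> real"
  by (intro continuous_imp_measurable_on_sets_lebesgue) auto

lemma L2_continuous:
  assumes "continuous_on {0..1} f"
  shows "L2 f"
proof -
  have "bounded (f ` {0..1})"
    using assms by (intro compact_imp_bounded compact_continuous_image) auto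
  then obtain B where "\<forall>y\<in>f ` {0..1}. norm y \<le> B"
    unfolding bounded_iff by blast
  then have "\<And>x. x \<in> {0..1} \<Longrightarrow> \<bar>f x\<bar> \<le> B" by simp
  then show ?thesis
    using L2_bounded continuous_measurable_unit assms by blast
qed

lemma L2_const [simp, intro]: "L2 (\<lambda>_. c)"
  by (intro L2_continuous continuous_intros)

lemma L2_integrable: "L2 f \<Longrightarrow> integrable unit_measure f"
  using L2_integrable_mult[of f "\<lambda>_. 1"] by simp

lemma L2_add [intro]:
  assumes "L2 f" "L2 g"
  shows "L2 (\<lambda>x. f x + g x)"
proof -
  have "integrable unit_measure (\<lambda>x. (f x)\<^sup>2 + 2 * (f x * g x) + (g x)\<^sup>2)"
    using assms L2_integrable_mult[OF assms] by (auto simp: L2_def)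
  then show ?thesis
    using assms by (auto simp: L2_def power2_sum algebra_simps)
qed

lemma L2_cmult [intro]: "L2 f \<Longrightarrow> L2 (\<lambda>x. c * f x)"
  unfolding L2_def power_mult_distrib by (intro conjI borel_measurable_times) auto

lemma L2_diff [intro]:
  assumes "L2 f" "L2 g"
  shows "L2 (\<lambda>x. f x - g x)"
  using L2_add[OF assms(1) L2_cmult[OF assms(2), of "- 1"]] by simp

lemma L2_mult_bounded:
  assumes "L2 f" "g \<in> borel_measurable unit_measure" "\<And>x. x \<in> {0..1} \<Longrightarrow> \<bar>g x\<bar> \<le> B"
  shows "L2 (\<lambda>x. g x * f x)"
proof -
  have "integrable unit_measure (\<lambda>x. (g x * f x)\<^sup>2)"
  proof (rule Bochner_Integration.integrable_bound)
    show "integrable unit_measure (\<lambda>x. B\<^sup>2 * (f x)\<^sup>2)"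
      using assms by (auto simp: L2_def)
    show "(\<lambda>x. (g x * f x)\<^sup>2) \<in> borel_measurable unit_measure"
      using assms L2_measurable[of f] by auto
    show "AE x in unit_measure. norm ((g x * f x)\<^sup>2) \<le> norm (B\<^sup>2 * (f x)\<^sup>2)"
    proof (intro AE_I2)
      fix x assume "x \<in> space unit_measure"
      then have "\<bar>g x\<bar>\<^sup>2 \<le> B\<^sup>2" using assms(3)[of x] by (intro power_mono) auto
      then show "norm ((g x * f x)\<^sup>2) \<le> norm (B\<^sup>2 * (f x)\<^sup>2)"
        by (auto simp: power_mult_distrib intro!: mult_right_mono)
    qed
  qed
  then show ?thesis
    using borel_measurable_times[OF assms(2) L2_measurable[OF assms(1)]] by (simp add: L2_def)
qed

lemma L2_cong:
  assumes "\<And>x. x \<in> {0..1} \<Longrightarrow> f x = g x"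
  shows "L2 f \<longleftrightarrow> L2 g"
proof -
  have "f \<in> borel_measurable unit_measure \<longleftrightarrow> g \<in> borel_measurable unit_measure"
    using assms by (intro measurable_cong) auto
  moreover have "integrable unit_measure (\<lambda>x. (f x)\<^sup>2) \<longleftrightarrow> integrable unit_measure (\<lambda>x. (g x)\<^sup>2)"
    using assms by (intro Bochner_Integration.integrable_cong) auto
  ultimately show ?thesis by (simp add: L2_def)
qed

lemma inner_L2_cong:
  assumes "\<And>x. x \<in> {0..1} \<Longrightarrow> f x = f' x" "\<And>x. x \<in> {0..1} \<Longrightarrow> g x = g' x"
  shows "inner_L2 f g = inner_L2 f' g'"
  unfolding inner_L2_def using assms by (intro unit_integral_cong) auto

lemma norm_L2_cong:
  assumes "\<And>x. x \<in> {0..1} \<Longrightarrow> f x = g x"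
  shows "norm_L2 f = norm_L2 g"
  unfolding norm_L2_def using inner_L2_cong[OF assms assms] by simp

lemma inner_L2_AE:
  assumes "AE x in unit_measure. f x = f' x" "AE x in unit_measure. g x = g' x"
    "L2 f" "L2 g" "L2 f'" "L2 g'"
  shows "inner_L2 f g = inner_L2 f' g'"
  unfolding inner_L2_def using assms(1,2) L2_integrable_mult[OF assms(3,4)] L2_integrable_mult[OF assms(5,6)]
  by (intro integral_cong_AE) auto

lemma inner_L2_commute: "inner_L2 f g = inner_L2 g f"
  by (simp add: inner_L2_def mult.commute)

lemma inner_L2_add_left:
  assumes "L2 f" "L2 g" "L2 h"
  shows "inner_L2 (\<lambda>x. f x + g x) h = inner_L2 f h + inner_L2 g h"
  unfolding inner_L2_def
  using L2_integrable_mult[OF assms(1,3)] L2_integrable_mult[OF assms(2,3)]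
  by (simp add: distrib_right)

lemma inner_L2_cmult_left: "inner_L2 (\<lambda>x. c * f x) h = c * inner_L2 f h"
  unfolding inner_L2_def by (simp add: mult.assoc)

lemma inner_L2_diff_left:
  assumes "L2 f" "L2 g" "L2 h"
  shows "inner_L2 (\<lambda>x. f x - g x) h = inner_L2 f h - inner_L2 g h"
  unfolding inner_L2_def
  using L2_integrable_mult[OF assms(1,3)] L2_integrable_mult[OF assms(2,3)]
  by (simp add: left_diff_distrib)

lemma inner_L2_add_right:
  assumes "L2 f" "L2 g" "L2 h"
  shows "inner_L2 h (\<lambda>x. f x + g x) = inner_L2 h f + inner_L2 h g"
  using inner_L2_add_left[OF assms] by (simp add: inner_L2_commute)

lemma inner_L2_cmult_right: "inner_L2 h (\<lambda>x. c * f x) = c * inner_L2 h f"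
  using inner_L2_cmult_left[of c f h] by (simp add: inner_L2_commute)

lemma inner_L2_diff_right:
  assumes "L2 f" "L2 g" "L2 h"
  shows "inner_L2 h (\<lambda>x. f x - g x) = inner_L2 h f - inner_L2 h g"
  using inner_L2_diff_left[OF assms] by (simp add: inner_L2_commute)

lemma inner_L2_self_nonneg [simp]: "inner_L2 f f \<ge> 0"
  unfolding inner_L2_def by (intro Bochner_Integration.integral_nonneg) auto

lemma norm_L2_nonneg [simp]: "norm_L2 f \<ge> 0"
  by (simp add: norm_L2_def)

lemma norm_L2_sq: "(norm_L2 f)\<^sup>2 = inner_L2 f f"
  by (simp add: norm_L2_def)

lemma norm_L2_eq_0_iff:
  assumes "L2 f"
  shows "norm_L2 f = 0 \<longleftrightarrow> (AE x in unit_measure. f x = 0)"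
proof -
  have "norm_L2 f = 0 \<longleftrightarrow> integral\<^sup>L unit_measure (\<lambda>x. f x * f x) = 0"
    by (simp add: norm_L2_def inner_L2_def)
  also have "\<dots> \<longleftrightarrow> (AE x in unit_measure. f x * f x = 0)"
    using L2_integrable_mult[OF assms assms] by (intro integral_nonneg_eq_0_iff_AE) auto
  finally show ?thesis by simp
qed

lemma inner_L2_square_add:
  assumes "L2 f" "L2 g"
  shows "inner_L2 (\<lambda>x. f x + t * g x) (\<lambda>x. f x + t * g x)
    = inner_L2 f f + 2 * t * inner_L2 f g + t\<^sup>2 * inner_L2 g g"
proof -
  note l = assms(1) L2_cmult[OF assms(2), of t]
  have "inner_L2 (\<lambda>x. f x + t * g x) (\<lambda>x. f x + t * g x)
    = inner_L2 f f + t * inner_L2 f g + (t * inner_L2 g f + t * (t * inner_L2 g g))"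
    unfolding inner_L2_add_left[OF l L2_add[OF l]] inner_L2_add_right[OF l l(1)]
      inner_L2_cmult_left inner_L2_add_right[OF l assms(2)] inner_L2_cmult_right
    by (simp only: distrib_left)
  then show ?thesis
    unfolding inner_L2_commute[of g f] by (simp add: power2_eq_square)
qed

lemma L2_Cauchy_Schwarz:
  assumes "L2 f" "L2 g"
  shows "\<bar>inner_L2 f g\<bar> \<le> norm_L2 f * norm_L2 g"
proof -
  have "(inner_L2 f g)\<^sup>2 \<le> inner_L2 f f * inner_L2 g g"
    using inner_L2_square_add[OF assms] inner_L2_self_nonneg
    by (intro discriminant_le) metis
  then have "(inner_L2 f g)\<^sup>2 \<le> (norm_L2 f * norm_L2 g)\<^sup>2"
    by (simp add: power_mult_distrib norm_L2_sq)
  then show ?thesis by (rule abs_le_square_iff[THEN iffD2, THEN order_trans]) simp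
qed

lemma norm_L2_cmult: "norm_L2 (\<lambda>x. c * f x) = \<bar>c\<bar> * norm_L2 f"
  unfolding norm_L2_def inner_L2_cmult_left inner_L2_cmult_right
  by (simp add: real_sqrt_mult flip: mult.assoc)

lemma norm_L2_triangle:
  assumes "L2 f" "L2 g"
  shows "norm_L2 (\<lambda>x. f x + g x) \<le> norm_L2 f + norm_L2 g"
proof (rule power2_le_imp_le)
  have "inner_L2 f g \<le> norm_L2 f * norm_L2 g"
    using L2_Cauchy_Schwarz[OF assms] by simp
  then show "(norm_L2 (\<lambda>x. f x + g x))\<^sup>2 \<le> (norm_L2 f + norm_L2 g)\<^sup>2"
    using inner_L2_square_add[OF assms, of 1] by (simp add: norm_L2_sq power2_sum)
qed simp

lemma norm_L2_triangle_diff: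
  assumes "L2 f" "L2 g"
  shows "norm_L2 (\<lambda>x. f x - g x) \<le> norm_L2 f + norm_L2 g"
  using norm_L2_triangle[OF assms(1) L2_cmult[OF assms(2), of "- 1"]]
    norm_L2_cmult[of "-1" g] by simp

lemma norm_L2_mono:
  assumes "L2 f" "L2 g" "\<And>x. x \<in> {0..1} \<Longrightarrow> \<bar>f x\<bar> \<le> \<bar>g x\<bar>"
  shows "norm_L2 f \<le> norm_L2 g"
proof -
  have "f x * f x \<le> g x * g x" if "x \<in> space unit_measure" for x
    using assms(3)[of x] that abs_le_square_iff[of "f x" "g x"] by (simp add: power2_eq_square)
  then show ?thesis
    unfolding norm_L2_def inner_L2_def using assms(1,2)
    by (intro real_sqrt_le_mono integral_mono L2_integrable_mult) auto
qed

lemma norm_L2_const: "norm_L2 (\<lambda>_. c) = \<bar>c\<bar>"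
proof -
  have "measure unit_measure {0..1} = 1" using unit.prob_space by simp
  then show ?thesis by (simp add: norm_L2_def inner_L2_def)
qed

lemma norm_L2_sup:
  assumes "L2 f" "\<And>x. x \<in> {0..1} \<Longrightarrow> \<bar>f x\<bar> \<le> B"
  shows "norm_L2 f \<le> B"
proof -
  have "B \<ge> 0" using assms(2)[of 0] by auto
  then show ?thesis
    using norm_L2_mono[OF assms(1) L2_const[of B]] assms(2) by (auto simp: norm_L2_const)
qed

lemma integral_abs_le_norm_L2:
  assumes "L2 f"
  shows "integral\<^sup>L unit_measure (\<lambda>x. \<bar>f x\<bar>) \<le> norm_L2 f"
proof -
  have a: "L2 (\<lambda>x. \<bar>f x\<bar>)" using assms by (auto simp: L2_def)
  have "\<bar>inner_L2 (\<lambda>x. \<bar>f x\<bar>) (\<lambda>_. 1)\<bar> \<le> norm_L2 (\<lambda>x. \<bar>f x\<bar>) * norm_L2 (\<lambda>_. 1)"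
    by (rule L2_Cauchy_Schwarz[OF a L2_const])
  also have "norm_L2 (\<lambda>x. \<bar>f x\<bar>) = norm_L2 f" by (simp add: norm_L2_def inner_L2_def)
  finally show ?thesis by (simp add: norm_L2_const inner_L2_def)
qed

text \<open>The factor \<open>k\<close> is taken out by its supremum, and on a probability space the
  L1 norm is below the L2 norm. With \<open>k\<close> a difference of two rows of \<open>w\<close>,
  this turns the Lipschitz condition on \<open>w\<close> into smoothness of integrals.\<close>

lemma integral_bounded_mult_le:
  assumes "L2 f" "k \<in> borel_measurable unit_measure" "\<And>y. y \<in> {0..1} \<Longrightarrow> \<bar>k y\<bar> \<le> B"
  shows "\<bar>integral\<^sup>L unit_measure (\<lambda>y. k y * f y)\<bar> \<le> B * norm_L2 f"
proof -
  have B: "B \<ge> 0" using assms(3)[of 0] by auto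
  have i: "integrable unit_measure (\<lambda>y. k y * f y)"
    by (rule L2_integrable[OF L2_mult_bounded[OF assms]])
  have "\<bar>integral\<^sup>L unit_measure (\<lambda>y. k y * f y)\<bar> \<le> integral\<^sup>L unit_measure (\<lambda>y. \<bar>k y * f y\<bar>)"
    by (rule integral_abs_bound)
  also have "\<dots> \<le> integral\<^sup>L unit_measure (\<lambda>y. B * \<bar>f y\<bar>)"
    using assms(3) integrable_abs[OF i] L2_integrable[OF assms(1)]
    by (intro integral_mono) (auto simp: abs_mult intro!: mult_right_mono)
  also have "\<dots> = B * integral\<^sup>L unit_measure (\<lambda>y. \<bar>f y\<bar>)" by simp
  also have "\<dots> \<le> B * norm_L2 f"
    using integral_abs_le_norm_L2[OF assms(1)] B by (intro mult_left_mono)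
  finally show ?thesis .
qed

section \<open>The graphon Laplacian\<close>

text \<open>The integral operator inside the Laplacian, defined at every point and not only almost
  everywhere, so that its images are genuine continuous functions.\<close>

definition kernel_op :: "(real \<Rightarrow> real \<Rightarrow> real) \<Rightarrow> (real \<Rightarrow> real) \<Rightarrow> real \<Rightarrow> real" where
  "kernel_op w f x = (\<integral>y. w x y * f y \<partial>unit_measure)"

lemma continuous_on_abs_le:
  fixes f :: "real \<Rightarrow> real"
  assumes "\<And>x y. x \<in> S \<Longrightarrow> y \<in> S \<Longrightarrow> \<bar>f x - f y\<bar> \<le> C * \<bar>x - y\<bar>"
  shows "continuous_on S f"
proof -
  have "(max C 0)-lipschitz_on S f"
  proof (rule lipschitz_onI)
    fix x y assume "x \<in> S" "y \<in> S"
    then have "\<bar>f x - f y\<bar> \<le> C * \<bar>x - y\<bar>" by (rule assms)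
    also have "\<dots> \<le> max C 0 * \<bar>x - y\<bar>" by (intro mult_right_mono) auto
    finally show "dist (f x) (f y) \<le> max C 0 * dist x y" by (simp add: dist_real_def)
  qed auto
  then show ?thesis by (rule lipschitz_on_continuous_on)
qed

locale lipschitz_graphon =
  fixes w :: "real \<Rightarrow> real \<Rightarrow> real" and K :: real
  assumes K_pos: "K > 0"
    and w_sym: "\<And>x y. x \<in> {0..1} \<Longrightarrow> y \<in> {0..1} \<Longrightarrow> w x y = w y x"
    and w_nonneg: "\<And>x y. x \<in> {0..1} \<Longrightarrow> y \<in> {0..1} \<Longrightarrow> 0 \<le> w x y"
    and w_le_1: "\<And>x y. x \<in> {0..1} \<Longrightarrow> y \<in> {0..1} \<Longrightarrow> w x y \<le> 1"
    and w_lipschitz: "\<And>x y x' y'. x \<in> {0..1} \<Longrightarrow> y \<in> {0..1} \<Longrightarrow> x' \<in> {0..1} \<Longrightarrow> y' \<in> {0..1} \<Longrightarrow>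
      \<bar>w x y - w x' y'\<bar> \<le> K * (\<bar>x - x'\<bar> + \<bar>y - y'\<bar>)"
begin

abbreviation deg :: "real \<Rightarrow> real" where "deg \<equiv> graphon_degree w"

abbreviation lap :: "(real \<Rightarrow> real) \<Rightarrow> real \<Rightarrow> real" where "lap \<equiv> graphon_lap w"

lemma w_abs: "x \<in> {0..1} \<Longrightarrow> y \<in> {0..1} \<Longrightarrow> \<bar>w x y\<bar> \<le> 1"
  using w_nonneg[of x y] w_le_1[of x y] by simp

lemma w_slice_continuous: "x \<in> {0..1} \<Longrightarrow> continuous_on {0..1} (w x)"
  using w_lipschitz[of x _ x] by (intro continuous_on_abs_le[where C = K]) auto

lemma w_slice_measurable: "x \<in> {0..1} \<Longrightarrow> w x \<in> borel_measurable unit_measure"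
  by (intro continuous_measurable_unit w_slice_continuous)

lemma L2_w_mult: "x \<in> {0..1} \<Longrightarrow> L2 f \<Longrightarrow> L2 (\<lambda>y. w x y * f y)"
  using w_abs by (intro L2_mult_bounded[where B = 1] w_slice_measurable) auto

lemma kernel_op_bound:
  assumes "L2 f" "x \<in> {0..1}"
  shows "\<bar>kernel_op w f x\<bar> \<le> norm_L2 f"
  unfolding kernel_op_def
  using integral_bounded_mult_le[OF assms(1) w_slice_measurable, of x 1] w_abs assms by simp

lemma kernel_op_diff_arg:
  assumes "L2 f" "x \<in> {0..1}" "x' \<in> {0..1}"
  shows "kernel_op w f x - kernel_op w f x' = (\<integral>y. (w x y - w x' y) * f y \<partial>unit_measure)"
  unfolding kernel_op_def
  using L2_integrable[OF L2_w_mult[OF assms(2,1)]] L2_integrable[OF L2_w_mult[OF assms(3,1)]]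
  by (simp add: left_diff_distrib)

text \<open>The modulus depends on \<open>f\<close> only through its norm, so bounded sequences have
  equicontinuous images. This is the source of all compactness used below.\<close>

lemma kernel_op_lipschitz:
  assumes "L2 f" "x \<in> {0..1}" "x' \<in> {0..1}"
  shows "\<bar>kernel_op w f x - kernel_op w f x'\<bar> \<le> K * norm_L2 f * \<bar>x - x'\<bar>"
proof -
  have "\<bar>w x y - w x' y\<bar> \<le> K * \<bar>x - x'\<bar>" if "y \<in> {0..1}" for y
    using w_lipschitz[of x y x' y] that assms by simp
  from integral_bounded_mult_le[OF assms(1) _ this] show ?thesis
    unfolding kernel_op_diff_arg[OF assms]
    using w_slice_measurable assms by (simp add: mult_ac)
qed

lemma kernel_op_continuous: "L2 f \<Longrightarrow> continuous_on {0..1} (kernel_op w f)"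
  by (rule continuous_on_abs_le[where C = "K * norm_L2 f"]) (rule kernel_op_lipschitz)

lemma kernel_op_L2: "L2 f \<Longrightarrow> L2 (kernel_op w f)"
  by (rule L2_continuous[OF kernel_op_continuous])

lemma kernel_op_diff:
  assumes "L2 f" "L2 g" "x \<in> {0..1}"
  shows "kernel_op w (\<lambda>x. f x - g x) x = kernel_op w f x - kernel_op w g x"
  unfolding kernel_op_def
  using L2_integrable[OF L2_w_mult[OF assms(3,1)]] L2_integrable[OF L2_w_mult[OF assms(3,2)]]
  by (simp add: right_diff_distrib)

lemma kernel_op_add:
  assumes "L2 f" "L2 g" "x \<in> {0..1}"
  shows "kernel_op w (\<lambda>x. f x + g x) x = kernel_op w f x + kernel_op w g x"
  unfolding kernel_op_def
  using L2_integrable[OF L2_w_mult[OF assms(3,1)]] L2_integrable[OF L2_w_mult[OF assms(3,2)]]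
  by (simp add: distrib_left)

lemma kernel_op_cmult: "kernel_op w (\<lambda>x. c * f x) x = c * kernel_op w f x"
  unfolding kernel_op_def by (simp add: mult.left_commute)

lemma deg_eq: "deg x = kernel_op w (\<lambda>_. 1) x"
  by (simp add: graphon_degree_def kernel_op_def)

lemma deg_nonneg: "x \<in> {0..1} \<Longrightarrow> deg x \<ge> 0"
  unfolding graphon_degree_def using w_nonneg by (intro integral_nonneg_AE AE_I2) auto

lemma deg_le_1: "x \<in> {0..1} \<Longrightarrow> deg x \<le> 1"
  using kernel_op_bound[of "\<lambda>_. 1" x] by (simp add: deg_eq norm_L2_const)

lemma deg_lipschitz:
  "x \<in> {0..1} \<Longrightarrow> x' \<in> {0..1} \<Longrightarrow> \<bar>deg x - deg x'\<bar> \<le> K * \<bar>x - x'\<bar>"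
  using kernel_op_lipschitz[of "\<lambda>_. 1" x x'] by (simp add: deg_eq norm_L2_const)

lemma deg_continuous: "continuous_on {0..1} deg"
  using deg_lipschitz by (rule continuous_on_abs_le)

lemma lap_eq:
  assumes "L2 f" "x \<in> {0..1}"
  shows "lap f x = deg x * f x - kernel_op w f x"
proof -
  have "integrable unit_measure (\<lambda>y. w x y * f x)"
    using L2_integrable[OF L2_w_mult[OF assms(2) L2_const[of "f x"]]] .
  then show ?thesis
    unfolding graphon_lap_def graphon_degree_def kernel_op_def
    using L2_integrable[OF L2_w_mult[OF assms(2,1)]] by (simp add: right_diff_distrib)
qed

lemma L2_deg_mult: "L2 f \<Longrightarrow> L2 (\<lambda>x. deg x * f x)"
  using deg_nonneg deg_le_1
  by (intro L2_mult_bounded[where B = 1] continuous_measurable_unit deg_continuous)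
     (auto simp: abs_le_iff intro: order_trans[of _ 0])

lemma lap_L2:
  assumes "L2 f" shows "L2 (lap f)"
proof -
  have "L2 (\<lambda>x. deg x * f x - kernel_op w f x)"
    using assms by (intro L2_diff L2_deg_mult kernel_op_L2)
  then show ?thesis using L2_cong[of "lap f"] lap_eq[OF assms] by simp
qed

lemma lap_norm_le:
  assumes "L2 f" shows "norm_L2 (lap f) \<le> 2 * norm_L2 f"
proof -
  have "norm_L2 (lap f) = norm_L2 (\<lambda>x. deg x * f x - kernel_op w f x)"
    using lap_eq[OF assms] by (intro norm_L2_cong)
  also have "\<dots> \<le> norm_L2 (\<lambda>x. deg x * f x) + norm_L2 (kernel_op w f)"
    using assms by (intro norm_L2_triangle_diff L2_deg_mult kernel_op_L2)
  also have "norm_L2 (\<lambda>x. deg x * f x) \<le> norm_L2 f"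
    using assms deg_nonneg deg_le_1
    by (intro norm_L2_mono L2_deg_mult) (auto simp: abs_mult intro!: mult_left_le_one_le)
  also have "norm_L2 (kernel_op w f) \<le> norm_L2 f"
    using kernel_op_bound[OF assms] assms by (intro norm_L2_sup kernel_op_L2)
  finally show ?thesis by simp
qed

lemma lap_diff:
  assumes "L2 f" "L2 g" "x \<in> {0..1}"
  shows "lap (\<lambda>x. f x - g x) x = lap f x - lap g x"
  using assms by (simp add: lap_eq L2_diff kernel_op_diff algebra_simps)

lemma lap_add:
  assumes "L2 f" "L2 g" "x \<in> {0..1}"
  shows "lap (\<lambda>x. f x + g x) x = lap f x + lap g x"
  using assms by (simp add: lap_eq L2_add kernel_op_add algebra_simps)

lemma lap_cmult:
  assumes "L2 f" "x \<in> {0..1}"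
  shows "lap (\<lambda>x. c * f x) x = c * lap f x"
  using assms by (simp add: lap_eq L2_cmult kernel_op_cmult algebra_simps)

lemma lap_const: "lap (\<lambda>_. c) x = 0"
  by (simp add: graphon_lap_def)

lemma w_joint_measurable:
  "(\<lambda>(x, y). w x y) \<in> borel_measurable (unit_measure \<Otimes>\<^sub>M unit_measure)"
proof -
  \<comment> \<open>Nothing is known about \<open>w\<close> outside the unit square. Clamping both
    arguments to [0,1] gives a function that is Lipschitz on the whole plane, hence Borel, and
    agrees with \<open>w\<close> where it matters.\<close>
  define c :: "real \<Rightarrow> real" where "c x = max 0 (min 1 x)" for x
  have c: "c x \<in> {0..1}" "\<bar>c x - c y\<bar> \<le> \<bar>x - y\<bar>" for x y
    by (auto simp: c_def)
  have "continuous_on UNIV (\<lambda>z. w (c (fst z)) (c (snd z)))"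
  proof (rule lipschitz_on_continuous_on[where L = "2 * K"], rule lipschitz_onI)
    fix z z' :: "real \<times> real"
    have "\<bar>w (c (fst z)) (c (snd z)) - w (c (fst z')) (c (snd z'))\<bar>
      \<le> K * (\<bar>c (fst z) - c (fst z')\<bar> + \<bar>c (snd z) - c (snd z')\<bar>)"
      using c by (intro w_lipschitz)
    also have "\<dots> \<le> K * (dist z z' + dist z z')"
      using c(2)[of "fst z" "fst z'"] c(2)[of "snd z" "snd z'"] dist_fst_le[of z z'] dist_snd_le[of z z'] K_pos
      by (intro mult_left_mono add_mono) (auto simp: dist_real_def)
    finally show "dist (w (c (fst z)) (c (snd z))) (w (c (fst z')) (c (snd z'))) \<le> 2 * K * dist z z'"
      by (simp add: dist_real_def)
  qed (use K_pos in auto)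
  then have m: "(\<lambda>z. w (c (fst z)) (c (snd z))) \<in> borel_measurable (borel \<Otimes>\<^sub>M borel)"
    unfolding borel_prod by (rule borel_measurable_continuous_onI)
  have id: "(\<lambda>x::real. x) \<in> borel_measurable unit_measure"
    by (intro continuous_measurable_unit continuous_intros)
  have "(\<lambda>z. (fst z, snd z)) \<in> unit_measure \<Otimes>\<^sub>M unit_measure \<rightarrow>\<^sub>M borel \<Otimes>\<^sub>M borel"
    using measurable_compose[OF measurable_fst id] measurable_compose[OF measurable_snd id]
    by (intro measurable_Pair)
  from measurable_compose[OF this m]
  have "(\<lambda>z. w (c (fst z)) (c (snd z))) \<in> borel_measurable (unit_measure \<Otimes>\<^sub>M unit_measure)"
    by simp
  then show ?thesis
    by (rule measurable_cong[THEN iffD1, rotated]) (auto simp: space_pair_measure c_def)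
qed

lemma kernel_op_symmetric:
  assumes "L2 f" "L2 g"
  shows "inner_L2 (kernel_op w f) g = inner_L2 f (kernel_op w g)"
proof -
  note [measurable] = w_joint_measurable L2_measurable[OF assms(1)] L2_measurable[OF assms(2)]
  note fi = L2_integrable[OF assms(1)] and gi = L2_integrable[OF assms(2)]
  have m: "(\<lambda>(x, y). w x y * f y * g x) \<in> borel_measurable (unit_measure \<Otimes>\<^sub>M unit_measure)"
    by measurable
  \<comment> \<open>Since \<open>\<bar>w\<bar> <= 1\<close> on the square, the product of two
    integrable functions dominates the integrand in Fubini's theorem.\<close>
  have "integrable (unit_measure \<Otimes>\<^sub>M unit_measure) (\<lambda>(x, y). f y * g x)"
  proof (rule unit_pair.Fubini_integrable)
    show "integrable unit_measure (\<lambda>x. \<integral>y. norm (case (x, y) of (x, y) \<Rightarrow> f y * g x) \<partial>unit_measure)"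
      using gi fi by (simp add: abs_mult)
  qed (use fi in simp_all)
  then have i: "integrable (unit_measure \<Otimes>\<^sub>M unit_measure) (\<lambda>(x, y). w x y * f y * g x)"
  proof (rule Bochner_Integration.integrable_bound[OF _ m], intro AE_I2)
    fix z assume "z \<in> space (unit_measure \<Otimes>\<^sub>M unit_measure)"
    then show "norm (case z of (x, y) \<Rightarrow> w x y * f y * g x) \<le> norm (case z of (x, y) \<Rightarrow> f y * g x)"
      using w_abs by (auto simp: space_pair_measure abs_mult mult.assoc intro!: mult_left_le_one_le)
  qed
  have "inner_L2 (kernel_op w f) g = (\<integral>x. (\<integral>y. w x y * f y * g x \<partial>unit_measure) \<partial>unit_measure)"
    unfolding inner_L2_def kernel_op_def by simp
  also have "\<dots> = (\<integral>y. (\<integral>x. w x y * f y * g x \<partial>unit_measure) \<partial>unit_measure)"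
    using unit_pair.Fubini_integral[OF i] by simp
  also have "\<dots> = (\<integral>y. (\<integral>x. f y * (w y x * g x) \<partial>unit_measure) \<partial>unit_measure)"
    by (intro unit_integral_cong) (simp add: w_sym mult_ac)
  also have "\<dots> = inner_L2 f (kernel_op w g)"
    unfolding inner_L2_def kernel_op_def by simp
  finally show ?thesis .
qed

lemma lap_symmetric:
  assumes "L2 f" "L2 g"
  shows "inner_L2 (lap f) g = inner_L2 f (lap g)"
proof -
  note l = L2_deg_mult[OF assms(1)] L2_deg_mult[OF assms(2)]
    kernel_op_L2[OF assms(1)] kernel_op_L2[OF assms(2)]
  have "inner_L2 (lap f) g = inner_L2 (\<lambda>x. deg x * f x - kernel_op w f x) g"
    using lap_eq[OF assms(1)] by (intro inner_L2_cong) auto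
  also have "\<dots> = inner_L2 (\<lambda>x. deg x * f x) g - inner_L2 f (kernel_op w g)"
    using inner_L2_diff_left[OF l(1) l(3) assms(2)] kernel_op_symmetric[OF assms] by simp
  also have "inner_L2 (\<lambda>x. deg x * f x) g = inner_L2 f (\<lambda>x. deg x * g x)"
    unfolding inner_L2_def by (intro unit_integral_cong) simp
  also have "\<dots> - inner_L2 f (kernel_op w g) = inner_L2 f (\<lambda>x. deg x * g x - kernel_op w g x)"
    using inner_L2_diff_right[OF l(2) l(4) assms(1)] by simp
  also have "\<dots> = inner_L2 f (lap g)"
    using lap_eq[OF assms(2)] by (intro inner_L2_cong) auto
  finally show ?thesis .
qed

lemma lap_orthogonal_const: "L2 f \<Longrightarrow> inner_L2 (lap f) (\<lambda>_. c) = 0"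
  unfolding lap_symmetric[OF _ L2_const] by (simp add: lap_const inner_L2_def)

text \<open>The multiplication part of \<open>L - m\<close> is invertible below the infimum of the degree and the
  kernel part maps bounded sequences to equicontinuous ones, so approximate eigenfunctions
  subconverge to eigenfunctions; the same holds for approximate solutions of \<open>(L - m) f = h\<close>.\<close>

lemma approximate_solutions_subconverge:
  assumes f: "\<And>n. L2 (f n)" and B: "\<And>n. norm_L2 (f n) \<le> B"
    and c: "c > 0" "\<forall>x\<in>{0..1}. c \<le> deg x - m"
    and h: "L2 h"
    and lim: "(\<lambda>n. norm_L2 (\<lambda>x. lap (f n) x - m * f n x - h x)) \<longlonglongrightarrow> 0"
  shows "\<exists>g r. strict_mono (r :: nat \<Rightarrow> nat) \<and> L2 g \<and>
    (continuous_on {0..1} h \<longrightarrow> continuous_on {0..1} g) \<and>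
    (\<forall>x\<in>{0..1}. lap g x - m * g x = h x) \<and>
    (\<lambda>n. norm_L2 (\<lambda>x. f (r n) x - g x)) \<longlonglongrightarrow> 0"
proof -
  have B0: "B \<ge> 0" using B[of 0] norm_L2_nonneg[of "f 0"] by linarith
  obtain u r where u: "continuous_on {0..1} u" and r: "strict_mono (r::nat\<Rightarrow>nat)"
    and conv: "\<And>e. 0 < e \<Longrightarrow> \<exists>N. \<forall>n x. n \<ge> N \<and> x \<in> {0..1} \<longrightarrow> norm (kernel_op w (f (r n)) x - u x) < e"
  proof (rule Arzela_Ascoli[of "{0..1::real}" "\<lambda>n. kernel_op w (f n)" B])
    show "norm (kernel_op w (f n) x) \<le> B" if "x \<in> {0..1}" for n x
      using kernel_op_bound[OF f that, of n] B[of n] by simp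
    fix x e :: real assume x: "x \<in> {0..1}" and e: "0 < e"
    show "\<exists>d>0. \<forall>n y. y \<in> {0..1} \<and> norm (x - y) < d \<longrightarrow>
        norm (kernel_op w (f n) x - kernel_op w (f n) y) < e"
    proof (intro exI conjI allI impI)
      \<comment> \<open>\<open>B + 1\<close> in place of \<open>B\<close> keeps the denominator
        positive when \<open>B = 0\<close>.\<close>
      show "e / (K * (B + 1)) > 0" using e B0 K_pos by simp
      fix n y assume y: "y \<in> {0..1} \<and> norm (x - y) < e / (K * (B + 1))"
      have "\<bar>kernel_op w (f n) x - kernel_op w (f n) y\<bar> \<le> K * norm_L2 (f n) * \<bar>x - y\<bar>"
        using x y f by (intro kernel_op_lipschitz) auto
      also have "\<dots> \<le> K * (B + 1) * \<bar>x - y\<bar>"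
        using B[of n] K_pos B0 by (intro mult_right_mono mult_left_mono) auto
      also have "\<dots> < e" using y B0 K_pos by (simp add: pos_less_divide_eq mult.commute)
      finally show "norm (kernel_op w (f n) x - kernel_op w (f n) y) < e" by simp
    qed
  qed auto
  have u2: "L2 u" by (rule L2_continuous[OF u])
  \<comment> \<open>Solves \<open>(deg - m) g = h + u\<close>, with \<open>u\<close> the uniform
    limit of the kernel images. That \<open>u\<close> is the kernel image of \<open>g\<close> itself
    can be shown only after convergence to \<open>g\<close> is known.\<close>
  define g where "g x = (h x + u x) / (deg x - m)" for x
  have dm: "deg x - m > 0" if "x \<in> {0..1}" for x using bspec[OF c(2) that] c(1) by simp
  have g: "continuous_on {0..1} g" if "continuous_on {0..1} h"
    unfolding g_def using dm by (intro continuous_intros u deg_continuous that) force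
  have g2: "L2 g"
  proof -
    have "(\<lambda>x. 1 / (deg x - m)) \<in> borel_measurable unit_measure"
      using dm by (intro continuous_measurable_unit continuous_intros deg_continuous) force
    moreover have "\<bar>1 / (deg x - m)\<bar> \<le> 1 / c" if "x \<in> {0..1}" for x
      using dm[OF that] c that by (simp add: field_simps)
    ultimately have "L2 (\<lambda>x. 1 / (deg x - m) * (h x + u x))"
      using h u2 by (intro L2_mult_bounded[where B = "1 / c"] L2_add)
    then show ?thesis by (simp add: g_def[abs_def])
  qed
  define k where "k = 1 / c"
  have k: "k > 0" using c(1) by (simp add: k_def)
  let ?res = "\<lambda>n x. lap (f n) x - m * f n x - h x"
  have res2: "L2 (?res n)" for n using f h by (intro L2_diff lap_L2 L2_cmult)
  have est: "norm_L2 (\<lambda>x. f n x - g x) \<le> k * (norm_L2 (?res n) + norm_L2 (\<lambda>x. kernel_op w (f n) x - u x))" for n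
  proof -
    \<comment> \<open>The residual says that \<open>(deg - m) * f n\<close> is the residual plus
      \<open>h\<close> plus the kernel image of \<open>f n\<close>; subtracting the equation of
      \<open>g\<close> cancels \<open>h\<close>.\<close>
    have eq: "f n x - g x = (?res n x + (kernel_op w (f n) x - u x)) / (deg x - m)" if "x \<in> {0..1}" for x
      using dm[OF that] that lap_eq[OF f that] by (simp add: g_def field_simps)
    have l: "L2 (\<lambda>x. ?res n x + (kernel_op w (f n) x - u x))"
      using f u2 by (intro L2_add res2 L2_diff kernel_op_L2)
    have "norm_L2 (\<lambda>x. f n x - g x) \<le> norm_L2 (\<lambda>x. k * (?res n x + (kernel_op w (f n) x - u x)))"
    proof (rule norm_L2_mono)
      fix x :: real assume x: "x \<in> {0..1}"
      have "\<bar>f n x - g x\<bar> = \<bar>?res n x + (kernel_op w (f n) x - u x)\<bar> / (deg x - m)"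
        unfolding eq[OF x] using dm[OF x] by (simp add: abs_divide)
      also have "\<dots> \<le> \<bar>?res n x + (kernel_op w (f n) x - u x)\<bar> / c"
        using c dm[OF x] x by (intro divide_left_mono mult_pos_pos) auto
      finally show "\<bar>f n x - g x\<bar> \<le> \<bar>k * (?res n x + (kernel_op w (f n) x - u x))\<bar>"
        using c(1) by (simp add: abs_mult k_def)
    qed (use f g2 l in \<open>auto intro!: L2_diff L2_cmult\<close>)
    also have "\<dots> = k * norm_L2 (\<lambda>x. ?res n x + (kernel_op w (f n) x - u x))"
      using k norm_L2_cmult[of k "\<lambda>x. ?res n x + (kernel_op w (f n) x - u x)"] by simp
    also have "\<dots> \<le> k * (norm_L2 (?res n) + norm_L2 (\<lambda>x. kernel_op w (f n) x - u x))"
      using k f u2 by (intro mult_left_mono norm_L2_triangle res2 L2_diff kernel_op_L2) auto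
    finally show ?thesis .
  qed
  have ulim: "(\<lambda>n. norm_L2 (\<lambda>x. kernel_op w (f (r n)) x - u x)) \<longlonglongrightarrow> 0"
  proof (rule LIMSEQ_I)
    fix e :: real assume "e > 0"
    then obtain N where N: "\<And>n x. n \<ge> N \<Longrightarrow> x \<in> {0..1} \<Longrightarrow> norm (kernel_op w (f (r n)) x - u x) < e / 2"
      using conv[of "e / 2"] by auto
    show "\<exists>N. \<forall>n\<ge>N. norm (norm_L2 (\<lambda>x. kernel_op w (f (r n)) x - u x) - 0) < e"
    proof (intro exI allI impI)
      fix n assume "n \<ge> N"
      then have "norm_L2 (\<lambda>x. kernel_op w (f (r n)) x - u x) \<le> e / 2"
        using N[of n] f u2 by (intro norm_L2_sup L2_diff kernel_op_L2) (auto intro: less_imp_le)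
      then show "norm (norm_L2 (\<lambda>x. kernel_op w (f (r n)) x - u x) - 0) < e"
        using \<open>e > 0\<close> by simp
    qed
  qed
  have glim: "(\<lambda>n. norm_L2 (\<lambda>x. f (r n) x - g x)) \<longlonglongrightarrow> 0"
  proof (rule tendsto_sandwich[OF _ _ tendsto_const])
    show "(\<lambda>n. k * (norm_L2 (?res (r n)) + norm_L2 (\<lambda>x. kernel_op w (f (r n)) x - u x))) \<longlonglongrightarrow> 0"
      using LIMSEQ_subseq_LIMSEQ[OF lim r] ulim
      by (intro tendsto_mult_right_zero tendsto_add_zero) (simp_all add: o_def)
  qed (use est in \<open>auto intro!: always_eventually\<close>)
  \<comment> \<open>Both sides are limits of the same sequence of kernel values: uniformly by the
    choice of \<open>u\<close>, and through L2 convergence by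
    \<open>kernel_op_bound\<close>.\<close>
  have "u x = kernel_op w g x" if x: "x \<in> {0..1}" for x
  proof (rule LIMSEQ_unique)
    show "(\<lambda>n. kernel_op w (f (r n)) x) \<longlonglongrightarrow> u x"
    proof (rule LIMSEQ_I)
      fix e :: real assume "e > 0"
      then show "\<exists>N. \<forall>n\<ge>N. norm (kernel_op w (f (r n)) x - u x) < e"
        using conv[of e] x by blast
    qed
    have "(\<lambda>n. kernel_op w (f (r n)) x - kernel_op w g x) \<longlonglongrightarrow> 0"
    proof (rule Lim_null_comparison[OF always_eventually glim], rule allI)
      fix n
      show "norm (kernel_op w (f (r n)) x - kernel_op w g x) \<le> norm_L2 (\<lambda>x. f (r n) x - g x)"
        using kernel_op_bound[OF L2_diff[OF f g2] x, of "r n"] kernel_op_diff[OF f g2 x] by simp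
    qed
    then show "(\<lambda>n. kernel_op w (f (r n)) x) \<longlonglongrightarrow> kernel_op w g x"
      by (rule LIM_zero_cancel)
  qed
  then have "lap g x - m * g x = h x" if "x \<in> {0..1}" for x
  proof -
    have "g x * (deg x - m) = h x + kernel_op w g x"
      using dm[OF that] \<open>\<And>x. x \<in> {0..1} \<Longrightarrow> u x = kernel_op w g x\<close>[OF that] by (simp add: g_def)
    then show ?thesis using lap_eq[OF g2 that] by (simp add: algebra_simps)
  qed
  then show ?thesis using r g2 g glim by (intro exI[of _ g] exI[of _ r]) simp
qed

text \<open>The homogeneous case. Here \<open>h = 0\<close> is continuous, so the limit is
  continuous and satisfies the eigenvalue equation at every point.\<close>

lemma approximate_eigenfunctions_subconverge:
  assumes f: "\<And>n. L2 (f n)" and B: "\<And>n. norm_L2 (f n) \<le> B"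
    and c: "c > 0" "\<forall>x\<in>{0..1}. c \<le> deg x - m"
    and lim: "(\<lambda>n. norm_L2 (\<lambda>x. lap (f n) x - m * f n x)) \<longlonglongrightarrow> 0"
  obtains g and r :: "nat \<Rightarrow> nat" where "strict_mono r" "continuous_on {0..1} g"
    "\<And>x. x \<in> {0..1} \<Longrightarrow> lap g x = m * g x"
    "(\<lambda>n. norm_L2 (\<lambda>x. f (r n) x - g x)) \<longlonglongrightarrow> 0"
proof -
  have lim0: "(\<lambda>n. norm_L2 (\<lambda>x. lap (f n) x - m * f n x - 0)) \<longlonglongrightarrow> 0" using lim by simp
  obtain g and r :: "nat \<Rightarrow> nat" where g: "strict_mono r" "continuous_on {0..1} g"
    "\<forall>x\<in>{0..1}. lap g x = m * g x"
    and conv: "(\<lambda>n. norm_L2 (\<lambda>x. f (r n) x - g x)) \<longlonglongrightarrow> 0"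
    using approximate_solutions_subconverge[OF f B c L2_const lim0] by auto
  show thesis by (rule that[OF g(1,2) bspec[OF g(3)] conv])
qed

end

section \<open>Limits in L2 and the variational construction of eigenfunctions\<close>

lemma has_integral_unit_measure:
  "integrable unit_measure f \<Longrightarrow> (f has_integral integral\<^sup>L unit_measure f) {0..1}" for f :: "real \<Rightarrow> real"
  by (rule has_integral_integral_lebesgue_on) auto

lemma nonneg_continuous_integral_zero:
  fixes g :: "real \<Rightarrow> real"
  assumes "continuous_on {0..1} g" "\<And>x. x \<in> {0..1} \<Longrightarrow> 0 \<le> g x"
    "integral\<^sup>L unit_measure g = 0" "x \<in> {0..1}"
  shows "g x = 0"
proof (rule has_integral_0_cbox_imp_0[of 0 1 g])
  show "(g has_integral 0) (cbox 0 1)"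
    using has_integral_unit_measure[OF L2_integrable[OF L2_continuous[OF assms(1)]]] assms(3) by simp
qed (use assms in auto)

lemma continuous_AE_zero:
  fixes g :: "real \<Rightarrow> real"
  assumes g: "continuous_on {0..1} g" and ae: "AE x in unit_measure. g x = 0" and x: "x \<in> {0..1}"
  shows "g x = 0"
proof -
  have "integral\<^sup>L unit_measure (\<lambda>x. \<bar>g x\<bar>) = integral\<^sup>L unit_measure (\<lambda>_. 0)"
    using ae continuous_measurable_unit[OF g] by (intro integral_cong_AE) auto
  then have "\<bar>g x\<bar> = 0"
    using x g by (intro nonneg_continuous_integral_zero[of "\<lambda>x. \<bar>g x\<bar>"] continuous_intros) auto
  then show ?thesis by simp
qed

lemma inner_L2_tendsto:
  assumes "\<And>n. L2 (f n)" "L2 g" "L2 h" "(\<lambda>n. norm_L2 (\<lambda>x. f n x - g x)) \<longlonglongrightarrow> 0"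
  shows "(\<lambda>n. inner_L2 (f n) h) \<longlonglongrightarrow> inner_L2 g h"
proof (rule LIM_zero_cancel, rule Lim_null_comparison[OF always_eventually])
  show "\<forall>n. norm (inner_L2 (f n) h - inner_L2 g h) \<le> norm_L2 (\<lambda>x. f n x - g x) * norm_L2 h"
    using L2_Cauchy_Schwarz[OF L2_diff[OF assms(1,2)] assms(3)]
    by (simp add: inner_L2_diff_left[OF assms(1,2,3)])
  show "(\<lambda>n. norm_L2 (\<lambda>x. f n x - g x) * norm_L2 h) \<longlonglongrightarrow> 0"
    using assms(4) by (rule tendsto_mult_left_zero)
qed

lemma norm_L2_tendsto:
  assumes "\<And>n. L2 (f n)" "L2 g" "(\<lambda>n. norm_L2 (\<lambda>x. f n x - g x)) \<longlonglongrightarrow> 0"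
  shows "(\<lambda>n. norm_L2 (f n)) \<longlonglongrightarrow> norm_L2 g"
proof (rule LIM_zero_cancel, rule Lim_null_comparison[OF always_eventually assms(3)], rule allI)
  fix n
  have "norm_L2 (f n) \<le> norm_L2 (\<lambda>x. f n x - g x) + norm_L2 g"
    using norm_L2_triangle[OF L2_diff[OF assms(1,2)] assms(2), of n] by simp
  moreover have "norm_L2 g \<le> norm_L2 (f n) + norm_L2 (\<lambda>x. f n x - g x)"
    using norm_L2_triangle_diff[OF assms(1) L2_diff[OF assms(1,2)], of n n] by simp
  ultimately show "norm (norm_L2 (f n) - norm_L2 g) \<le> norm_L2 (\<lambda>x. f n x - g x)" by simp
qed

context lipschitz_graphon
begin

lemma lap_form_le:
  assumes "L2 f" shows "inner_L2 (lap f) f \<le> 2 * (norm_L2 f)\<^sup>2" "- 2 * (norm_L2 f)\<^sup>2 \<le> inner_L2 (lap f) f"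
proof -
  have "\<bar>inner_L2 (lap f) f\<bar> \<le> norm_L2 (lap f) * norm_L2 f"
    using L2_Cauchy_Schwarz[OF lap_L2[OF assms] assms] .
  also have "\<dots> \<le> 2 * norm_L2 f * norm_L2 f"
    using lap_norm_le[OF assms] by (intro mult_right_mono) auto
  finally have "\<bar>inner_L2 (lap f) f\<bar> \<le> 2 * (norm_L2 f)\<^sup>2" by (simp add: power2_eq_square)
  then show "inner_L2 (lap f) f \<le> 2 * (norm_L2 f)\<^sup>2" "- 2 * (norm_L2 f)\<^sup>2 \<le> inner_L2 (lap f) f"
    by linarith+
qed

text \<open>Cauchy--Schwarz for the nonnegative form of \<open>L - m\<close> on the invariant subspace \<open>S\<^sup>\<bottom>\<close>,
  applied to \<open>f\<close> and \<open>(L - m) f\<close>.\<close>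

lemma residual_le_form:
  assumes S: "\<And>s. s \<in> S \<Longrightarrow> L2 s" "\<And>s. s \<in> S \<Longrightarrow> \<exists>\<kappa>. \<forall>x\<in>{0..1}. lap s x = \<kappa> * s x"
    and form: "\<And>f. L2 f \<Longrightarrow> (\<And>s. s \<in> S \<Longrightarrow> inner_L2 f s = 0) \<Longrightarrow> m * inner_L2 f f \<le> inner_L2 (lap f) f"
    and f: "L2 f" "\<And>s. s \<in> S \<Longrightarrow> inner_L2 f s = 0"
  shows "(norm_L2 (\<lambda>x. lap f x - m * f x))\<^sup>2
    \<le> (2 + \<bar>m\<bar>) * (inner_L2 (lap f) f - m * inner_L2 f f)"
proof -
  define h where "h x = lap f x - m * f x" for x
  have lf: "L2 (lap f)" and mf: "L2 (\<lambda>x. m * f x)" using f(1) by (auto intro: lap_L2)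
  have h: "L2 h" unfolding h_def by (intro L2_diff lf mf)
  have hi: "inner_L2 h g = inner_L2 (lap f) g - m * inner_L2 f g" if "L2 g" for g
    unfolding h_def inner_L2_diff_left[OF lf mf that] by (simp add: inner_L2_cmult_left)
  have hS: "inner_L2 h s = 0" if s: "s \<in> S" for s
  proof -
    obtain \<kappa> where \<kappa>: "\<forall>x\<in>{0..1}. lap s x = \<kappa> * s x" using S(2)[OF s] by auto
    have "inner_L2 (lap f) s = inner_L2 f (lap s)" by (rule lap_symmetric[OF f(1) S(1)[OF s]])
    also have "\<dots> = inner_L2 f (\<lambda>x. \<kappa> * s x)" using \<kappa> by (intro inner_L2_cong) auto
    also have "\<dots> = 0" using f(2)[OF s] by (simp add: inner_L2_cmult_right)
    finally show ?thesis using hi[OF S(1)[OF s]] f(2)[OF s] by simp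
  qed
  let ?B = "\<lambda>f g. inner_L2 (lap f) g - m * inner_L2 f g"
  have "(?B f h)\<^sup>2 \<le> ?B f f * ?B h h"
  proof (rule discriminant_le)
    fix t :: real
    let ?g = "\<lambda>x. f x + t * h x"
    have th: "L2 (\<lambda>x. t * h x)" using h by auto
    have g: "L2 ?g" using f(1) th by auto
    have lg: "inner_L2 (lap ?g) g' = inner_L2 (lap f) g' + t * inner_L2 (lap h) g'" if "L2 g'" for g'
    proof -
      have "inner_L2 (lap ?g) g' = inner_L2 (\<lambda>x. lap f x + t * lap h x) g'"
        using f(1) h th by (intro inner_L2_cong) (auto simp: lap_add lap_cmult)
      then show ?thesis
        using inner_L2_add_left[OF lf L2_cmult[OF lap_L2[OF h]] that] by (simp add: inner_L2_cmult_left)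
    qed
    have "m * inner_L2 ?g ?g \<le> inner_L2 (lap ?g) ?g"
    proof (rule form[OF g])
      fix s assume s: "s \<in> S"
      show "inner_L2 ?g s = 0"
        using inner_L2_add_left[OF f(1) th S(1)[OF s]] f(2)[OF s] hS[OF s] by (simp add: inner_L2_cmult_left)
    qed
    moreover have "inner_L2 (lap ?g) ?g = inner_L2 (lap f) f + 2 * t * inner_L2 (lap f) h + t\<^sup>2 * inner_L2 (lap h) h"
    proof -
      have "inner_L2 (lap ?g) ?g = (inner_L2 (lap f) f + t * inner_L2 (lap f) h) + t * (inner_L2 (lap h) f + t * inner_L2 (lap h) h)"
        unfolding lg[OF g] inner_L2_add_right[OF f(1) th lf] inner_L2_add_right[OF f(1) th lap_L2[OF h]]
        by (simp add: inner_L2_cmult_right)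
      also have "inner_L2 (lap h) f = inner_L2 (lap f) h"
        using lap_symmetric[OF h f(1)] by (simp add: inner_L2_commute)
      finally show ?thesis by (simp add: algebra_simps power2_eq_square)
    qed
    ultimately show "0 \<le> ?B f f + 2 * t * ?B f h + t\<^sup>2 * ?B h h"
      unfolding inner_L2_square_add[OF f(1) h] by (simp add: algebra_simps)
  qed
  moreover have "?B f h = (norm_L2 h)\<^sup>2"
    using hi[OF h] by (simp add: norm_L2_sq)
  moreover have "?B h h \<le> (2 + \<bar>m\<bar>) * (norm_L2 h)\<^sup>2"
  proof -
    have "- m * (norm_L2 h)\<^sup>2 \<le> \<bar>m\<bar> * (norm_L2 h)\<^sup>2" by (intro mult_right_mono) auto
    then show ?thesis using lap_form_le(1)[OF h] by (simp add: norm_L2_sq algebra_simps)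
  qed
  moreover have "?B f f \<ge> 0" using form[OF f] by simp
  ultimately have "((norm_L2 h)\<^sup>2)\<^sup>2 \<le> ?B f f * ?B h h"
    "?B f f * ?B h h \<le> ?B f f * ((2 + \<bar>m\<bar>) * (norm_L2 h)\<^sup>2)"
    by (simp_all only: mult_left_mono)
  then have "((norm_L2 h)\<^sup>2)\<^sup>2 \<le> ?B f f * ((2 + \<bar>m\<bar>) * (norm_L2 h)\<^sup>2)"
    by (rule order_trans)
  then have "(norm_L2 h)\<^sup>2 * (norm_L2 h)\<^sup>2 \<le> ((2 + \<bar>m\<bar>) * ?B f f) * (norm_L2 h)\<^sup>2"
    by (simp add: power2_eq_square mult_ac)
  then have "(norm_L2 h)\<^sup>2 \<le> (2 + \<bar>m\<bar>) * ?B f f"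
  proof (cases "norm_L2 h = 0")
    case True
    then show ?thesis using \<open>?B f f \<ge> 0\<close> by simp
  next
    case False
    then have "0 < (norm_L2 h)\<^sup>2" by simp
    then show ?thesis
      using \<open>(norm_L2 h)\<^sup>2 * (norm_L2 h)\<^sup>2 \<le> _\<close> by (simp only: mult_le_cancel_right_pos)
  qed
  then show ?thesis by (simp add: h_def[abs_def])
qed

text \<open>By \<open>residual_le_form\<close>, Rayleigh quotients tending to the minimum
  \<open>m\<close> force the residuals to zero, so a limit function exists. The set \<open>S\<close>
  holds the eigenfunctions already split off: with the constants alone it yields the first
  nonconstant eigenfunction, with one more function it serves the spectral gap.\<close>

lemma minimizing_sequence_eigenfunction:
  assumes S: "\<And>s. s \<in> S \<Longrightarrow> L2 s" "\<And>s. s \<in> S \<Longrightarrow> \<exists>\<kappa>. \<forall>x\<in>{0..1}. lap s x = \<kappa> * s x"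
    and form: "\<And>f. L2 f \<Longrightarrow> (\<And>s. s \<in> S \<Longrightarrow> inner_L2 f s = 0) \<Longrightarrow> m * inner_L2 f f \<le> inner_L2 (lap f) f"
    and f: "\<And>n::nat. L2 (f n)" "\<And>n s. s \<in> S \<Longrightarrow> inner_L2 (f n) s = 0" "\<And>n. norm_L2 (f n) = 1"
    and lim: "(\<lambda>n. inner_L2 (lap (f n)) (f n)) \<longlonglongrightarrow> m"
    and c: "c > 0" "\<And>x. x \<in> {0..1} \<Longrightarrow> c \<le> deg x - m"
  shows "\<exists>g. continuous_on {0..1} g \<and> (\<forall>x\<in>{0..1}. lap g x = m * g x) \<and>
    norm_L2 g = 1 \<and> (\<forall>s\<in>S. inner_L2 g s = 0)"
proof -
  let ?h = "\<lambda>n x. lap (f n) x - m * f n x"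
  have sq: "inner_L2 (f n) (f n) = 1" for n using f(3)[of n] norm_L2_sq[of "f n"] by simp
  have "(\<lambda>n. (norm_L2 (?h n))\<^sup>2) \<longlonglongrightarrow> 0"
  proof (rule tendsto_sandwich[OF _ _ tendsto_const])
    show "(\<lambda>n. (2 + \<bar>m\<bar>) * (inner_L2 (lap (f n)) (f n) - m)) \<longlonglongrightarrow> 0"
      by (intro tendsto_mult_right_zero LIM_zero lim)
    have "(norm_L2 (?h n))\<^sup>2 \<le> (2 + \<bar>m\<bar>) * (inner_L2 (lap (f n)) (f n) - m)" for n
    proof -
      have "(norm_L2 (?h n))\<^sup>2 \<le> (2 + \<bar>m\<bar>) * (inner_L2 (lap (f n)) (f n) - m * inner_L2 (f n) (f n))"
        by (rule residual_le_form[where S = S]) (fact S form f)+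
      then show ?thesis by (simp add: sq)
    qed
    then show "\<forall>\<^sub>F n in sequentially. (norm_L2 (?h n))\<^sup>2 \<le> (2 + \<bar>m\<bar>) * (inner_L2 (lap (f n)) (f n) - m)"
      by (intro always_eventually allI)
  qed auto
  then have "(\<lambda>n. sqrt ((norm_L2 (?h n))\<^sup>2)) \<longlonglongrightarrow> sqrt 0" by (rule tendsto_real_sqrt)
  then have "(\<lambda>n. norm_L2 (?h n)) \<longlonglongrightarrow> 0" by simp
  note nlim = this
  have cb: "\<forall>x\<in>{0..1}. c \<le> deg x - m" using c(2) by blast
  obtain g and r :: "nat \<Rightarrow> nat" where g: "strict_mono r" "continuous_on {0..1} g"
    "\<And>x. x \<in> {0..1} \<Longrightarrow> lap g x = m * g x" and conv: "(\<lambda>n. norm_L2 (\<lambda>x. f (r n) x - g x)) \<longlonglongrightarrow> 0"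
    using approximate_eigenfunctions_subconverge[OF f(1) eq_refl[OF f(3)] c(1) cb nlim] by blast
  have g2: "L2 g" using g(2) by (rule L2_continuous)
  have "norm_L2 g = 1"
    using norm_L2_tendsto[OF f(1) g2 conv] f(3) by (simp add: LIMSEQ_const_iff)
  moreover have "inner_L2 g s = 0" if "s \<in> S" for s
    using inner_L2_tendsto[OF f(1) g2 S(1)[OF that] conv] f(2)[OF that] by (simp add: LIMSEQ_const_iff)
  ultimately show ?thesis using g by blast
qed

text \<open>The left side of (A4), written exactly as in that assumption. It is shown below to be
  the second eigenvalue.\<close>

definition bottom :: real where
  "bottom = (INF f\<in>{f. L2 f \<and> (\<integral>x. f x \<partial>unit_measure) = 0 \<and> inner_L2 f f = 1}. inner_L2 (lap f) f)"

lemma bottom_bdd_below: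
  "bdd_below ((\<lambda>f. inner_L2 (lap f) f) ` {f. L2 f \<and> (\<integral>x. f x \<partial>unit_measure) = 0 \<and> inner_L2 f f = 1})"
proof (rule bdd_belowI2)
  fix f assume f: "f \<in> {f. L2 f \<and> (\<integral>x. f x \<partial>unit_measure) = 0 \<and> inner_L2 f f = 1}"
  then have "(norm_L2 f)\<^sup>2 = 1" by (simp add: norm_L2_sq)
  then show "- 2 \<le> inner_L2 (lap f) f"
    using f lap_form_le(2)[of f] by simp
qed

lemma bottom_le_form:
  assumes f: "L2 f" "inner_L2 f (\<lambda>_. 1) = 0"
  shows "bottom * inner_L2 f f \<le> inner_L2 (lap f) f"
proof (cases "norm_L2 f = 0")
  case True
  then have "inner_L2 f f = 0" using norm_L2_sq[of f] by simp
  then show ?thesis using lap_form_le(2)[OF f(1)] True by simp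
next
  case False
  define k where "k = 1 / norm_L2 f"
  have k: "k > 0" using False norm_L2_nonneg[of f] by (simp add: k_def less_le)
  have kk: "k * (k * inner_L2 f f) = 1"
    using False by (simp add: k_def norm_L2_sq[symmetric] power2_eq_square)
  have "bottom \<le> inner_L2 (lap (\<lambda>x. k * f x)) (\<lambda>x. k * f x)"
    unfolding bottom_def
  proof (intro cINF_lower bottom_bdd_below CollectI conjI)
    show "integral\<^sup>L unit_measure (\<lambda>x. k * f x) = 0" using f(2) by (simp add: inner_L2_def)
    show "L2 (\<lambda>x. k * f x)" using f(1) by (rule L2_cmult)
    show "inner_L2 (\<lambda>x. k * f x) (\<lambda>x. k * f x) = 1"
      unfolding inner_L2_cmult_left inner_L2_cmult_right by (rule kk)
  qed
  also have "\<dots> = inner_L2 (\<lambda>x. k * lap f x) (\<lambda>x. k * f x)"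
    using f by (intro inner_L2_cong) (auto simp: lap_cmult)
  also have "\<dots> = k * (k * inner_L2 (lap f) f)"
    by (simp add: inner_L2_cmult_left inner_L2_cmult_right)
  finally have "bottom * (norm_L2 f)\<^sup>2 \<le> (k * (k * inner_L2 (lap f) f)) * (norm_L2 f)\<^sup>2"
    by (intro mult_right_mono) auto
  also have "\<dots> = inner_L2 (lap f) f"
    using False by (simp add: k_def power2_eq_square)
  finally have "bottom * (norm_L2 f)\<^sup>2 \<le> inner_L2 (lap f) f" .
  then show ?thesis by (simp add: norm_L2_sq)
qed

lemma bottom_eigenfunction:
  assumes c: "c > 0" "\<And>x. x \<in> {0..1} \<Longrightarrow> c \<le> deg x - bottom"
  obtains g where "continuous_on {0..1} g" "\<And>x. x \<in> {0..1} \<Longrightarrow> lap g x = bottom * g x"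
    "norm_L2 g = 1" "inner_L2 g (\<lambda>_. 1) = 0"
proof -
  let ?H = "{f. L2 f \<and> (\<integral>x. f x \<partial>unit_measure) = 0 \<and> inner_L2 f f = 1}"
  \<comment> \<open>The function with values -1 and 1 on the two halves shows that normalised
    functions of mean zero exist; otherwise the infimum would carry no information.\<close>
  define s :: "real \<Rightarrow> real" where "s x = 1 - 2 * indicator {0..1/2} x" for x
  have ind: "indicat_real {0..1/2} \<in> borel_measurable unit_measure"
    by (intro borel_measurable_indicator) (auto simp: sets_restrict_space)
  then have sm: "s \<in> borel_measurable unit_measure"
    unfolding s_def[abs_def] by (intro borel_measurable_diff borel_measurable_times) auto
  have s2: "L2 s" by (rule L2_bounded[OF sm, of 1]) (auto simp: s_def split: split_indicator)
  have "measure unit_measure {0..1/2::real} = 1/2"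
    by (subst measure_restrict_space) auto
  moreover have "integral\<^sup>L unit_measure s = 1 - 2 * integral\<^sup>L unit_measure (indicator {0..1/2::real})"
    unfolding s_def[abs_def] using unit.prob_space
    by (subst Bochner_Integration.integral_diff)
       (auto simp: ind intro!: integrable_mult_right unit.integrable_const_bound[where B=1])
  ultimately have s0: "integral\<^sup>L unit_measure s = 0" by (simp add: Int_absorb2)
  have "inner_L2 s s = inner_L2 (\<lambda>_. 1) (\<lambda>_. 1)"
    unfolding inner_L2_def by (intro unit_integral_cong) (auto simp: s_def split: split_indicator)
  then have s1: "inner_L2 s s = 1" using norm_L2_const[of 1] norm_L2_sq[of "\<lambda>_. 1"] by simp
  have ne: "?H \<noteq> {}" using s2 s0 s1 by auto
  have ex: "\<exists>f. f \<in> ?H \<and> inner_L2 (lap f) f < bottom + 1 / real (Suc n)" for n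
  proof -
    have "bottom < bottom + 1 / real (Suc n)" by simp
    then show ?thesis
      using cINF_less_iff[OF ne bottom_bdd_below, of "bottom + 1 / real (Suc n)"]
      unfolding bottom_def[symmetric] by blast
  qed
  define f where "f n = (SOME f. f \<in> ?H \<and> inner_L2 (lap f) f < bottom + 1 / real (Suc n))" for n
  have f: "f n \<in> ?H" "inner_L2 (lap (f n)) (f n) < bottom + 1 / real (Suc n)" for n
    using someI_ex[OF ex[of n]] unfolding f_def by blast+
  have f1: "inner_L2 (f n) (\<lambda>_. 1) = 0" for n using f(1)[of n] by (simp add: inner_L2_def)
  have lim: "(\<lambda>n. inner_L2 (lap (f n)) (f n)) \<longlonglongrightarrow> bottom"
  proof (rule tendsto_sandwich[OF _ _ tendsto_const])
    show "(\<lambda>n. bottom + 1 / real (Suc n)) \<longlonglongrightarrow> bottom"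
      using LIMSEQ_inverse_real_of_nat_add[of bottom] by (simp add: inverse_eq_divide)
    show "\<forall>\<^sub>F n in sequentially. bottom \<le> inner_L2 (lap (f n)) (f n)"
    proof (intro always_eventually allI)
      fix n show "bottom \<le> inner_L2 (lap (f n)) (f n)"
        using bottom_le_form[OF _ f1, of n] f(1)[of n] by simp
    qed
    show "\<forall>\<^sub>F n in sequentially. inner_L2 (lap (f n)) (f n) \<le> bottom + 1 / real (Suc n)"
      by (intro always_eventually allI less_imp_le f(2))
  qed
  have S1: "L2 s" if "s \<in> {\<lambda>_. 1}" for s :: "real \<Rightarrow> real"
    using that by auto
  have S2: "\<exists>\<kappa>. \<forall>x\<in>{0..1}. lap s x = \<kappa> * s x" if "s \<in> {\<lambda>_. 1}" for s
    using that lap_const by (intro exI[of _ 0]) auto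
  have S3: "bottom * inner_L2 h h \<le> inner_L2 (lap h) h"
    if "L2 h" "\<And>s. s \<in> {\<lambda>_. 1} \<Longrightarrow> inner_L2 h s = 0" for h
    by (rule bottom_le_form[OF that(1) that(2)]) simp
  have f2: "L2 (f n)" "norm_L2 (f n) = 1" for n using f(1)[of n] by (simp_all add: norm_L2_def)
  have f3: "inner_L2 (f n) s = 0" if "s \<in> {\<lambda>_. 1}" for s n using that f1 by simp
  have "\<exists>g. continuous_on {0..1} g \<and> (\<forall>x\<in>{0..1}. lap g x = bottom * g x) \<and>
    norm_L2 g = 1 \<and> (\<forall>s\<in>{\<lambda>_. 1}. inner_L2 g s = 0)"
    by (rule minimizing_sequence_eigenfunction[where f = f and c = c]) (fact S1 S2 S3 f2 f3 lim c)+
  then obtain g where "continuous_on {0..1} g" "\<forall>x\<in>{0..1}. lap g x = bottom * g x"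
    "norm_L2 g = 1" "inner_L2 g (\<lambda>_. 1) = 0"
    by blast
  then show thesis using that by blast
qed

end

section \<open>The bottom eigenvalue\<close>

context lipschitz_graphon
begin

text \<open>Subtracting \<open>q u\<close> inside the integral absorbs the change of the degree.
  What remains is a local term, in which only \<open>q\<close> moves, and a nonlocal term, in which
  only \<open>w\<close> moves. Lipschitz continuity, the derivative and the variation estimate are
  all read off from this identity.\<close>

lemma residual_increment:
  assumes q: "L2 q" and uv: "u \<in> {0..1}" "v \<in> {0..1}"
  shows "(lap q v - m * q v) - (lap q u - m * q u)
    = (deg v - m) * (q v - q u) - (\<integral>y. (w v y - w u y) * (q y - q u) \<partial>unit_measure)"
proof -
  have "L2 (\<lambda>y. q y - q u)" using q by (intro L2_diff L2_const)
  then have "(\<integral>y. (w v y - w u y) * (q y - q u) \<partial>unit_measure)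
    = kernel_op w (\<lambda>y. q y - q u) v - kernel_op w (\<lambda>y. q y - q u) u"
    using kernel_op_diff_arg uv by simp
  also have "\<dots> = (kernel_op w q v - deg v * q u) - (kernel_op w q u - deg u * q u)"
    using uv q kernel_op_cmult[of "q u" "\<lambda>_. 1"]
    by (simp add: kernel_op_diff L2_const deg_eq mult.commute)
  finally show ?thesis
    using lap_eq[OF q uv(1)] lap_eq[OF q uv(2)] by (simp add: algebra_simps)
qed

end

section \<open>Monotonicity of Robinsonian graphons and positivity of the bottom\<close>

locale robinson_graphon = lipschitz_graphon +
  assumes robinson: "robinsonian w"
    and derivative_nonzero: "\<And>x. x \<in> {0..1} \<Longrightarrow> AE y in unit_measure.
      \<exists>D. ((\<lambda>t. w t y) has_real_derivative D) (at x within {0..1}) \<and> D \<noteq> 0"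
    and bottom_less: "bottom < (INF x\<in>{0..1}. deg x)"
begin

text \<open>A uniform lower bound for \<open>deg - bottom\<close>, the multiplication part of the
  shifted Laplacian; its positivity is assumption (A4).\<close>

definition margin :: real where "margin = (INF x\<in>{0..1}. deg x) - bottom"

lemma margin_pos: "margin > 0"
  using bottom_less by (simp add: margin_def)

lemma margin_le:
  assumes "x \<in> {0..1}" shows "margin \<le> deg x - bottom"
proof -
  have "(INF x\<in>{0..1}. deg x) \<le> deg x"
    using assms deg_nonneg by (intro cINF_lower bdd_belowI2[where m = 0]) auto
  then show ?thesis by (simp add: margin_def)
qed

lemma deg_minus_bottom_pos: "x \<in> {0..1} \<Longrightarrow> deg x - bottom > 0"
  using margin_le[of x] margin_pos by simp

text \<open>The Robinson property speaks of the second argument and of strictly ordered points.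
  Symmetry moves it to the first argument, and Lipschitz continuity adds the case
  \<open>t = y\<close> on the diagonal.\<close>

lemma w_mono_left:
  assumes "0 \<le> s" "s \<le> t" "t \<le> y" "y \<le> 1"
  shows "w s y \<le> w t y"
proof -
  have strict: "w s' y \<le> w t' y" if "0 \<le> s'" "s' < t'" "t' < y" for s' t'
  proof -
    have "w y s' \<le> w y t'"
      using robinson that assms unfolding robinsonian_def by auto
    then show ?thesis using that assms w_sym[of y s'] w_sym[of y t'] by auto
  qed
  consider "s = t" | "s < t" "t < y" | "s < t" "t = y" using assms by linarith
  then show ?thesis
  proof cases
    case 3
    show ?thesis
    proof (rule field_le_epsilon)
      fix e :: real assume e: "e > 0"
      \<comment> \<open>Strictly between \<open>s\<close> and \<open>y\<close>, yet within
        \<open>e / K\<close> of \<open>y\<close>, so that passing to the diagonal costs at most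
        \<open>e\<close>.\<close>
      define t' where "t' = max ((s + y) / 2) (y - e / K)"
      have t': "s < t'" "t' < y" "y - t' \<le> e / K"
        using 3 divide_pos_pos[OF e K_pos] by (auto simp: t'_def less_max_iff_disj)
      have "w s y \<le> w t' y" using strict[of s t'] t' assms by auto
      also have "\<dots> \<le> w y y + K * (y - t')"
        using w_lipschitz[of t' y y y] t' assms by auto
      also have "K * (y - t') \<le> e" using t'(3) K_pos by (simp add: field_simps)
      finally show "w s y \<le> w t y + e" using 3 by simp
    qed
  qed (use strict assms in auto)
qed

lemma w_mono_right:
  assumes "0 \<le> y" "y \<le> s" "s \<le> t" "t \<le> 1"
  shows "w t y \<le> w s y"
proof -
  have strict: "w t' y \<le> w s' y" if "y < s'" "s' < t'" "t' \<le> 1" for s' t'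
  proof -
    have "w y t' \<le> w y s'"
      using robinson that assms unfolding robinsonian_def by auto
    then show ?thesis using that assms w_sym[of y s'] w_sym[of y t'] by auto
  qed
  consider "s = t" | "y < s" "s < t" | "y = s" "s < t" using assms by linarith
  then show ?thesis
  proof cases
    case 3
    show ?thesis
    proof (rule field_le_epsilon)
      fix e :: real assume e: "e > 0"
      define s' where "s' = min ((s + t) / 2) (y + e / K)"
      have s': "y < s'" "s' < t" "s' - y \<le> e / K"
        using 3 divide_pos_pos[OF e K_pos] by (auto simp: s'_def min_less_iff_disj)
      have "w t y \<le> w s' y" using strict[of s' t] s' assms by auto
      also have "\<dots> \<le> w y y + K * (s' - y)"
        using w_lipschitz[of s' y y y] s' assms by auto
      also have "K * (s' - y) \<le> e" using s'(3) K_pos by (simp add: field_simps)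
      finally show "w t y \<le> w s y + e" using 3 by simp
    qed
  qed (use strict assms in auto)
qed

text \<open>Every row is largest on the diagonal, so a zero there makes the whole row and its degree
  vanish.\<close>

lemma w_diag_pos:
  assumes "deg x > 0" "x \<in> {0..1}" shows "w x x > 0"
proof (rule ccontr)
  assume "\<not> 0 < w x x"
  then have 0: "w x x = 0" using w_nonneg[of x x] assms by simp
  have "w x y = 0" if "y \<in> {0..1}" for y
  proof -
    have "w y x \<le> w x x"
      using w_mono_left[of y x x] w_mono_right[of x x y] that assms by (cases "y \<le> x") auto
    then show ?thesis using 0 w_nonneg[of x y] w_sym[of x y] that assms by simp
  qed
  then have "deg x = integral\<^sup>L unit_measure (\<lambda>_. 0)"
    unfolding graphon_degree_def by (intro unit_integral_cong) auto
  then show False using assms by simp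
qed

text \<open>Maximum principle: at a maximum of \<open>f\<close> the Laplacian is nonnegative, and it vanishes only
  if \<open>f\<close> is constant near that point.\<close>

lemma bottom_pos: "bottom > 0"
proof (rule ccontr)
  assume neg: "\<not> bottom > 0"
  obtain f where f: "continuous_on {0..1} f" "\<And>x. x \<in> {0..1} \<Longrightarrow> lap f x = bottom * f x"
    "norm_L2 f = 1" "inner_L2 f (\<lambda>_. 1) = 0"
    using bottom_eigenfunction[OF margin_pos margin_le] by blast
  obtain x0 where x0: "x0 \<in> {0..1}" "\<And>y. y \<in> {0..1} \<Longrightarrow> f y \<le> f x0"
    using continuous_attains_sup[of "{0..1::real}" f] f(1) by auto
  have pos: "f x0 > 0"
  proof (rule ccontr)
    assume "\<not> f x0 > 0"
    then have "0 \<le> - f y" if "y \<in> {0..1}" for y using x0(2)[OF that] by simp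
    moreover have "integral\<^sup>L unit_measure (\<lambda>y. - f y) = 0" using f(4) by (simp add: inner_L2_def)
    ultimately have "- f y = 0" if "y \<in> {0..1}" for y
      using that f(1) by (intro nonneg_continuous_integral_zero[of "\<lambda>y. - f y"] continuous_intros) auto
    then have "norm_L2 f = norm_L2 (\<lambda>_. 0)" by (intro norm_L2_cong) auto
    then show False using f(3) by (simp add: norm_L2_const)
  qed
  have max: "w x y * (f x - f y) = 0 \<and> bottom = 0"
    if x: "x \<in> {0..1}" "f x = f x0" and y: "y \<in> {0..1}" for x y
  proof -
    have nn: "0 \<le> w x y * (f x - f y)" if "y \<in> {0..1}" for y
      using w_nonneg[OF x(1) that] x0(2)[OF that] x(2) by simp
    then have ge: "0 \<le> lap f x"
      unfolding graphon_lap_def by (intro integral_nonneg_AE AE_I2) auto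
    have eq: "lap f x = bottom * f x0" using f(2)[OF x(1)] x(2) by simp
    have "bottom = 0"
      using ge eq neg pos by (simp add: zero_le_mult_iff)
    then have "integral\<^sup>L unit_measure (\<lambda>y. w x y * (f x - f y)) = 0"
      using eq by (simp add: graphon_lap_def)
    moreover have "continuous_on {0..1} (\<lambda>y. w x y * (f x - f y))"
      by (rule continuous_on_mult[OF w_slice_continuous[OF x(1)] continuous_on_diff[OF continuous_on_const f(1)]])
    ultimately have "w x y * (f x - f y) = 0"
      using nn y by (intro nonneg_continuous_integral_zero[of "\<lambda>y. w x y * (f x - f y)"])
    then show ?thesis using \<open>bottom = 0\<close> by simp
  qed
  have b0: "bottom = 0" using max[OF x0(1) refl x0(1)] by simp
  \<comment> \<open>The set of maximum points is closed by continuity, and open because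
    \<open>w\<close> is positive near the diagonal. Connectedness makes \<open>f\<close> constant,
    which contradicts mean zero and a positive maximum.\<close>
  let ?S = "{x \<in> {0..1}. f x = f x0}"
  have cl: "closedin (top_of_set {0..1}) ?S"
    using f(1) by (rule continuous_closedin_preimage_constant)
  have op: "openin (top_of_set {0..1}) ?S"
    unfolding openin_contains_ball
  proof (intro conjI ballI)
    fix x assume x: "x \<in> ?S"
    have wx: "w x x > 0"
      using x deg_minus_bottom_pos[of x] b0 by (intro w_diag_pos) auto
    have "f y = f x0" if y: "y \<in> {0..1}" "\<bar>x - y\<bar> < w x x / K" for y
    proof -
      have "w x x - w x y \<le> K * \<bar>x - y\<bar>" using w_lipschitz[of x x x y] x y by auto
      also have "\<dots> < w x x" using y K_pos by (simp add: field_simps)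
      finally have "w x y > 0" by simp
      then show ?thesis using max[of x y] x y by auto
    qed
    then show "\<exists>e>0. ball x e \<inter> {0..1} \<subseteq> ?S"
      using wx K_pos by (intro exI[of _ "w x x / K"]) (auto simp: dist_real_def)
  qed auto
  have conn: "connected {0..1::real}" by simp
  have "?S = {} \<or> ?S = {0..1}"
    by (rule connected_clopen[THEN iffD1, OF conn, rule_format, OF conjI[OF op cl]])
  moreover have "x0 \<in> ?S" using x0(1) by simp
  ultimately have S: "?S = {0..1}" by blast
  have "f x = f x0" if "x \<in> {0..1}" for x
    using subsetD[OF equalityD2[OF S] that] by simp
  then have "inner_L2 f (\<lambda>_. 1) = inner_L2 (\<lambda>_. f x0) (\<lambda>_. 1)" by (intro inner_L2_cong) auto
  also have "\<dots> = f x0" using unit.prob_space by (simp add: inner_L2_def)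
  finally show False using f(4) pos by simp
qed

text \<open>The eigenspace realised by continuous functions with the equation at every point. The
  zero function is included, so the class is closed under linear combinations.\<close>

definition bottom_eigenfn :: "(real \<Rightarrow> real) \<Rightarrow> bool" where
  "bottom_eigenfn f \<longleftrightarrow> continuous_on {0..1} f \<and> (\<forall>x\<in>{0..1}. lap f x = bottom * f x) \<and>
     inner_L2 f (\<lambda>_. 1) = 0"

lemma bottom_eigenfnD:
  assumes "bottom_eigenfn f"
  shows "continuous_on {0..1} f" "L2 f" "x \<in> {0..1} \<Longrightarrow> lap f x = bottom * f x"
    "inner_L2 f (\<lambda>_. 1) = 0"
  using assms by (auto simp: bottom_eigenfn_def intro: L2_continuous)

lemma bottom_eigenfn_combine:
  assumes f: "bottom_eigenfn f" and g: "bottom_eigenfn g"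
  shows "bottom_eigenfn (\<lambda>x. f x + t * g x)"
  unfolding bottom_eigenfn_def
proof (intro conjI ballI)
  note ff = bottom_eigenfnD[OF f] and gg = bottom_eigenfnD[OF g]
  show "continuous_on {0..1} (\<lambda>x. f x + t * g x)"
    using ff(1) gg(1) by (intro continuous_intros)
  show "lap (\<lambda>x. f x + t * g x) x = bottom * (f x + t * g x)" if "x \<in> {0..1}" for x
    using that lap_add[OF ff(2) L2_cmult[OF gg(2)] that] lap_cmult[OF gg(2) that] ff(3) gg(3)
    by (simp add: algebra_simps)
  show "inner_L2 (\<lambda>x. f x + t * g x) (\<lambda>_. 1) = 0"
    using inner_L2_add_left[OF ff(2) L2_cmult[OF gg(2)] L2_const[of 1]] ff(4) gg(4)
    by (simp add: inner_L2_cmult_left)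
qed

lemma bottom_eigenfn_increment:
  assumes "bottom_eigenfn f" "u \<in> {0..1}" "v \<in> {0..1}"
  shows "(deg v - bottom) * (f v - f u) = (\<integral>y. (w v y - w u y) * (f y - f u) \<partial>unit_measure)"
  using residual_increment[OF bottom_eigenfnD(2)[OF assms(1)] assms(2,3), of bottom]
    bottom_eigenfnD(3)[OF assms(1)] assms by simp

text \<open>Solving the increment identity for \<open>f v - f u\<close> and dividing by
  \<open>deg - bottom >= margin\<close> transfers the Lipschitz bound of \<open>w\<close> to
  \<open>f\<close>.\<close>

lemma bottom_eigenfn_lipschitz:
  assumes f: "bottom_eigenfn f"
  obtains C where "C \<ge> 0" "\<And>x y. x \<in> {0..1} \<Longrightarrow> y \<in> {0..1} \<Longrightarrow> \<bar>f x - f y\<bar> \<le> C * \<bar>x - y\<bar>"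
proof -

  have "bounded (f ` {0..1})"
    using bottom_eigenfnD(1)[OF f] by (intro compact_imp_bounded compact_continuous_image) auto
  then obtain B where "\<forall>y\<in>f ` {0..1}. norm y \<le> B" unfolding bounded_iff by blast
  then have B: "\<bar>f x\<bar> \<le> B" if "x \<in> {0..1}" for x using that by simp
  have B0: "B \<ge> 0" using B[of 0] by simp
  show thesis
  proof (rule that[of "K * (2 * B) / margin"])
    show "0 \<le> K * (2 * B) / margin" using K_pos B0 margin_pos by simp
    fix v u :: real assume uv: "v \<in> {0..1}" "u \<in> {0..1}"
    have l: "L2 (\<lambda>y. f y - f u)" using bottom_eigenfnD(2)[OF f] by (intro L2_diff L2_const)
    have "\<bar>f y - f u\<bar> \<le> 2 * B" if "y \<in> {0..1}" for y using B[OF that] B[OF uv(2)] by linarith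
    then have n: "norm_L2 (\<lambda>y. f y - f u) \<le> 2 * B" using l by (rule norm_L2_sup[rotated])
    have "\<bar>(deg v - bottom) * (f v - f u)\<bar> \<le> (K * \<bar>v - u\<bar>) * norm_L2 (\<lambda>y. f y - f u)"
      unfolding bottom_eigenfn_increment[OF f uv(2,1)]
    proof (rule integral_bounded_mult_le[OF l])
      show "(\<lambda>y. w v y - w u y) \<in> borel_measurable unit_measure"
        using w_slice_measurable uv by (intro borel_measurable_diff) auto
      show "\<bar>w v y - w u y\<bar> \<le> K * \<bar>v - u\<bar>" if "y \<in> {0..1}" for y
        using w_lipschitz[of v y u y] uv that by simp
    qed
    also have "\<dots> \<le> (K * \<bar>v - u\<bar>) * (2 * B)" using n K_pos by (intro mult_left_mono) auto
    finally have "(deg v - bottom) * \<bar>f v - f u\<bar> \<le> K * \<bar>v - u\<bar> * (2 * B)"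
      using deg_minus_bottom_pos[OF uv(1)] by (simp add: abs_mult)
    moreover have "margin * \<bar>f v - f u\<bar> \<le> (deg v - bottom) * \<bar>f v - f u\<bar>"
      using margin_le[OF uv(1)] by (intro mult_right_mono) auto
    ultimately have "margin * \<bar>f v - f u\<bar> \<le> K * \<bar>v - u\<bar> * (2 * B)" by linarith
    then show "\<bar>f v - f u\<bar> \<le> K * (2 * B) / margin * \<bar>v - u\<bar>"
      using margin_pos by (simp add: field_simps)
  qed
qed

end

section \<open>Differentiability of eigenfunctions at the bottom\<close>

lemma at_unit_not_bot: "x \<in> {0..1} \<Longrightarrow> at x within {0..1} \<noteq> bot" for x :: real
  by (simp add: trivial_limit_within)

context robinson_graphon
begin

text \<open>A null sequence of nonzero increments that never leaves [0,1]: forward from the left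
  half, backward from the right half.\<close>

definition step_dir :: "real \<Rightarrow> nat \<Rightarrow> real" where
  "step_dir x n = (if x \<le> 1/2 then 1 else - 1) / (2 * real (Suc n))"

lemma step_dir:
  assumes "x \<in> {0..1}"
  shows "x + step_dir x n \<in> {0..1} - {x}" "(\<lambda>n. x + step_dir x n) \<longlonglongrightarrow> x"
proof -
  define d where "d = 1 / (2 * real (Suc n))"
  have "0 < d" "d \<le> 1/2" by (auto simp: d_def field_simps)
  moreover have "step_dir x n = (if x \<le> 1/2 then d else - d)" by (simp add: step_dir_def d_def)
  ultimately show "x + step_dir x n \<in> {0..1} - {x}" using assms by auto
  have "(\<lambda>n. ((if x \<le> 1/2 then 1 else - 1) / 2) * inverse (real (Suc n))) \<longlonglongrightarrow> ((if x \<le> 1/2 then 1 else - 1) / 2) * 0"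
    by (intro tendsto_mult_left LIMSEQ_inverse_real_of_nat)
  then have "(\<lambda>n. x + step_dir x n) \<longlonglongrightarrow> x + 0"
    by (intro tendsto_add tendsto_const) (simp add: step_dir_def[abs_def] field_simps)
  then show "(\<lambda>n. x + step_dir x n) \<longlonglongrightarrow> x" by simp
qed

text \<open>The partial derivative of \<open>w\<close> in its first argument, taken as the limit
  along one fixed sequence rather than by choice. This makes it measurable in \<open>y\<close>, and
  it is the true derivative wherever one exists.\<close>

definition wder :: "real \<Rightarrow> real \<Rightarrow> real" where
  "wder x y = lim (\<lambda>n. (w (x + step_dir x n) y - w x y) / step_dir x n)"

lemma wder_AE:
  assumes x: "x \<in> {0..1}"
  shows "AE y in unit_measure. ((\<lambda>t. w t y) has_real_derivative wder x y) (at x within {0..1}) \<and> wder x y \<noteq> 0"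
  using derivative_nonzero[OF x]
proof (rule AE_mp, intro AE_I2 impI)
  fix y
  assume "\<exists>D. ((\<lambda>t. w t y) has_real_derivative D) (at x within {0..1}) \<and> D \<noteq> 0"
  then obtain D where D: "((\<lambda>t. w t y) has_real_derivative D) (at x within {0..1})" "D \<noteq> 0" by auto
  have "((\<lambda>t. (w t y - w x y) / (t - x)) \<longlongrightarrow> D) (at x within {0..1})"
    using D(1) by (simp add: has_field_derivative_iff)
  from this[unfolded tendsto_at_iff_sequentially, THEN spec, of "\<lambda>n. x + step_dir x n"]
  have "((\<lambda>t. (w t y - w x y) / (t - x)) \<circ> (\<lambda>n. x + step_dir x n)) \<longlonglongrightarrow> D"
    using step_dir[OF x] by blast
  then have "wder x y = D" unfolding wder_def by (intro limI) (simp add: o_def)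
  then show "((\<lambda>t. w t y) has_real_derivative wder x y) (at x within {0..1}) \<and> wder x y \<noteq> 0"
    using D by simp
qed

lemma wder_measurable:
  assumes x: "x \<in> {0..1}" shows "wder x \<in> borel_measurable unit_measure"
proof -
  have "(\<lambda>y. lim (\<lambda>n. (w (x + step_dir x n) y - w x y) / step_dir x n)) \<in> borel_measurable unit_measure"
    using step_dir(1)[OF x] x
    by (intro borel_measurable_lim_metric borel_measurable_divide borel_measurable_diff
        borel_measurable_const w_slice_measurable) auto
  then show ?thesis by (simp add: wder_def[abs_def])
qed

lemma difference_quotient_bound:
  assumes "x \<in> {0..1}" "t \<in> {0..1}" "y \<in> {0..1}"
  shows "\<bar>(w t y - w x y) / (t - x)\<bar> \<le> K"
proof (cases "t = x")
  case False
  then show ?thesis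
    using w_lipschitz[of t y x y] assms by (simp add: abs_divide divide_le_eq)
qed (use K_pos in simp)

text \<open>By the Robinson property \<open>w t y\<close> increases in \<open>t\<close> up to
  \<open>y\<close> and decreases afterwards, which fixes the sign of every difference quotient near
  \<open>x\<close>.\<close>

lemma wder_sign:
  assumes x: "x \<in> {0..1}" and y: "y \<in> {0..1}"
    and D: "((\<lambda>t. w t y) has_real_derivative D) (at x within {0..1})"
  shows "x < y \<Longrightarrow> 0 \<le> D" "y < x \<Longrightarrow> D \<le> 0"
proof -
  have lim: "((\<lambda>t. (w t y - w x y) / (t - x)) \<longlongrightarrow> D) (at x within {0..1})"
    using D by (simp add: has_field_derivative_iff)
  show "0 \<le> D" if xy: "x < y"
  proof (rule tendsto_lowerbound[OF lim _ at_unit_not_bot[OF x]])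
    have "\<forall>\<^sub>F t in at x within {0..1}. t < y"
      using xy by (auto intro: order_tendstoD tendsto_ident_at)
    moreover have "\<forall>\<^sub>F t in at x within {0..1}. t \<in> {0..1}"
      by (auto simp: eventually_at_filter)
    ultimately show "\<forall>\<^sub>F t in at x within {0..1}. 0 \<le> (w t y - w x y) / (t - x)"
    proof eventually_elim
      case (elim t)
      show ?case
        using w_mono_left[of x t y] w_mono_left[of t x y] elim x y xy
        by (cases "x \<le> t") (auto intro!: divide_nonneg_nonneg divide_nonpos_nonpos)
    qed
  qed
  show "D \<le> 0" if xy: "y < x"
  proof (rule tendsto_upperbound[OF lim _ at_unit_not_bot[OF x]])
    have "\<forall>\<^sub>F t in at x within {0..1}. y < t"
      using xy by (auto intro: order_tendstoD tendsto_ident_at)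
    moreover have "\<forall>\<^sub>F t in at x within {0..1}. t \<in> {0..1}"
      by (auto simp: eventually_at_filter)
    ultimately show "\<forall>\<^sub>F t in at x within {0..1}. (w t y - w x y) / (t - x) \<le> 0"
    proof eventually_elim
      case (elim t)
      show ?case
        using w_mono_right[of y x t] w_mono_right[of y t x] elim x y xy
        by (cases "x \<le> t") (auto intro: divide_nonpos_nonneg divide_nonneg_nonpos)
    qed
  qed
qed

lemma wder_bound:
  assumes x: "x \<in> {0..1}" and y: "y \<in> {0..1}"
    and D: "((\<lambda>t. w t y) has_real_derivative D) (at x within {0..1})"
  shows "\<bar>D\<bar> \<le> K"
proof -
  have "((\<lambda>t. \<bar>(w t y - w x y) / (t - x)\<bar>) \<longlongrightarrow> \<bar>D\<bar>) (at x within {0..1})"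
    using D by (intro tendsto_rabs) (simp add: has_field_derivative_iff)
  moreover have "\<forall>\<^sub>F t in at x within {0..1}. \<bar>(w t y - w x y) / (t - x)\<bar> \<le> K"
    using difference_quotient_bound[OF x _ y] by (auto simp: eventually_at_filter)
  ultimately show ?thesis by (rule tendsto_upperbound[OF _ _ at_unit_not_bot[OF x]])
qed

text \<open>The increment identity for \<open>f\<close> divided by the increment, in the limit. No
  derivative of the degree enters, since the integrand contains \<open>f y - f x\<close> instead of
  \<open>f y\<close>.\<close>

definition eigder :: "(real \<Rightarrow> real) \<Rightarrow> real \<Rightarrow> real" where
  "eigder f x = (\<integral>y. wder x y * (f y - f x) \<partial>unit_measure) / (deg x - bottom)"

lemma continuous_bounded_unit:
  fixes f :: "real \<Rightarrow> real"
  assumes "continuous_on {0..1} f"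
  obtains B where "\<And>x. x \<in> {0..1} \<Longrightarrow> \<bar>f x\<bar> \<le> B"
proof -
  have "bounded (f ` {0..1})"
    using assms by (intro compact_imp_bounded compact_continuous_image) auto
  then obtain B where "\<forall>y\<in>f ` {0..1}. norm y \<le> B" unfolding bounded_iff by blast
  then have "\<bar>f x\<bar> \<le> B" if "x \<in> {0..1}" for x using that by simp
  then show thesis by (rule that)
qed

text \<open>Dominated convergence along sequences: the difference quotients of \<open>w\<close> are
  bounded by \<open>K\<close> and converge for almost every \<open>y\<close> by (A2), and the
  denominator converges by continuity of the degree.\<close>

lemma bottom_eigenfn_has_derivative:
  assumes f: "bottom_eigenfn f" and x: "x \<in> {0..1}"
  shows "(f has_real_derivative eigder f x) (at x within {0..1})"
  unfolding has_field_derivative_iff tendsto_at_iff_sequentially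
proof (intro allI impI)
  fix X :: "nat \<Rightarrow> real"
  assume X: "\<forall>i. X i \<in> {0..1} - {x}" "X \<longlonglongrightarrow> x"
  have X1: "X i \<in> {0..1}" "X i \<noteq> x" for i using X(1) by auto
  obtain B where B: "\<And>x. x \<in> {0..1} \<Longrightarrow> \<bar>f x\<bar> \<le> B"
    using continuous_bounded_unit[OF bottom_eigenfnD(1)[OF f]] by blast
  note fm = L2_measurable[OF L2_diff[OF bottom_eigenfnD(2)[OF f] L2_const[of "f x"]]]
  have "(\<lambda>n. \<integral>y. ((w (X n) y - w x y) / (X n - x)) * (f y - f x) \<partial>unit_measure)
    \<longlonglongrightarrow> (\<integral>y. wder x y * (f y - f x) \<partial>unit_measure)"
  proof (rule integral_dominated_convergence[where w = "\<lambda>_. K * (2 * B)"])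
    show "(\<lambda>y. wder x y * (f y - f x)) \<in> borel_measurable unit_measure"
      using wder_measurable[OF x] fm by (rule borel_measurable_times)
    show "(\<lambda>y. ((w (X n) y - w x y) / (X n - x)) * (f y - f x)) \<in> borel_measurable unit_measure" for n
      by (rule borel_measurable_times[OF borel_measurable_divide[OF borel_measurable_diff[OF
              w_slice_measurable[OF X1(1)[of n]] w_slice_measurable[OF x]] borel_measurable_const] fm])
    show "integrable unit_measure (\<lambda>_. K * (2 * B))" by simp
    show "AE y in unit_measure. norm ((w (X n) y - w x y) / (X n - x) * (f y - f x)) \<le> K * (2 * B)" for n
    proof (intro AE_I2)
      fix y assume "y \<in> space unit_measure"
      then have y: "y \<in> {0..1}" by simp
      have "\<bar>f y - f x\<bar> \<le> 2 * B" using B[OF y] B[OF x] by linarith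
      then show "norm ((w (X n) y - w x y) / (X n - x) * (f y - f x)) \<le> K * (2 * B)"
        using difference_quotient_bound[OF x X1(1)[of n] y] K_pos
        unfolding real_norm_def abs_mult by (intro mult_mono) auto
    qed
    show "AE y in unit_measure. (\<lambda>n. (w (X n) y - w x y) / (X n - x) * (f y - f x))
      \<longlonglongrightarrow> wder x y * (f y - f x)"
      using wder_AE[OF x]
    proof eventually_elim
      case (elim y)
      then have "((\<lambda>t. (w t y - w x y) / (t - x)) \<longlongrightarrow> wder x y) (at x within {0..1})"
        by (simp add: has_field_derivative_iff)
      from this[unfolded tendsto_at_iff_sequentially, THEN spec, of X]
      have "((\<lambda>t. (w t y - w x y) / (t - x)) \<circ> X) \<longlonglongrightarrow> wder x y"
        using X by blast
      then show ?case
        by (intro tendsto_mult tendsto_const) (simp add: o_def)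
    qed
  qed
  note lim1 = this
  have lim2: "(\<lambda>n. deg (X n) - bottom) \<longlonglongrightarrow> deg x - bottom"
    using continuous_on_tendsto_compose[OF deg_continuous X(2) x] X1 by (intro tendsto_diff tendsto_const) simp
  have "(\<lambda>n. (\<integral>y. ((w (X n) y - w x y) / (X n - x)) * (f y - f x) \<partial>unit_measure) / (deg (X n) - bottom))
    \<longlonglongrightarrow> eigder f x"
    unfolding eigder_def by (rule tendsto_divide[OF lim1 lim2]) (use deg_minus_bottom_pos[OF x] in simp)
  moreover have "(\<integral>y. ((w (X n) y - w x y) / (X n - x)) * (f y - f x) \<partial>unit_measure) / (deg (X n) - bottom)
    = (f (X n) - f x) / (X n - x)" for n
  proof -
    have "(\<integral>y. ((w (X n) y - w x y) / (X n - x)) * (f y - f x) \<partial>unit_measure)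
      = (\<integral>y. (w (X n) y - w x y) * (f y - f x) / (X n - x) \<partial>unit_measure)"
      by (intro unit_integral_cong) simp
    also have "\<dots> = (\<integral>y. (w (X n) y - w x y) * (f y - f x) \<partial>unit_measure) / (X n - x)"
      by (rule integral_divide_zero)
    also have "\<dots> = (deg (X n) - bottom) * (f (X n) - f x) / (X n - x)"
      using bottom_eigenfn_increment[OF f x X1(1)[of n]] by simp
    finally have E: "(\<integral>y. ((w (X n) y - w x y) / (X n - x)) * (f y - f x) \<partial>unit_measure)
      = (deg (X n) - bottom) * (f (X n) - f x) / (X n - x)" .
    show ?thesis unfolding E using deg_minus_bottom_pos[OF X1(1)[of n]] by simp
  qed
  ultimately show "((\<lambda>y. (f y - f x) / (y - x)) \<circ> X) \<longlonglongrightarrow> eigder f x"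
    by (simp only: o_def)
qed

lemma eigder_combine:
  assumes f: "bottom_eigenfn f" and g: "bottom_eigenfn g" and x: "x \<in> {0..1}"
  shows "eigder (\<lambda>x. f x + t * g x) x = eigder f x + t * eigder g x"
proof -
  have AEb: "AE y in unit_measure. \<bar>wder x y\<bar> \<le> K"
    using wder_AE[OF x] AE_space by eventually_elim (auto intro: wder_bound[OF x])
  have i: "integrable unit_measure (\<lambda>y. wder x y * (f y - f x))" if f: "bottom_eigenfn f" for f
  proof (rule Bochner_Integration.integrable_bound)
    have l: "L2 (\<lambda>y. f y - f x)" using bottom_eigenfnD(2)[OF f] by (intro L2_diff L2_const)
    show "integrable unit_measure (\<lambda>y. K * (f y - f x))" using L2_integrable[OF l] by simp
    show "(\<lambda>y. wder x y * (f y - f x)) \<in> borel_measurable unit_measure"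
      using wder_measurable[OF x] L2_measurable[OF l] by (rule borel_measurable_times)
    show "AE y in unit_measure. norm (wder x y * (f y - f x)) \<le> norm (K * (f y - f x))"
      using AEb by eventually_elim (use K_pos in \<open>auto simp: abs_mult intro!: mult_right_mono\<close>)
  qed
  have "(\<integral>y. wder x y * ((f y + t * g y) - (f x + t * g x)) \<partial>unit_measure)
    = (\<integral>y. wder x y * (f y - f x) + t * (wder x y * (g y - g x)) \<partial>unit_measure)"
    by (intro unit_integral_cong) (simp add: algebra_simps)
  also have "\<dots> = (\<integral>y. wder x y * (f y - f x) \<partial>unit_measure) + t * (\<integral>y. wder x y * (g y - g x) \<partial>unit_measure)"
    using i[OF f] i[OF g] by simp
  finally show ?thesis by (simp add: eigder_def add_divide_distrib)
qed

text \<open>For increasing \<open>f\<close>, the factors \<open>wder x y\<close> and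
  \<open>f y - f x\<close> have the same sign on either side of \<open>x\<close>. At a critical
  point a nonnegative integrand thus has integral zero. Since \<open>wder\<close> is nonzero almost
  everywhere, \<open>f\<close> is constant, and mean zero makes it vanish.\<close>

lemma monotone_eigenfn_zero:
  assumes f: "bottom_eigenfn f" and x: "x \<in> {0..1}" and e: "eigder f x = 0"
    and mono: "\<And>a b. 0 \<le> a \<Longrightarrow> a \<le> b \<Longrightarrow> b \<le> 1 \<Longrightarrow> f a \<le> f b" and y: "y \<in> {0..1}"
  shows "f y = 0"
proof -
  have l: "L2 (\<lambda>y. f y - f x)" using bottom_eigenfnD(2)[OF f] by (intro L2_diff L2_const)
  have "(\<integral>y. wder x y * (f y - f x) \<partial>unit_measure) = 0"
    using e deg_minus_bottom_pos[OF x] by (simp add: eigder_def)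
  moreover have nn: "AE y in unit_measure. 0 \<le> wder x y * (f y - f x) \<and> \<bar>wder x y\<bar> \<le> K \<and> wder x y \<noteq> 0"
    using wder_AE[OF x] AE_space
  proof eventually_elim
    case (elim y)
    then have y: "y \<in> {0..1}" and D: "((\<lambda>t. w t y) has_real_derivative wder x y) (at x within {0..1}) \<and> wder x y \<noteq> 0"
      by auto
    have "0 \<le> wder x y * (f y - f x)"
    proof (cases x y rule: linorder_cases)
      case less
      then show ?thesis using wder_sign(1)[OF x y conjunct1[OF D]] mono[of x y] x y by simp
    next
      case greater
      then show ?thesis using wder_sign(2)[OF x y conjunct1[OF D]] mono[of y x] x y
        by (intro mult_nonpos_nonpos) auto
    qed simp
    then show ?case
      using wder_bound[OF x y conjunct1[OF D]] D by simp
  qed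
  moreover have "integrable unit_measure (\<lambda>y. wder x y * (f y - f x))"
  proof (rule Bochner_Integration.integrable_bound)
    show "integrable unit_measure (\<lambda>y. K * (f y - f x))" using L2_integrable[OF l] by simp
    show "(\<lambda>y. wder x y * (f y - f x)) \<in> borel_measurable unit_measure"
      using wder_measurable[OF x] L2_measurable[OF l] by (rule borel_measurable_times)
    show "AE y in unit_measure. norm (wder x y * (f y - f x)) \<le> norm (K * (f y - f x))"
      using nn by eventually_elim (use K_pos in \<open>auto simp: abs_mult intro!: mult_right_mono\<close>)
  qed
  ultimately have "AE y in unit_measure. wder x y * (f y - f x) = 0"
    using integral_nonneg_eq_0_iff_AE[of unit_measure "\<lambda>y. wder x y * (f y - f x)"] by auto
  with nn have "AE y in unit_measure. f y - f x = 0" by eventually_elim auto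
  then have c: "f y - f x = 0" if "y \<in> {0..1}" for y
    using that bottom_eigenfnD(1)[OF f]
    by (intro continuous_AE_zero[of "\<lambda>y. f y - f x"] continuous_on_diff continuous_on_const)
  have "inner_L2 f (\<lambda>_. 1) = inner_L2 (\<lambda>_. f x) (\<lambda>_. 1)" using c by (intro inner_L2_cong) auto
  also have "\<dots> = f x" using unit.prob_space by (simp add: inner_L2_def)
  finally show ?thesis using bottom_eigenfnD(4)[OF f] c[OF y] by simp
qed

lemma eigder_abs_le:
  assumes f: "bottom_eigenfn f" and x: "x \<in> {0..1}"
    and C: "\<And>x y. x \<in> {0..1} \<Longrightarrow> y \<in> {0..1} \<Longrightarrow> \<bar>f x - f y\<bar> \<le> C * \<bar>x - y\<bar>"
  shows "\<bar>eigder f x\<bar> \<le> C"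
proof -
  have "((\<lambda>t. \<bar>(f t - f x) / (t - x)\<bar>) \<longlongrightarrow> \<bar>eigder f x\<bar>) (at x within {0..1})"
    using bottom_eigenfn_has_derivative[OF f x] by (intro tendsto_rabs) (simp add: has_field_derivative_iff)
  moreover have "\<bar>(f t - f x) / (t - x)\<bar> \<le> C" if "t \<in> {0..1}" "t \<noteq> x" for t
    using C[OF that(1) x] that by (simp add: abs_divide divide_le_eq)
  then have "\<forall>\<^sub>F t in at x within {0..1}. \<bar>(f t - f x) / (t - x)\<bar> \<le> C"
    by (auto simp: eventually_at_filter)
  ultimately show ?thesis by (rule tendsto_upperbound[OF _ _ at_unit_not_bot[OF x]])
qed

section \<open>The variation of an eigenfunction\<close>

lemma eigder_has_integral:
  assumes f: "bottom_eigenfn f" and ab: "0 \<le> a" "a \<le> b" "b \<le> 1"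
  shows "(eigder f has_integral (f b - f a)) {a..b}"
proof (rule fundamental_theorem_of_calculus[OF ab(2)])
  fix x assume x: "x \<in> {a..b}"
  then have x1: "x \<in> {0..1}" and sub: "{a..b} \<subseteq> {0..1}" using ab by auto
  have "(f has_real_derivative eigder f x) (at x within {a..b})"
    by (rule DERIV_subset[OF bottom_eigenfn_has_derivative[OF f x1] sub])
  then show "(f has_vector_derivative eigder f x) (at x within {a..b})"
    by (rule has_real_derivative_iff_has_vector_derivative[THEN iffD1])
qed

text \<open>The total variation of \<open>f\<close> on \<open>[0,x]\<close>. The gauge integral
  gives the fundamental theorem for a function that is merely differentiable everywhere.\<close>

definition variation :: "(real \<Rightarrow> real) \<Rightarrow> real \<Rightarrow> real" where
  "variation f x = integral {0..x} (\<lambda>t. \<bar>eigder f t\<bar>)"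

text \<open>Gauge integrability does not pass to absolute values in general; here the Lipschitz
  constant bounds the derivative and makes it absolutely integrable.\<close>

lemma eigder_abs_integrable:
  assumes f: "bottom_eigenfn f" and ab: "0 \<le> a" "b \<le> 1"
  shows "(\<lambda>t. \<bar>eigder f t\<bar>) integrable_on {a..b}"
proof -
  obtain C where C: "C \<ge> 0" "\<And>x y. x \<in> {0..1} \<Longrightarrow> y \<in> {0..1} \<Longrightarrow> \<bar>f x - f y\<bar> \<le> C * \<bar>x - y\<bar>"
    using bottom_eigenfn_lipschitz[OF f] by metis
  have "(eigder f) absolutely_integrable_on {0..1}"
  proof (rule absolutely_integrable_integrable_bound)
    show "eigder f integrable_on {0..1}" using eigder_has_integral[OF f, of 0 1] by (auto simp: has_integral_integrable)
    show "norm (eigder f x) \<le> C" if "x \<in> {0..1}" for x using eigder_abs_le[OF f that C(2)] by simp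
  qed (rule integrable_const_ivl)
  then have "(\<lambda>t. \<bar>eigder f t\<bar>) integrable_on {0..1}"
    by (simp add: absolutely_integrable_on_def)
  moreover have "{a..b} \<subseteq> {0..1}" using ab by auto
  ultimately show ?thesis by (rule integrable_on_subinterval)
qed

lemma variation_diff:
  assumes f: "bottom_eigenfn f" and ab: "0 \<le> a" "a \<le> b" "b \<le> 1"
  shows "variation f b - variation f a = integral {a..b} (\<lambda>t. \<bar>eigder f t\<bar>)"
  using Henstock_Kurzweil_Integration.integral_combine[OF ab(1,2) eigder_abs_integrable[OF f order_refl ab(3)]]
  by (simp add: variation_def)

lemma variation_ge:
  assumes f: "bottom_eigenfn f" and ab: "0 \<le> a" "a \<le> b" "b \<le> 1"
  shows "\<bar>f b - f a\<bar> \<le> variation f b - variation f a"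
proof -
  have "f b - f a = integral {a..b} (eigder f)"
    using eigder_has_integral[OF f ab] by (simp add: integral_unique)
  then show ?thesis
    unfolding variation_diff[OF f ab]
    using integral_norm_bound_integral[of "eigder f" "{a..b}" "\<lambda>t. \<bar>eigder f t\<bar>"]
      eigder_has_integral[OF f ab] eigder_abs_integrable[OF f ab(1,3)]
    by (simp add: has_integral_integrable)
qed

lemma variation_le:
  assumes f: "bottom_eigenfn f" and ab: "0 \<le> a" "a \<le> b" "b \<le> 1"
    and C: "\<And>x y. x \<in> {0..1} \<Longrightarrow> y \<in> {0..1} \<Longrightarrow> \<bar>f x - f y\<bar> \<le> C * \<bar>x - y\<bar>"
  shows "variation f b - variation f a \<le> C * (b - a)"
proof -
  have "integral {a..b} (\<lambda>t. \<bar>eigder f t\<bar>) \<le> integral {a..b} (\<lambda>_. C)"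
    using eigder_abs_le[OF f _ C] ab
    by (intro integral_le eigder_abs_integrable[OF f] integrable_const_ivl) auto
  then show ?thesis unfolding variation_diff[OF f ab] using ab by (simp add: mult.commute)
qed

lemma variation_continuous:
  assumes f: "bottom_eigenfn f"
  shows "continuous_on {0..1} (variation f)"
proof -
  obtain C where C: "C \<ge> 0" "\<And>x y. x \<in> {0..1} \<Longrightarrow> y \<in> {0..1} \<Longrightarrow> \<bar>f x - f y\<bar> \<le> C * \<bar>x - y\<bar>"
    using bottom_eigenfn_lipschitz[OF f] by metis
  have *: "\<bar>variation f x - variation f y\<bar> \<le> C * \<bar>x - y\<bar>" if "x \<in> {0..1}" "y \<in> {0..1}" "x \<le> y" for x y
    using variation_le[OF f _ _ _ C(2), of x y] variation_ge[OF f, of x y] that by simp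
  show ?thesis
  proof (rule continuous_on_abs_le[where C = C])
    fix x y :: real assume "x \<in> {0..1}" "y \<in> {0..1}"
    then show "\<bar>variation f x - variation f y\<bar> \<le> C * \<bar>x - y\<bar>"
      using *[of x y] *[of y x] by (cases "x \<le> y") (auto simp: abs_minus_commute)
  qed
qed

text \<open>For \<open>y\<close> outside \<open>(u,v)\<close> the increment of \<open>w\<close> has
  the same sign as the variation increment \<open>?q y - ?q u\<close>, which dominates
  \<open>\<bar>f y - f u\<bar>\<close>. For \<open>y\<close> between \<open>u\<close> and
  \<open>v\<close> both integrands are at most \<open>K * C * (v - u)\<^sup>2\<close>. So the
  nonlocal term of the variation is at least that of \<open>f\<close>, up to the quadratic error.
  What is left of the local term is the defect \<open>variation - \<bar>f v - f u\<bar>\<close>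
  times a factor of at most 1.\<close>

lemma residual_variation_increment:
  assumes f: "bottom_eigenfn f" and uv: "0 \<le> u" "u \<le> v" "v \<le> 1"
    and C: "C \<ge> 0" "\<And>x y. x \<in> {0..1} \<Longrightarrow> y \<in> {0..1} \<Longrightarrow> \<bar>f x - f y\<bar> \<le> C * \<bar>x - y\<bar>"
  shows "(lap (variation f) v - bottom * variation f v) - (lap (variation f) u - bottom * variation f u)
    \<le> (variation f v - variation f u - \<bar>f v - f u\<bar>) + 2 * K * C * (v - u)\<^sup>2"
proof -
  let ?q = "variation f"
  let ?dw = "\<lambda>y. w v y - w u y"
  have q: "L2 ?q" by (rule L2_continuous[OF variation_continuous[OF f]])
  have fl: "L2 f" by (rule bottom_eigenfnD(2)[OF f])
  have u: "u \<in> {0..1}" and v: "v \<in> {0..1}" using uv by auto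
  have dwm: "?dw \<in> borel_measurable unit_measure"
    using w_slice_measurable[OF u] w_slice_measurable[OF v] by (intro borel_measurable_diff)
  have dwb: "\<bar>?dw y\<bar> \<le> K * (v - u)" if "y \<in> {0..1}" for y
    using w_lipschitz[OF v that u that] uv by simp
  have i1: "integrable unit_measure (\<lambda>y. ?dw y * (?q y - ?q u))"
    using q by (intro L2_integrable[OF L2_mult_bounded[OF _ dwm dwb]] L2_diff L2_const)
  have i2: "integrable unit_measure (\<lambda>y. ?dw y * (f y - f u))"
    using fl by (intro L2_integrable[OF L2_mult_bounded[OF _ dwm dwb]] L2_diff L2_const)
  have pw: "\<bar>?dw y * (f y - f u)\<bar> \<le> ?dw y * (?q y - ?q u) + 2 * K * C * (v - u)\<^sup>2" if y: "y \<in> {0..1}" for y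
  proof -
    have K0: "0 \<le> 2 * K * C * (v - u)\<^sup>2" using K_pos C(1) by simp
    consider "y \<le> u" | "u < y" "y < v" | "v \<le> y" by linarith
    then show ?thesis
    proof cases
      case 1
      have "?dw y \<le> 0" using w_mono_right[of y u v] 1 y uv by simp
      moreover have "\<bar>f y - f u\<bar> \<le> ?q u - ?q y" using variation_ge[OF f, of y u] 1 y uv by simp
      ultimately have "(- ?dw y) * \<bar>f y - f u\<bar> \<le> (- ?dw y) * (?q u - ?q y)"
        by (intro mult_left_mono) auto
      moreover have "\<bar>?dw y * (f y - f u)\<bar> = (- ?dw y) * \<bar>f y - f u\<bar>"
        using \<open>?dw y \<le> 0\<close> by (simp only: abs_mult abs_of_nonpos)
      moreover have "(- ?dw y) * (?q u - ?q y) = ?dw y * (?q y - ?q u)" by (simp add: algebra_simps)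
      ultimately show ?thesis using K0 by linarith
    next
      case 2
      have "\<bar>f y - f u\<bar> \<le> C * (v - u)"
        using C(2)[OF y u] 2 C(1) mult_left_mono[of "y - u" "v - u" C] by simp
      then have "\<bar>?dw y * (f y - f u)\<bar> \<le> (K * (v - u)) * (C * (v - u))"
        unfolding abs_mult using dwb[OF y] K_pos uv by (intro mult_mono) auto
      moreover have "\<bar>?q y - ?q u\<bar> \<le> C * (v - u)"
        using variation_le[OF f _ _ _ C(2), of u y] variation_ge[OF f, of u y] 2 y uv C(1)
          mult_left_mono[of "y - u" "v - u" C] by simp
      then have "\<bar>?dw y * (?q y - ?q u)\<bar> \<le> (K * (v - u)) * (C * (v - u))"
        unfolding abs_mult using dwb[OF y] K_pos uv by (intro mult_mono) auto
      ultimately show ?thesis by (simp add: power2_eq_square algebra_simps abs_le_iff)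
    next
      case 3
      have "?dw y \<ge> 0" using w_mono_left[of u v y] 3 y uv by simp
      moreover have "\<bar>f y - f u\<bar> \<le> ?q y - ?q u" using variation_ge[OF f, of u y] 3 y uv by simp
      ultimately have "?dw y * \<bar>f y - f u\<bar> \<le> ?dw y * (?q y - ?q u)"
        by (intro mult_left_mono) auto
      moreover have "\<bar>?dw y * (f y - f u)\<bar> = ?dw y * \<bar>f y - f u\<bar>"
        using \<open>?dw y \<ge> 0\<close> by (simp only: abs_mult abs_of_nonneg)
      ultimately show ?thesis using K0 by linarith
    qed
  qed
  have "(deg v - bottom) * \<bar>f v - f u\<bar> = \<bar>\<integral>y. ?dw y * (f y - f u) \<partial>unit_measure\<bar>"
    unfolding bottom_eigenfn_increment[OF f u v, symmetric]
    using deg_minus_bottom_pos[OF v] by (simp add: abs_mult)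
  also have "\<dots> \<le> (\<integral>y. \<bar>?dw y * (f y - f u)\<bar> \<partial>unit_measure)" by (rule integral_abs_bound)
  also have "\<dots> \<le> (\<integral>y. ?dw y * (?q y - ?q u) + 2 * K * C * (v - u)\<^sup>2 \<partial>unit_measure)"
    using i1 i2 pw by (intro integral_mono) auto
  also have "\<dots> = (\<integral>y. ?dw y * (?q y - ?q u) \<partial>unit_measure) + 2 * K * C * (v - u)\<^sup>2"
    using i1 unit.prob_space by simp
  finally have "(\<integral>y. ?dw y * (?q y - ?q u) \<partial>unit_measure)
    \<ge> (deg v - bottom) * \<bar>f v - f u\<bar> - 2 * K * C * (v - u)\<^sup>2" by simp
  then have "(lap ?q v - bottom * ?q v) - (lap ?q u - bottom * ?q u)
    \<le> (deg v - bottom) * (?q v - ?q u - \<bar>f v - f u\<bar>) + 2 * K * C * (v - u)\<^sup>2"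
    unfolding residual_increment[OF q u v] by (simp add: right_diff_distrib)
  also have "(deg v - bottom) * (?q v - ?q u - \<bar>f v - f u\<bar>) \<le> 1 * (?q v - ?q u - \<bar>f v - f u\<bar>)"
    using deg_le_1[OF v] bottom_pos variation_ge[OF f uv] by (intro mult_right_mono) auto
  finally show ?thesis by simp
qed

text \<open>Summing the previous estimate over a fine tagged division, Henstock's lemma for \<open>f'\<close> and
  \<open>\<bar>f'\<bar>\<close> makes the terms \<open>\<integral>\<bar>f'\<bar> - \<bar>\<integral>f'\<bar>\<close> disappear.\<close>

lemma residual_variation_antimono:
  assumes f: "bottom_eigenfn f" and ab: "0 \<le> a" "a \<le> b" "b \<le> 1"
  shows "lap (variation f) b - bottom * variation f b \<le> lap (variation f) a - bottom * variation f a"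
proof (rule field_le_epsilon)
  fix e :: real assume e: "e > 0"
  let ?h = "\<lambda>x. lap (variation f) x - bottom * variation f x"
  let ?g = "eigder f" let ?G = "\<lambda>t. \<bar>eigder f t\<bar>"
  obtain C where C: "C \<ge> 0" "\<And>x y. x \<in> {0..1} \<Longrightarrow> y \<in> {0..1} \<Longrightarrow> \<bar>f x - f y\<bar> \<le> C * \<bar>x - y\<bar>"
    using bottom_eigenfn_lipschitz[OF f] by metis
  \<comment> \<open>Makes the accumulated quadratic error at most \<open>e / 4\<close>; the summand
    1 guards against \<open>C = 0\<close>.\<close>
  define d where "d = e / (4 * (4 * K * C + 1))"
  have KC: "4 * K * C \<ge> 0" using K_pos C(1) by simp
  have d: "d > 0" unfolding d_def using e KC by (intro divide_pos_pos mult_pos_pos add_nonneg_pos) auto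
  have e4: "e / 4 > 0" using e by simp
  have gi: "?g integrable_on cbox a b" "?G integrable_on cbox a b"
    using has_integral_integrable[OF eigder_has_integral[OF f ab]] eigder_abs_integrable[OF f ab(1,3)] by simp_all
  obtain \<gamma>1 where g1: "gauge \<gamma>1" "\<And>p. p tagged_partial_division_of cbox a b \<Longrightarrow> \<gamma>1 fine p \<Longrightarrow>
     (\<Sum>(x,k)\<in>p. norm (measure lborel k *\<^sub>R ?g x - integral k ?g)) < e / 4"
    by (rule Henstock_lemma[OF gi(1) e4]) blast
  obtain \<gamma>2 where g2: "gauge \<gamma>2" "\<And>p. p tagged_partial_division_of cbox a b \<Longrightarrow> \<gamma>2 fine p \<Longrightarrow>
     (\<Sum>(x,k)\<in>p. norm (measure lborel k *\<^sub>R ?G x - integral k ?G)) < e / 4"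
    by (rule Henstock_lemma[OF gi(2) e4]) blast
  have "gauge (\<lambda>x. (\<gamma>1 x \<inter> \<gamma>2 x) \<inter> ball x d)"
    by (intro gauge_Int g1(1) g2(1) gauge_ball d)
  then obtain p where p: "p tagged_division_of cbox a b" "(\<lambda>x. (\<gamma>1 x \<inter> \<gamma>2 x) \<inter> ball x d) fine p"
    using fine_division_exists by blast
  have fine: "\<gamma>1 fine p" "\<gamma>2 fine p" "(\<lambda>x. ball x d) fine p"
    using p(2) by (auto simp: fine_def)
  have pp: "p tagged_partial_division_of cbox a b" using p(1) by (simp add: tagged_division_of_def)
  have each: "?h (Sup k) - ?h (Inf k)
    \<le> norm (measure lborel k *\<^sub>R ?g x - integral k ?g) + norm (measure lborel k *\<^sub>R ?G x - integral k ?G) + 4 * K * C * d * measure lborel k"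
    if xk: "(x, k) \<in> p" for x k
  proof -
    obtain u v where k: "k = cbox u v" using tagged_division_ofD(4)[OF p(1) xk] by auto
    have xin: "x \<in> k" and sub: "k \<subseteq> cbox a b" using tagged_division_ofD(2,3)[OF p(1) xk] by auto
    have uv: "u \<le> v" "a \<le> u" "v \<le> b" using xin sub unfolding k by auto
    have k': "k = {u..v}" by (simp add: k)
    have "k \<subseteq> ball x d" using fine(3) xk by (auto simp: fine_def)
    then have "u \<in> ball x d" "v \<in> ball x d" using uv(1) unfolding k' by auto
    then have vu: "v - u \<le> 2 * d" by (auto simp: dist_real_def abs_if split: if_splits)
    have ct: "measure lborel k = v - u" using uv(1) by (simp add: k')
    have u0: "0 \<le> u" "v \<le> 1" using uv ab by auto
    have ig: "integral k ?g = f v - f u"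
      unfolding k' using eigder_has_integral[OF f u0(1) uv(1) u0(2)] by (rule integral_unique)
    have iG: "integral k ?G = variation f v - variation f u"
      unfolding k' using variation_diff[OF f u0(1) uv(1) u0(2)] by simp
    have "(v - u)\<^sup>2 \<le> 2 * d * (v - u)"
      unfolding power2_eq_square using vu uv(1) by (intro mult_right_mono) auto
    then have "2 * K * C * (v - u)\<^sup>2 \<le> 2 * K * C * (2 * d * (v - u))"
      using K_pos C(1) by (intro mult_left_mono) auto
    \<comment> \<open>On a fine cell with tag \<open>x\<close>, the number
      \<open>(v - u) * \<bar>f' x\<bar>\<close> approximates both the integral of
      \<open>\<bar>f'\<bar>\<close> and the absolute value of the integral of \<open>f'\<close>, so
      their difference is controlled by the two Henstock errors.\<close>
    moreover have "variation f v - variation f u - \<bar>f v - f u\<bar>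
      \<le> norm (measure lborel k *\<^sub>R ?g x - integral k ?g) + norm (measure lborel k *\<^sub>R ?G x - integral k ?G)"
    proof -
      have "variation f v - variation f u \<le> norm (measure lborel k *\<^sub>R ?G x - integral k ?G) + (v - u) * \<bar>?g x\<bar>"
        unfolding iG ct by simp
      moreover have "(v - u) * \<bar>?g x\<bar> = \<bar>(v - u) * ?g x\<bar>" using uv(1) by (simp add: abs_mult)
      moreover have "\<bar>(v - u) * ?g x\<bar> \<le> norm (measure lborel k *\<^sub>R ?g x - integral k ?g) + \<bar>f v - f u\<bar>"
        unfolding ig ct by simp
      ultimately show ?thesis by linarith
    qed
    ultimately show ?thesis
      using residual_variation_increment[OF f u0(1) uv(1) u0(2) C] uv(1) unfolding ct k'
      by (simp add: algebra_simps)
  qed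
  have "?h b - ?h a = (\<Sum>(x,k)\<in>p. ?h (Sup k) - ?h (Inf k))"
    using additive_tagged_division_1[OF ab(2), of p ?h] p(1) by simp
  also have "\<dots> \<le> (\<Sum>(x,k)\<in>p. norm (measure lborel k *\<^sub>R ?g x - integral k ?g) + norm (measure lborel k *\<^sub>R ?G x - integral k ?G) + 4 * K * C * d * measure lborel k)"
    using each by (intro sum_mono) auto
  also have "\<dots> = (\<Sum>(x,k)\<in>p. norm (measure lborel k *\<^sub>R ?g x - integral k ?g))
     + (\<Sum>(x,k)\<in>p. norm (measure lborel k *\<^sub>R ?G x - integral k ?G)) + 4 * K * C * d * (\<Sum>(x,k)\<in>p. measure lborel k)"
    unfolding sum_distrib_left sum.distrib[symmetric] by (intro sum.cong) auto
  also have "(\<Sum>(x,k)\<in>p. measure lborel k) = b - a"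
    using additive_content_tagged_division[OF p(1)] ab by simp
  also have "4 * K * C * d * (b - a) \<le> 4 * K * C * d * 1"
    using KC d ab by (intro mult_left_mono) auto
  also have "4 * K * C * d \<le> e / 4"
    using KC e by (simp add: d_def field_simps)
  finally show "?h b \<le> ?h a + e"
    using g1(2)[OF pp fine(1)] g2(2)[OF pp fine(2)] e by simp
qed

end

section \<open>Simplicity of the bottom eigenvalue\<close>

lemma (in lipschitz_graphon) lap_continuous:
  assumes "continuous_on {0..1} f"
  shows "continuous_on {0..1} (lap f)"
proof -
  have f: "L2 f" using assms by (rule L2_continuous)
  have "continuous_on {0..1} (\<lambda>x. deg x * f x - kernel_op w f x)"
    by (rule continuous_on_diff[OF continuous_on_mult[OF deg_continuous assms] kernel_op_continuous[OF f]])
  then show ?thesis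
    by (rule continuous_on_cong[OF refl lap_eq[OF f], THEN iffD2, rotated])
qed

text \<open>Strict positivity at every point, without a positive lower bound, is enough. The
  contrapositive produces a point at which two derivatives with equal integrals touch.\<close>

lemma positive_has_integral_pos:
  fixes f :: "real \<Rightarrow> real"
  assumes i: "(f has_integral I) {0..1}" and pos: "\<And>x. x \<in> {0..1} \<Longrightarrow> 0 < f x"
  shows "0 < I"
proof -
  have "f absolutely_integrable_on {0..1}"
    using i pos by (intro nonnegative_absolutely_integrable_1) (auto simp: has_integral_integrable less_imp_le)
  then have u: "integrable unit_measure f"
    by (simp add: set_integrable_def integrable_restrict_space)
  have I: "I = integral\<^sup>L unit_measure f"
    using has_integral_unique[OF i has_integral_unit_measure[OF u]] .
  have nn: "AE x in unit_measure. 0 \<le> f x" using pos by (intro AE_I2) (auto intro: less_imp_le)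
  have "I \<noteq> 0"
  proof
    assume "I = 0"
    then have "AE x in unit_measure. f x = 0"
      using integral_nonneg_eq_0_iff_AE[OF u nn] I by simp
    then have "AE x in unit_measure. False" using AE_space
      by eventually_elim (use pos in fastforce)
    then show False using unit.AE_False by simp
  qed
  moreover have "0 \<le> I" unfolding I by (rule integral_nonneg_AE[OF nn])
  ultimately show ?thesis by simp
qed

context robinson_graphon
begin

definition centered_variation :: "(real \<Rightarrow> real) \<Rightarrow> real \<Rightarrow> real" where
  "centered_variation f x = variation f x - inner_L2 (variation f) (\<lambda>_. 1)"

lemma centered_variation_ge:
  assumes f: "bottom_eigenfn f" and ab: "0 \<le> a" "a \<le> b" "b \<le> 1"
  shows "\<bar>f b - f a\<bar> \<le> centered_variation f b - centered_variation f a"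
  using variation_ge[OF assms] by (simp add: centered_variation_def)

text \<open>The residual \<open>(L - \<lambda>) q\<close> is decreasing and \<open>q\<close> is increasing with mean zero, so their
  inner product is nonpositive (Chebyshev) and \<open>q\<close> attains the bottom of the form.\<close>

lemma centered_variation_eigenfn:
  assumes f: "bottom_eigenfn f"
  shows "bottom_eigenfn (centered_variation f)"
proof -
  let ?q = "centered_variation f"
  let ?h = "\<lambda>x. lap ?q x - bottom * ?q x"
  note cv = variation_continuous[OF f]
  have cq: "continuous_on {0..1} ?q"
    unfolding centered_variation_def[abs_def] by (rule continuous_on_diff[OF cv continuous_on_const])
  have vq: "L2 (variation f)" and q: "L2 ?q" using cv cq by (auto intro: L2_continuous)
  have ch: "continuous_on {0..1} ?h"
    by (rule continuous_on_diff[OF lap_continuous[OF cq] continuous_on_mult[OF continuous_on_const cq]])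
  have h: "L2 ?h" using ch by (rule L2_continuous)
  have one: "inner_L2 (\<lambda>_. c) (\<lambda>_. 1) = c" for c using unit.prob_space by (simp add: inner_L2_def)
  have mean: "inner_L2 ?q (\<lambda>_. 1) = 0"
    unfolding centered_variation_def[abs_def] inner_L2_diff_left[OF vq L2_const L2_const] one by simp
  have hq: "?h x = lap (variation f) x - bottom * variation f x
      + bottom * inner_L2 (variation f) (\<lambda>_. 1)" if "x \<in> {0..1}" for x
    unfolding centered_variation_def[abs_def] lap_diff[OF vq L2_const that] lap_const
    by (simp add: algebra_simps)
  have anti: "?h b \<le> ?h a" if "0 \<le> a" "a \<le> b" "b \<le> 1" for a b
    using residual_variation_antimono[OF f that] hq[of a] hq[of b] that by simp
  have mono: "?q a \<le> ?q b" if "0 \<le> a" "a \<le> b" "b \<le> 1" for a b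
    using centered_variation_ge[OF f that] by simp
  have int0: "integral\<^sup>L unit_measure ?q = 0" using mean by (simp add: inner_L2_def)
  have q0: "?q 0 \<le> 0"
  proof (rule ccontr)
    assume *: "\<not> ?q 0 \<le> 0"
    have "?q 0 = 0"
    proof (rule nonneg_continuous_integral_zero[OF cq _ int0])
      fix x :: real assume "x \<in> {0..1}"
      then show "0 \<le> ?q x" using mono[of 0 x] * by simp
    qed simp
    then show False using * by simp
  qed
  have q1: "0 \<le> ?q 1"
  proof (rule ccontr)
    assume *: "\<not> 0 \<le> ?q 1"
    have "- ?q 1 = 0"
    proof (rule nonneg_continuous_integral_zero[OF continuous_on_minus[OF cq]])
      fix x :: real assume "x \<in> {0..1}"
      then show "0 \<le> - ?q x" using mono[of x 1] * by simp
    qed (use int0 in simp_all)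
    then show False using * by simp
  qed
  \<comment> \<open>A zero of the increasing function \<open>?q\<close>. Since \<open>?q\<close> has
    mean zero, the constant \<open>?h c\<close> can be subtracted from the residual, and then the
    two factors have opposite signs on each side of \<open>c\<close>.\<close>
  obtain c where c: "0 \<le> c" "c \<le> 1" "?q c = 0"
    using IVT'[of ?q 0 0 1, OF q0 q1 zero_le_one cq] by blast
  have le0: "(?h x - ?h c) * ?q x \<le> 0" if "x \<in> {0..1}" for x
  proof (cases "x \<le> c")
    case True
    then show ?thesis using anti[of x c] mono[of x c] c that by (intro mult_nonneg_nonpos) auto
  next
    case False
    then show ?thesis using anti[of c x] mono[of c x] c that by (intro mult_nonpos_nonneg) auto
  qed
  have "inner_L2 (\<lambda>x. ?h x - ?h c) ?q \<le> 0"
  proof -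
    have "0 \<le> integral\<^sup>L unit_measure (\<lambda>x. - ((?h x - ?h c) * ?q x))"
      using le0 by (intro integral_nonneg_AE AE_I2) auto
    then show ?thesis by (simp add: inner_L2_def)
  qed
  moreover have "inner_L2 (\<lambda>x. ?h x - ?h c) ?q = inner_L2 ?h ?q"
    unfolding inner_L2_diff_left[OF h L2_const q]
    using mean inner_L2_cmult_left[of "?h c" "\<lambda>_. 1" ?q] by (simp add: inner_L2_commute[of _ ?q])
  moreover have "inner_L2 ?h ?q = inner_L2 (lap ?q) ?q - bottom * inner_L2 ?q ?q"
    unfolding inner_L2_diff_left[OF lap_L2[OF q] L2_cmult[OF q] q] inner_L2_cmult_left ..
  ultimately have form0: "inner_L2 (lap ?q) ?q - bottom * inner_L2 ?q ?q \<le> 0" by simp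
  have "(norm_L2 ?h)\<^sup>2 \<le> (2 + \<bar>bottom\<bar>) * (inner_L2 (lap ?q) ?q - bottom * inner_L2 ?q ?q)"
  proof (rule residual_le_form[where S = "{\<lambda>_. 1}"])
    show "\<exists>\<kappa>. \<forall>x\<in>{0..1}. lap s x = \<kappa> * s x" if "s \<in> {\<lambda>_. 1}" for s
      using that lap_const by (intro exI[of _ 0]) auto
    show "bottom * inner_L2 g g \<le> inner_L2 (lap g) g"
      if "L2 g" "\<And>s. s \<in> {\<lambda>_. 1} \<Longrightarrow> inner_L2 g s = 0" for g
      by (rule bottom_le_form[OF that(1) that(2)]) simp
  qed (use q mean in auto)
  also have "\<dots> \<le> 0" using form0 by (intro mult_nonneg_nonpos) auto
  finally have "norm_L2 ?h = 0" by simp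
  then have "AE x in unit_measure. ?h x = 0" using norm_L2_eq_0_iff[OF h] by simp
  then have "?h x = 0" if "x \<in> {0..1}" for x using continuous_AE_zero[OF ch _ that] by simp
  then show ?thesis unfolding bottom_eigenfn_def using cq mean by simp
qed

lemma eigder_nonneg:
  assumes f: "bottom_eigenfn f" and x: "x \<in> {0..1}"
    and mono: "\<And>a b. 0 \<le> a \<Longrightarrow> a \<le> b \<Longrightarrow> b \<le> 1 \<Longrightarrow> f a \<le> f b"
  shows "0 \<le> eigder f x"
proof (rule tendsto_lowerbound[OF _ _ at_unit_not_bot[OF x]])
  show "((\<lambda>t. (f t - f x) / (t - x)) \<longlongrightarrow> eigder f x) (at x within {0..1})"
    using bottom_eigenfn_has_derivative[OF f x] by (simp add: has_field_derivative_iff)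
  have "0 \<le> (f t - f x) / (t - x)" if "t \<in> {0..1}" for t
    using mono[of t x] mono[of x t] that x
    by (cases "t \<le> x") (auto intro: divide_nonneg_nonneg divide_nonpos_nonpos)
  then show "\<forall>\<^sub>F t in at x within {0..1}. 0 \<le> (f t - f x) / (t - x)"
    by (auto simp: eventually_at_filter)
qed

text \<open>Both \<open>q + f\<close> and \<open>q - f\<close> are increasing eigenfunctions, so
  \<open>\<bar>f'\<bar> <= q'\<close>. The two sides have the same integral over [0,1], hence they
  agree at some point. There \<open>q + f\<close> or \<open>q - f\<close> is a monotone
  eigenfunction with a critical point, and so it is zero.\<close>

lemma eigenfn_eq_variation:
  assumes f: "bottom_eigenfn f"
  shows "(\<forall>x\<in>{0..1}. f x = centered_variation f x) \<or> (\<forall>x\<in>{0..1}. f x = - centered_variation f x)"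
proof -
  let ?q = "centered_variation f"
  note q = centered_variation_eigenfn[OF f]
  have comb: "bottom_eigenfn (\<lambda>x. ?q x + t * f x)" for t by (rule bottom_eigenfn_combine[OF q f])
  have mono: "?q a + t * f a \<le> ?q b + t * f b" if "0 \<le> a" "a \<le> b" "b \<le> 1" "t = 1 \<or> t = - 1" for a b t
    using centered_variation_ge[OF f that(1-3)] that(4) by auto
  have e: "eigder (\<lambda>x. ?q x + t * f x) x = eigder ?q x + t * eigder f x" if "x \<in> {0..1}" for x t
    by (rule eigder_combine[OF q f that])
  have ge: "\<bar>eigder f x\<bar> \<le> eigder ?q x" if x: "x \<in> {0..1}" for x
  proof -
    have "0 \<le> eigder ?q x + t * eigder f x" if "t = 1 \<or> t = - 1" for t
      unfolding e[OF x, symmetric] using mono that by (intro eigder_nonneg[OF comb x])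
    from this[of 1] this[of "-1"] show ?thesis by simp
  qed
  have "\<exists>x\<in>{0..1}. \<not> 0 < eigder ?q x - \<bar>eigder f x\<bar>"
  proof (rule ccontr)
    assume "\<not> ?thesis"
    then have lt: "0 < eigder ?q x - \<bar>eigder f x\<bar>" if "x \<in> {0..1}" for x using that by blast
    have "((\<lambda>x. \<bar>eigder f x\<bar>) has_integral (?q 1 - ?q 0)) {0..1}"
      using variation_diff[OF f, of 0 1] eigder_abs_integrable[OF f, of 0 1]
      by (simp add: centered_variation_def has_integral_integral)
    moreover have "(eigder ?q has_integral (?q 1 - ?q 0)) {0..1}"
      by (rule eigder_has_integral[OF q]) auto
    ultimately have "((\<lambda>x. eigder ?q x - \<bar>eigder f x\<bar>) has_integral (?q 1 - ?q 0) - (?q 1 - ?q 0)) {0..1}"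
      by (rule has_integral_diff[rotated])
    from positive_has_integral_pos[OF this lt] show False by simp
  qed
  then obtain x where x: "x \<in> {0..1}" "\<not> 0 < eigder ?q x - \<bar>eigder f x\<bar>" by blast
  then have "\<bar>eigder f x\<bar> = eigder ?q x" using ge[of x] by simp
  then obtain t where t: "t = 1 \<or> t = - 1" "eigder ?q x + t * eigder f x = 0"
    by (cases "eigder f x \<ge> 0") (auto intro: that[of "- 1"] that[of 1])
  have "?q y + t * f y = 0" if y: "y \<in> {0..1}" for y
  proof (rule monotone_eigenfn_zero[OF comb x(1) _ _ y])
    show "eigder (\<lambda>x. ?q x + t * f x) x = 0" unfolding e[OF x(1)] by (rule t(2))
    show "?q a + t * f a \<le> ?q b + t * f b" if "0 \<le> a" "a \<le> b" "b \<le> 1" for a b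
      by (rule mono[OF that t(1)])
  qed
  then show ?thesis using t(1) by (auto simp: add_eq_0_iff)
qed

text \<open>Every eigenfunction is now known to be monotone up to sign, so
  \<open>monotone_eigenfn_zero\<close> applies without a monotonicity assumption.\<close>

lemma eigder_zero_imp_zero:
  assumes f: "bottom_eigenfn f" and x: "x \<in> {0..1}" and e: "eigder f x = 0" and y: "y \<in> {0..1}"
  shows "f y = 0"
  using eigenfn_eq_variation[OF f]
proof
  assume eq: "\<forall>x\<in>{0..1}. f x = centered_variation f x"
  show ?thesis
  proof (rule monotone_eigenfn_zero[OF f x e _ y])
    show "f a \<le> f b" if "0 \<le> a" "a \<le> b" "b \<le> 1" for a b
      using centered_variation_ge[OF f that] bspec[OF eq, of a] bspec[OF eq, of b] that by auto
  qed
next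
  assume eq: "\<forall>x\<in>{0..1}. f x = - centered_variation f x"
  \<comment> \<open>The zero function lets \<open>- f\<close> be treated by the lemmas on linear
    combinations.\<close>
  have z: "bottom_eigenfn (\<lambda>_. 0)" by (simp add: bottom_eigenfn_def lap_const inner_L2_def)
  note m = bottom_eigenfn_combine[OF z f, of "- 1"]
  have "0 + (- 1) * f y = 0"
  proof (rule monotone_eigenfn_zero[OF m x _ _ y])
    show "eigder (\<lambda>x. 0 + (- 1) * f x) x = 0"
      unfolding eigder_combine[OF z f x] e by (simp add: eigder_def)
    show "0 + (- 1) * f a \<le> 0 + (- 1) * f b" if "0 \<le> a" "a \<le> b" "b \<le> 1" for a b
      using centered_variation_ge[OF f that] bspec[OF eq, of a] bspec[OF eq, of b] that by auto
  qed
  then show ?thesis by simp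
qed

text \<open>The multiple of \<open>g\<close> is chosen to cancel the derivative of \<open>f\<close>
  at 0; the difference then has a critical point and vanishes identically.\<close>

theorem bottom_eigenvalue_simple:
  assumes f: "bottom_eigenfn f" and g: "bottom_eigenfn g" and ne: "x0 \<in> {0..1}" "g x0 \<noteq> 0"
  obtains c where "\<And>x. x \<in> {0..1} \<Longrightarrow> f x = c * g x"
proof
  fix x :: real assume x: "x \<in> {0..1}"
  define c where "c = eigder f 0 / eigder g 0"
  have g0: "eigder g 0 \<noteq> 0"
  proof
    assume "eigder g 0 = 0"
    then have "g x0 = 0" using eigder_zero_imp_zero[OF g, of 0 x0] ne(1) by simp
    then show False using ne(2) by simp
  qed
  have "eigder (\<lambda>x. f x + (- c) * g x) 0 = 0"
    using eigder_combine[OF f g, of 0 "- c"] g0 by (simp add: c_def)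
  then have "f x + (- c) * g x = 0"
    by (intro eigder_zero_imp_zero[OF bottom_eigenfn_combine[OF f g] _ _ x, of 0]) auto
  then show "f x = eigder f 0 / eigder g 0 * g x" by (simp add: c_def)
qed

end

section \<open>Spectrum and spectral gap\<close>

lemma L2_zero_of_norm:
  assumes "L2 f" "L2 g" "norm_L2 (\<lambda>x. f x - g x) = 0"
  shows "AE x in unit_measure. f x = g x"
  using norm_L2_eq_0_iff[OF L2_diff[OF assms(1,2)]] assms(3) by simp

context lipschitz_graphon
begin

text \<open>A Fredholm alternative by hand. Injectivity and compactness give a lower bound
  \<open>c * norm f <= norm (A f)\<close>; with symmetry, this lets an iteration solve
  \<open>A f = h\<close> approximately. The approximate solutions are bounded and subconverge to an
  exact one.\<close>

lemma shifted_lap_surjective: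
  assumes inj: "\<And>f. L2 f \<Longrightarrow> AE x in unit_measure. lap f x = m * f x \<Longrightarrow> norm_L2 f = 0"
    and d: "d > 0" "\<And>x. x \<in> {0..1} \<Longrightarrow> d \<le> deg x - m"
    and h: "L2 h"
  shows "\<exists>f. L2 f \<and> (\<forall>x\<in>{0..1}. lap f x - m * f x = h x)"
proof -
  have db: "\<forall>x\<in>{0..1}. d \<le> deg x - m" using d(2) by blast
  define A where "A f x = lap f x - m * f x" for f x
  have A2: "L2 (A f)" if "L2 f" for f
    unfolding A_def[abs_def] by (rule L2_diff[OF lap_L2[OF that] L2_cmult[OF that]])
  define b where "b = 2 + \<bar>m\<bar>"
  have b: "b > 0" "b \<ge> 1" by (simp_all add: b_def)
  have Ab: "norm_L2 (A f) \<le> b * norm_L2 f" if "L2 f" for f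
  proof -
    have "norm_L2 (A f) \<le> norm_L2 (lap f) + norm_L2 (\<lambda>x. m * f x)"
      unfolding A_def[abs_def] by (rule norm_L2_triangle_diff[OF lap_L2[OF that] L2_cmult[OF that]])
    then show ?thesis
      using lap_norm_le[OF that] by (simp add: norm_L2_cmult b_def algebra_simps)
  qed
  have Asym: "inner_L2 (A f) g = inner_L2 f (A g)" if "L2 f" "L2 g" for f g
    unfolding A_def[abs_def] inner_L2_diff_left[OF lap_L2[OF that(1)] L2_cmult[OF that(1)] that(2)]
      inner_L2_diff_right[OF lap_L2[OF that(2)] L2_cmult[OF that(2)] that(1)]
      inner_L2_cmult_left inner_L2_cmult_right lap_symmetric[OF that] ..
  have Aadd: "A (\<lambda>x. f x + t * g x) x = A f x + t * A g x" if "L2 f" "L2 g" "x \<in> {0..1}" for f g t x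
    unfolding A_def lap_add[OF that(1) L2_cmult[OF that(2)] that(3)] lap_cmult[OF that(2,3)]
    by (simp add: algebra_simps)
  have "\<exists>c>0. \<forall>f. L2 f \<longrightarrow> c * norm_L2 f \<le> norm_L2 (A f)"
  proof (rule ccontr)
    assume *: "\<not> ?thesis"
    have ex: "\<exists>f. L2 f \<and> norm_L2 f = 1 \<and> norm_L2 (A f) < 1 / real (Suc n)" for n
    proof -
      have "1 / real (Suc n) > 0" by simp
      then obtain f where f: "L2 f" "norm_L2 (A f) < 1 / real (Suc n) * norm_L2 f"
        using * by (meson not_le)
      have p: "norm_L2 f > 0"
      proof (rule ccontr)
        assume "\<not> norm_L2 f > 0"
        then have "norm_L2 f = 0" using norm_L2_nonneg[of f] by linarith
        then show False using f(2) norm_L2_nonneg[of "A f"] by simp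
      qed
      define k where "k = 1 / norm_L2 f"
      have k: "k > 0" "k * norm_L2 f = 1" using p by (simp_all add: k_def)
      have "norm_L2 (A (\<lambda>x. k * f x)) = norm_L2 (\<lambda>x. k * A f x)"
        using f(1) by (intro norm_L2_cong) (simp add: A_def lap_cmult algebra_simps)
      also have "\<dots> = k * norm_L2 (A f)" using k(1) by (simp add: norm_L2_cmult)
      also have "\<dots> < k * (1 / real (Suc n) * norm_L2 f)" by (rule mult_strict_left_mono[OF f(2) k(1)])
      also have "\<dots> = 1 / real (Suc n) * (k * norm_L2 f)" by simp
      finally have "norm_L2 (A (\<lambda>x. k * f x)) < 1 / real (Suc n)" unfolding k(2) by simp
      moreover have "norm_L2 (\<lambda>x. k * f x) = 1" using k by (simp add: norm_L2_cmult)
      ultimately show ?thesis using f(1) by blast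
    qed
    define f where "f n = (SOME f. L2 f \<and> norm_L2 f = 1 \<and> norm_L2 (A f) < 1 / real (Suc n))" for n
    have f: "L2 (f n)" "norm_L2 (f n) = 1" "norm_L2 (A (f n)) < 1 / real (Suc n)" for n
      using someI_ex[OF ex[of n]] unfolding f_def by blast+
    have lim: "(\<lambda>n. norm_L2 (\<lambda>x. lap (f n) x - m * f n x)) \<longlonglongrightarrow> 0"
    proof (rule tendsto_sandwich[OF _ _ tendsto_const])
      show "(\<lambda>n. 1 / real (Suc n)) \<longlonglongrightarrow> 0"
        using LIMSEQ_inverse_real_of_nat by (simp add: inverse_eq_divide)
      show "\<forall>\<^sub>F n in sequentially. norm_L2 (\<lambda>x. lap (f n) x - m * f n x) \<le> 1 / real (Suc n)"
        using f(3) by (intro always_eventually allI less_imp_le) (simp add: A_def[abs_def])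
    qed simp
    obtain g and r :: "nat \<Rightarrow> nat" where g: "strict_mono r" "continuous_on {0..1} g"
      "\<And>x. x \<in> {0..1} \<Longrightarrow> lap g x = m * g x"
      and conv: "(\<lambda>n. norm_L2 (\<lambda>x. f (r n) x - g x)) \<longlonglongrightarrow> 0"
      using approximate_eigenfunctions_subconverge[OF f(1) eq_refl[OF f(2)] d(1) db lim] by blast
    have g2: "L2 g" using g(2) by (rule L2_continuous)
    have "norm_L2 g = 1"
      using norm_L2_tendsto[OF f(1) g2 conv] f(2) by (simp add: LIMSEQ_const_iff)
    moreover have "AE x in unit_measure. lap g x = m * g x" using g(3) by (intro AE_I2) simp
    ultimately show False using inj[OF g2] by simp
  qed
  then obtain c0 where c0: "c0 > 0" "\<And>f. L2 f \<Longrightarrow> c0 * norm_L2 f \<le> norm_L2 (A f)" by blast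
  \<comment> \<open>Capped at 1 so that \<open>t * c\<^sup>2 <= 1\<close> and the contraction factor
    is the root of a nonnegative number.\<close>
  define c where "c = min c0 1"
  have c: "c > 0" "c \<le> 1" using c0(1) by (auto simp: c_def)
  have cA: "c * norm_L2 f \<le> norm_L2 (A f)" if "L2 f" for f
    using order_trans[OF mult_right_mono[of c c0 "norm_L2 f"] c0(2)[OF that]] by (simp add: c_def)
  \<comment> \<open>The usual gradient step for an operator of norm at most \<open>b\<close>: the
    second order term then cancels half of the first order gain.\<close>
  define t where "t = 1 / b\<^sup>2"
  have b2: "b\<^sup>2 > 0" "b\<^sup>2 \<ge> 1" using b(1) one_le_power[OF b(2)] by simp_all
  have t: "t > 0" "t * b\<^sup>2 = 1" "t \<le> 1" using b2 by (simp_all add: t_def)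
  define q where "q = sqrt (1 - t * c\<^sup>2)"
  have tc: "t * c\<^sup>2 \<le> 1" using mult_mono[of t 1 "c\<^sup>2" 1] t c by (simp add: power_le_one)
  have q: "0 \<le> q" "q < 1" "q\<^sup>2 = 1 - t * c\<^sup>2"
    using tc t(1) c(1) by (simp_all add: q_def)
  txt \<open>Damped Richardson iteration \<open>f + t A (h - A f)\<close> contracts the residual by the factor \<open>q\<close>.\<close>
  have approx: "\<exists>f. L2 f \<and> norm_L2 (\<lambda>x. h x - A f x) \<le> q ^ n * norm_L2 h" for n
  proof (induction n)
    case 0
    have "norm_L2 (\<lambda>x. h x - A (\<lambda>_. 0) x) = norm_L2 h"
      by (intro norm_L2_cong) (simp add: A_def lap_const)
    then show ?case by (intro exI[of _ "\<lambda>_. 0"]) simp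
  next
    case (Suc n)
    then obtain f where f: "L2 f" "norm_L2 (\<lambda>x. h x - A f x) \<le> q ^ n * norm_L2 h" by blast
    define r where "r x = h x - A f x" for x
    have r2: "L2 r" unfolding r_def by (rule L2_diff[OF h A2[OF f(1)]])
    note Ar = A2[OF r2] and AAr = A2[OF A2[OF r2]]
    define f' where "f' x = f x + t * A r x" for x
    have f': "L2 f'" unfolding f'_def by (rule L2_add[OF f(1) L2_cmult[OF Ar]])
    have "norm_L2 (\<lambda>x. h x - A f' x) = norm_L2 (\<lambda>x. r x + (- t) * A (A r) x)"
    proof (rule norm_L2_cong)
      fix x :: real assume x: "x \<in> {0..1}"
      show "h x - A f' x = r x + (- t) * A (A r) x"
        using Aadd[OF f(1) Ar x, of t] by (simp add: f'_def[abs_def] r_def)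
    qed
    moreover have "(norm_L2 (\<lambda>x. r x + (- t) * A (A r) x))\<^sup>2 \<le> (q * norm_L2 r)\<^sup>2"
    proof -
      have "(norm_L2 (\<lambda>x. r x + (- t) * A (A r) x))\<^sup>2
        = (norm_L2 r)\<^sup>2 + 2 * (- t) * inner_L2 r (A (A r)) + (- t)\<^sup>2 * (norm_L2 (A (A r)))\<^sup>2"
        unfolding norm_L2_sq inner_L2_square_add[OF r2 AAr] ..
      also have "inner_L2 r (A (A r)) = (norm_L2 (A r))\<^sup>2"
        using Asym[OF r2 Ar] by (simp add: norm_L2_sq)
      also have "(- t)\<^sup>2 * (norm_L2 (A (A r)))\<^sup>2 \<le> t\<^sup>2 * (b * norm_L2 (A r))\<^sup>2"
        using Ab[OF Ar] by (auto intro!: mult_left_mono power_mono)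
      also have "\<dots> = t * (t * b\<^sup>2) * (norm_L2 (A r))\<^sup>2"
        by (simp add: power2_eq_square mult_ac)
      finally have "(norm_L2 (\<lambda>x. r x + (- t) * A (A r) x))\<^sup>2 \<le> (norm_L2 r)\<^sup>2 - t * (norm_L2 (A r))\<^sup>2"
        unfolding t(2) by simp
      also have "(c * norm_L2 r)\<^sup>2 \<le> (norm_L2 (A r))\<^sup>2"
        using cA[OF r2] c(1) by (intro power_mono) auto
      then have "t * (c * norm_L2 r)\<^sup>2 \<le> t * (norm_L2 (A r))\<^sup>2" using t(1) by (intro mult_left_mono) auto
      then have "(norm_L2 r)\<^sup>2 - t * (norm_L2 (A r))\<^sup>2 \<le> (norm_L2 r)\<^sup>2 - t * (c * norm_L2 r)\<^sup>2" by simp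
      also have "\<dots> = (q * norm_L2 r)\<^sup>2"
        unfolding power_mult_distrib q(3) by (simp add: algebra_simps)
      finally show ?thesis .
    qed
    then have "norm_L2 (\<lambda>x. r x + (- t) * A (A r) x) \<le> q * norm_L2 r"
      by (rule power2_le_imp_le) (use q in simp)
    moreover have "q * norm_L2 r \<le> q * (q ^ n * norm_L2 h)"
      using f(2) q(1) unfolding r_def by (rule mult_left_mono)
    ultimately have "norm_L2 (\<lambda>x. h x - A f' x) \<le> q ^ Suc n * norm_L2 h" by simp
    then show ?case using f' by blast
  qed
  define f where "f n = (SOME f. L2 f \<and> norm_L2 (\<lambda>x. h x - A f x) \<le> q ^ n * norm_L2 h)" for n
  have f: "L2 (f n)" "norm_L2 (\<lambda>x. h x - A (f n) x) \<le> q ^ n * norm_L2 h" for n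
    using someI_ex[OF approx[of n]] unfolding f_def by blast+
  have eq: "norm_L2 (\<lambda>x. lap (f n) x - m * f n x - h x) = norm_L2 (\<lambda>x. h x - A (f n) x)" for n
    using norm_L2_cmult[of "- 1" "\<lambda>x. h x - A (f n) x"] by (simp add: A_def)
  \<comment> \<open>The lower bound for \<open>A\<close> is used a second time: the images stay
    within twice the norm of \<open>h\<close>, hence so do the iterates up to the factor
    \<open>1 / c\<close>.\<close>
  have bd: "norm_L2 (f n) \<le> 2 * norm_L2 h / c" for n
  proof -
    have "norm_L2 (A (f n)) \<le> norm_L2 h + norm_L2 (\<lambda>x. h x - A (f n) x)"
      using norm_L2_triangle_diff[OF h L2_diff[OF h A2[OF f(1)[of n]]]] by simp
    also have "norm_L2 (\<lambda>x. h x - A (f n) x) \<le> 1 * norm_L2 h"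
      by (rule order_trans[OF f(2) mult_right_mono]) (use q in \<open>auto intro: power_le_one\<close>)
    finally have "c * norm_L2 (f n) \<le> 2 * norm_L2 h" using cA[OF f(1)[of n]] by simp
    then show ?thesis using c(1) by (simp add: field_simps)
  qed
  have lim: "(\<lambda>n. norm_L2 (\<lambda>x. lap (f n) x - m * f n x - h x)) \<longlonglongrightarrow> 0"
    unfolding eq
  proof (rule tendsto_sandwich[OF _ _ tendsto_const])
    show "(\<lambda>n. q ^ n * norm_L2 h) \<longlonglongrightarrow> 0"
      using q by (intro tendsto_mult_left_zero LIMSEQ_realpow_zero)
    show "\<forall>\<^sub>F n in sequentially. norm_L2 (\<lambda>x. h x - A (f n) x) \<le> q ^ n * norm_L2 h"
      by (intro always_eventually allI f(2))
  qed simp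
  show ?thesis
    using approximate_solutions_subconverge[OF f(1) bd d(1) db h lim] by (elim exE conjE) (intro exI conjI)
qed

lemma not_in_spectrum:
  assumes inj: "\<And>f. L2 f \<Longrightarrow> AE x in unit_measure. lap f x = m * f x \<Longrightarrow> norm_L2 f = 0"
    and d: "d > 0" "\<And>x. x \<in> {0..1} \<Longrightarrow> d \<le> deg x - m"
  shows "m \<notin> lap_spectrum w"
proof -
  have "\<exists>f. L2 f \<and> ae_eq01 (\<lambda>x. lap f x - m * f x) h" if h: "L2 h" for h
  proof -
    obtain f where f: "L2 f" "\<forall>x\<in>{0..1}. lap f x - m * f x = h x"
      using shifted_lap_surjective[OF inj d h] by blast
    then show ?thesis unfolding ae_eq01_def by (intro exI[of _ f] conjI AE_I2) auto
  qed
  moreover have "ae_eq01 f (\<lambda>_. 0)" if f: "L2 f" "ae_eq01 (\<lambda>x. lap f x - m * f x) (\<lambda>_. 0)" for f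
  proof -
    have "AE x in unit_measure. lap f x = m * f x" using f(2) by (simp add: ae_eq01_def)
    then show ?thesis using inj[OF f(1)] norm_L2_eq_0_iff[OF f(1)] by (simp add: ae_eq01_def)
  qed
  ultimately show ?thesis unfolding lap_spectrum_def by blast
qed

end

context robinson_graphon
begin

lemma principal_exists: "\<exists>g. bottom_eigenfn g \<and> norm_L2 g = 1"
proof -
  obtain g where "continuous_on {0..1} g" "\<And>x. x \<in> {0..1} \<Longrightarrow> lap g x = bottom * g x"
    "norm_L2 g = 1" "inner_L2 g (\<lambda>_. 1) = 0"
    using bottom_eigenfunction[OF margin_pos margin_le] by blast
  then show ?thesis unfolding bottom_eigenfn_def by blast
qed

text \<open>A normalised eigenfunction for \<open>bottom\<close>; by simplicity it is determined up
  to sign.\<close>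

definition principal :: "real \<Rightarrow> real" where
  "principal = (SOME g. bottom_eigenfn g \<and> norm_L2 g = 1)"

lemma principal: "bottom_eigenfn principal" "norm_L2 principal = 1"
  using someI_ex[OF principal_exists] by (simp_all add: principal_def)

lemmas principal_L2 = bottom_eigenfnD(2)[OF principal(1)]
  and principal_mean = bottom_eigenfnD(4)[OF principal(1)]

lemma principal_inner: "inner_L2 principal principal = 1"
  using principal(2) norm_L2_sq[of principal] by simp

lemma inner_lap_principal:
  assumes "L2 f" shows "inner_L2 (lap f) principal = bottom * inner_L2 f principal"
proof -
  have "inner_L2 (lap f) principal = inner_L2 f (lap principal)"
    by (rule lap_symmetric[OF assms principal_L2])
  also have "\<dots> = inner_L2 f (\<lambda>x. bottom * principal x)"
    using bottom_eigenfnD(3)[OF principal(1)] by (intro inner_L2_cong) auto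
  finally show ?thesis by (simp add: inner_L2_cmult_right)
qed

text \<open>Without a gap, there are normalised functions orthogonal to the constants and to
  \<open>principal\<close> whose Rayleigh quotients tend to \<open>bottom\<close>. They produce an
  eigenfunction for \<open>bottom\<close> orthogonal to \<open>principal\<close>, against
  simplicity.\<close>

lemma spectral_gap:
  obtains g where "0 < g" "g < margin"
    "\<And>f. L2 f \<Longrightarrow> inner_L2 f (\<lambda>_. 1) = 0 \<Longrightarrow> inner_L2 f principal = 0 \<Longrightarrow>
      (bottom + g) * inner_L2 f f \<le> inner_L2 (lap f) f"
proof -
  let ?P = "\<lambda>g f. L2 f \<and> inner_L2 f (\<lambda>_. 1) = 0 \<and> inner_L2 f principal = 0 \<and>
      inner_L2 (lap f) f < (bottom + g) * inner_L2 f f"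
  \<comment> \<open>The shift \<open>n + 2\<close> makes each candidate strictly smaller than
    \<open>margin\<close>, so that \<open>bottom\<close> plus the gap still lies below all degrees
    and compactness remains available there.\<close>
  have "\<exists>n. \<forall>f. \<not> ?P (margin / real (n + 2)) f"
  proof (rule ccontr)
    assume *: "\<not> ?thesis"
    have ex: "\<exists>f. L2 f \<and> inner_L2 f (\<lambda>_. 1) = 0 \<and> inner_L2 f principal = 0 \<and> norm_L2 f = 1 \<and>
        inner_L2 (lap f) f \<le> bottom + margin / real (n + 2)" for n
    proof -
      obtain f where f: "L2 f" "inner_L2 f (\<lambda>_. 1) = 0" "inner_L2 f principal = 0"
        "inner_L2 (lap f) f < (bottom + margin / real (n + 2)) * inner_L2 f f"
        using * by blast
      have p: "norm_L2 f > 0"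
      proof (rule ccontr)
        assume "\<not> norm_L2 f > 0"
        then have "norm_L2 f = 0" using norm_L2_nonneg[of f] by linarith
        then show False using f(4) norm_L2_sq[of f] lap_form_le(2)[OF f(1)] by simp
      qed
      define k where "k = 1 / norm_L2 f"
      have k: "k > 0" "k * norm_L2 f = 1" using p by (simp_all add: k_def)
      have kk: "k * (k * inner_L2 f f) = 1"
        using k(2) unfolding norm_L2_sq[symmetric] power2_eq_square by (metis mult.assoc mult.commute mult_1)
      have "inner_L2 (lap (\<lambda>x. k * f x)) (\<lambda>x. k * f x) = inner_L2 (\<lambda>x. k * lap f x) (\<lambda>x. k * f x)"
        using f(1) by (intro inner_L2_cong) (auto simp: lap_cmult)
      also have "\<dots> = k * k * inner_L2 (lap f) f"
        by (simp add: inner_L2_cmult_left inner_L2_cmult_right)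
      also have "\<dots> \<le> k * k * ((bottom + margin / real (n + 2)) * inner_L2 f f)"
        using f(4) k(1) by (intro mult_left_mono) auto
      also have "\<dots> = (bottom + margin / real (n + 2)) * (k * (k * inner_L2 f f))" by (simp only: mult_ac)
      finally have "inner_L2 (lap (\<lambda>x. k * f x)) (\<lambda>x. k * f x) \<le> bottom + margin / real (n + 2)"
        unfolding kk by simp
      then show ?thesis using f k
        by (intro exI[of _ "\<lambda>x. k * f x"]) (auto simp: inner_L2_cmult_left norm_L2_cmult)
    qed
    define f where "f n = (SOME f. L2 f \<and> inner_L2 f (\<lambda>_. 1) = 0 \<and> inner_L2 f principal = 0 \<and>
        norm_L2 f = 1 \<and> inner_L2 (lap f) f \<le> bottom + margin / real (n + 2))" for n
    have f: "L2 (f n)" "inner_L2 (f n) (\<lambda>_. 1) = 0" "inner_L2 (f n) principal = 0" "norm_L2 (f n) = 1"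
      "inner_L2 (lap (f n)) (f n) \<le> bottom + margin / real (n + 2)" for n
      using someI_ex[OF ex[of n]] unfolding f_def by blast+
    have lower: "bottom \<le> inner_L2 (lap (f n)) (f n)" for n
      using bottom_le_form[OF f(1,2)[of n]] f(4)[of n] norm_L2_sq[of "f n"] by simp
    have lim: "(\<lambda>n. inner_L2 (lap (f n)) (f n)) \<longlonglongrightarrow> bottom"
    proof (rule tendsto_sandwich[OF _ _ tendsto_const])
      have "(\<lambda>n. margin * inverse (real (Suc (Suc n)))) \<longlonglongrightarrow> margin * 0"
        by (intro tendsto_mult_left LIMSEQ_Suc[OF LIMSEQ_inverse_real_of_nat])
      then have "(\<lambda>n. bottom + margin / real (n + 2)) \<longlonglongrightarrow> bottom + 0"
        by (intro tendsto_add tendsto_const) (simp add: divide_inverse)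
      then show "(\<lambda>n. bottom + margin / real (n + 2)) \<longlonglongrightarrow> bottom" by simp
    qed (use f(5) lower in simp_all)
    let ?S = "{\<lambda>_. 1, principal}"
    have S1: "L2 s" if "s \<in> ?S" for s
      using that principal_L2 by auto
    have S2: "\<exists>\<kappa>. \<forall>x\<in>{0..1}. lap s x = \<kappa> * s x" if "s \<in> ?S" for s
    proof (cases "s = principal")
      case True
      then show ?thesis
        using bottom_eigenfnD(3)[OF principal(1)] by (intro exI[of _ bottom]) auto
    next
      case False
      then have "s = (\<lambda>_. 1)" using that by blast
      then show ?thesis using lap_const by (intro exI[of _ 0]) auto
    qed
    have S3: "bottom * inner_L2 h h \<le> inner_L2 (lap h) h"
      if "L2 h" "\<And>s. s \<in> ?S \<Longrightarrow> inner_L2 h s = 0" for h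
      by (rule bottom_le_form[OF that(1) that(2)]) simp
    have f3: "inner_L2 (f n) s = 0" if "s \<in> ?S" for s n using that f(2,3) by auto
    note mp = margin_pos and ml = margin_le
    have "\<exists>g. continuous_on {0..1} g \<and> (\<forall>x\<in>{0..1}. lap g x = bottom * g x) \<and>
      norm_L2 g = 1 \<and> (\<forall>s\<in>?S. inner_L2 g s = 0)"
      by (rule minimizing_sequence_eigenfunction[where f = f and c = margin]) (fact S1 S2 S3 f f3 lim mp ml)+
    then obtain g where g: "bottom_eigenfn g" "norm_L2 g = 1" "inner_L2 g principal = 0"
      unfolding bottom_eigenfn_def by auto
    have "\<exists>x0\<in>{0..1}. principal x0 \<noteq> 0"
    proof (rule ccontr)
      assume "\<not> ?thesis"
      then have "norm_L2 principal = norm_L2 (\<lambda>_. 0)" by (intro norm_L2_cong) auto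
      then show False using principal(2) by (simp add: norm_L2_const)
    qed
    then obtain x0 where x0: "x0 \<in> {0..1}" "principal x0 \<noteq> 0" by blast
    obtain c where c: "\<And>x. x \<in> {0..1} \<Longrightarrow> g x = c * principal x"
      using bottom_eigenvalue_simple[OF g(1) principal(1) x0] by blast
    have "inner_L2 g principal = inner_L2 (\<lambda>x. c * principal x) principal"
      using c by (intro inner_L2_cong) auto
    then have "c = 0" using g(3) principal_inner by (simp add: inner_L2_cmult_left)
    then have "norm_L2 g = norm_L2 (\<lambda>_. 0)" using c by (intro norm_L2_cong) auto
    then show False using g(2) by (simp add: norm_L2_const)
  qed
  then obtain n where n: "\<forall>f. \<not> ?P (margin / real (n + 2)) f" by blast
  show thesis
  proof (rule that[of "margin / real (n + 2)"])
    show "0 < margin / real (n + 2)" using margin_pos by simp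
    show "margin / real (n + 2) < margin"
      using mult_strict_left_mono[of 1 "real n + 2" margin] margin_pos by (simp add: divide_less_eq)
    show "(bottom + margin / real (n + 2)) * inner_L2 f f \<le> inner_L2 (lap f) f"
      if "L2 f" "inner_L2 f (\<lambda>_. 1) = 0" "inner_L2 f principal = 0" for f
      using n that not_le by blast
  qed
qed

definition gap :: real where
  "gap = (SOME g. 0 < g \<and> g < margin \<and> (\<forall>f. L2 f \<longrightarrow> inner_L2 f (\<lambda>_. 1) = 0 \<longrightarrow>
      inner_L2 f principal = 0 \<longrightarrow> (bottom + g) * inner_L2 f f \<le> inner_L2 (lap f) f))"

lemma gap: "0 < gap" "gap < margin"
  "L2 f \<Longrightarrow> inner_L2 f (\<lambda>_. 1) = 0 \<Longrightarrow> inner_L2 f principal = 0 \<Longrightarrow>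
    (bottom + gap) * inner_L2 f f \<le> inner_L2 (lap f) f"
proof -
  have ex: "\<exists>g. 0 < g \<and> g < margin \<and> (\<forall>f. L2 f \<longrightarrow> inner_L2 f (\<lambda>_. 1) = 0 \<longrightarrow>
      inner_L2 f principal = 0 \<longrightarrow> (bottom + g) * inner_L2 f f \<le> inner_L2 (lap f) f)"
    by (rule spectral_gap) blast
  from someI_ex[OF ex]
  show "0 < gap" "gap < margin" "L2 f \<Longrightarrow> inner_L2 f (\<lambda>_. 1) = 0 \<Longrightarrow> inner_L2 f principal = 0 \<Longrightarrow>
    (bottom + gap) * inner_L2 f f \<le> inner_L2 (lap f) f"
    unfolding gap_def by blast+
qed

lemma eigenspace_inner:
  assumes "L2 f" "AE x in unit_measure. lap f x = m * f x" "L2 h"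
  shows "inner_L2 (lap f) h = m * inner_L2 f h"
proof -
  have "inner_L2 (lap f) h = inner_L2 (\<lambda>x. m * f x) h"
    using assms lap_L2[OF assms(1)] by (intro inner_L2_AE) auto
  then show ?thesis by (simp add: inner_L2_cmult_left)
qed

lemma eigenspace_mean:
  assumes "L2 f" "AE x in unit_measure. lap f x = m * f x" "m \<noteq> 0"
  shows "inner_L2 f (\<lambda>_. 1) = 0"
  using eigenspace_inner[OF assms(1,2) L2_const[of 1]] lap_orthogonal_const[OF assms(1), of 1] assms(3) by simp

text \<open>Eigenfunctions for different eigenvalues are orthogonal, so \<open>f\<close> is
  orthogonal to the constants and to \<open>principal\<close>, and its Rayleigh quotient
  \<open>m\<close> would violate the gap.\<close>

lemma eigenvalue_below_gap:
  assumes f: "L2 f" "AE x in unit_measure. lap f x = m * f x"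
    and m: "m \<noteq> 0" "m \<noteq> bottom" "m < bottom + gap"
  shows "norm_L2 f = 0"
proof -
  have "inner_L2 f principal = 0"
    using eigenspace_inner[OF f principal_L2] inner_lap_principal[OF f(1)] m(2) by simp
  then have "(bottom + gap) * inner_L2 f f \<le> m * inner_L2 f f"
    using gap(3)[OF f(1) eigenspace_mean[OF f m(1)]] eigenspace_inner[OF f f(1)] by simp
  then have "(bottom + gap - m) * inner_L2 f f \<le> 0" by (simp add: algebra_simps)
  then have "inner_L2 f f \<le> 0" using m(3) by (simp add: mult_le_0_iff)
  then show ?thesis using inner_L2_self_nonneg[of f] by (simp add: norm_L2_def)
qed

lemma spectrum_below_gap:
  assumes "m \<in> lap_spectrum w" "m < bottom + gap"
  shows "m = 0 \<or> m = bottom"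
proof (rule ccontr)
  assume "\<not> ?thesis"
  then have m: "m \<noteq> 0" "m \<noteq> bottom" by auto
  have "m \<notin> lap_spectrum w"
  proof (rule not_in_spectrum[where d = "margin - gap"])
    show "norm_L2 f = 0" if "L2 f" "AE x in unit_measure. lap f x = m * f x" for f
      by (rule eigenvalue_below_gap[OF that m assms(2)])
    show "margin - gap > 0" using gap(2) by simp
    show "margin - gap \<le> deg x - m" if "x \<in> {0..1}" for x
      using margin_le[OF that] assms(2) by simp
  qed
  then show False using assms(1) by simp
qed

text \<open>After subtraction of its mean, \<open>f\<close> has form value zero, while the form is
  at least \<open>bottom > 0\<close> times the squared norm.\<close>

lemma kernel_constant:
  assumes f: "L2 f" "AE x in unit_measure. lap f x = 0 * f x"
  shows "AE x in unit_measure. f x = inner_L2 f (\<lambda>_. 1)"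
proof (rule L2_zero_of_norm[OF f(1) L2_const])
  let ?c = "inner_L2 f (\<lambda>_. 1)"
  let ?f = "\<lambda>x. f x - ?c"
  have f': "L2 ?f" using f(1) by (intro L2_diff L2_const)
  have one: "inner_L2 (\<lambda>_. c) (\<lambda>_. 1) = c" for c using unit.prob_space by (simp add: inner_L2_def)
  have mean: "inner_L2 ?f (\<lambda>_. 1) = 0"
    unfolding inner_L2_diff_left[OF f(1) L2_const L2_const] one by simp
  have "inner_L2 (lap ?f) ?f = inner_L2 (lap f) ?f"
    using lap_diff[OF f(1) L2_const] lap_const by (intro inner_L2_cong) auto
  also have "\<dots> = 0" using eigenspace_inner[OF f f'] by simp
  finally have "bottom * inner_L2 ?f ?f \<le> 0" using bottom_le_form[OF f' mean] by simp
  then have "inner_L2 ?f ?f \<le> 0" using bottom_pos by (simp add: mult_le_0_iff)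
  then show "norm_L2 ?f = 0" using inner_L2_self_nonneg[of ?f] by (simp add: norm_L2_def)
qed

text \<open>Removing the projection to \<open>principal\<close> leaves an eigenfunction to which the
  gap inequality applies. This covers solutions in the almost everywhere sense, for which no
  continuity is known beforehand.\<close>

lemma bottom_eigenspace:
  assumes f: "L2 f" "AE x in unit_measure. lap f x = bottom * f x"
  shows "AE x in unit_measure. f x = inner_L2 f principal * principal x"
proof (rule L2_zero_of_norm[OF f(1) L2_cmult[OF principal_L2]])
  let ?c = "inner_L2 f principal"
  let ?f = "\<lambda>x. f x - ?c * principal x"
  note cp = L2_cmult[OF principal_L2, of ?c]
  have f': "L2 ?f" using f(1) cp by (rule L2_diff)
  have mean: "inner_L2 ?f (\<lambda>_. 1) = 0"
    unfolding inner_L2_diff_left[OF f(1) cp L2_const] inner_L2_cmult_left principal_mean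
    using eigenspace_mean[OF f] bottom_pos by simp
  have orth: "inner_L2 ?f principal = 0"
    unfolding inner_L2_diff_left[OF f(1) cp principal_L2] inner_L2_cmult_left principal_inner by simp
  have "AE x in unit_measure. lap ?f x = bottom * ?f x"
    using f(2) AE_space
  proof eventually_elim
    case (elim x)
    then have x: "x \<in> {0..1}" by simp
    show ?case
      unfolding lap_diff[OF f(1) cp x] lap_cmult[OF principal_L2 x] elim(1) bottom_eigenfnD(3)[OF principal(1) x]
      by (simp add: algebra_simps)
  qed
  then have "inner_L2 (lap ?f) ?f = bottom * inner_L2 ?f ?f"
    by (rule eigenspace_inner[OF f' _ f'])
  then have "gap * inner_L2 ?f ?f \<le> 0" using gap(3)[OF f' mean orth] by (simp add: algebra_simps)
  then have "inner_L2 ?f ?f \<le> 0" using gap(1) by (simp add: mult_le_0_iff)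
  then show "norm_L2 ?f = 0" using inner_L2_self_nonneg[of ?f] by (simp add: norm_L2_def)
qed

lemma isolated_zero: "isolated_finite_eigenvalue w 0"
  unfolding isolated_finite_eigenvalue_def
proof (intro conjI)
  let ?one = "\<lambda>_::real. 1::real"
  have 1: "?one \<in> lap_eigenspace w 0" by (simp add: lap_eigenspace_def ae_eq01_def lap_const)
  have "\<not> ae_eq01 ?one (\<lambda>_. 0)" using unit.AE_False by (simp add: ae_eq01_def)
  then show "\<exists>f\<in>lap_eigenspace w 0. \<not> ae_eq01 f (\<lambda>_. 0)" using 1 by blast
  have "\<exists>c. ae_eq01 f (\<lambda>x. \<Sum>b\<in>{?one}. c b * b x)" if "f \<in> lap_eigenspace w 0" for f
    using kernel_constant[of f] that
    by (intro exI[of _ "\<lambda>_. inner_L2 f (\<lambda>_. 1)"]) (simp add: lap_eigenspace_def ae_eq01_def)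
  then show "\<exists>B. finite B \<and> B \<subseteq> lap_eigenspace w 0 \<and>
      (\<forall>f\<in>lap_eigenspace w 0. \<exists>c. ae_eq01 f (\<lambda>x. \<Sum>b\<in>B. c b * b x))"
    using 1 by (intro exI[of _ "{?one}"]) simp
  have "m = 0" if "m \<in> lap_spectrum w" "\<bar>m - 0\<bar> < bottom" for m
  proof -
    have "m < bottom + gap" "m < bottom" using that(2) gap(1) by linarith+
    then show ?thesis using spectrum_below_gap[OF that(1)] by auto
  qed
  then show "\<exists>e>0. \<forall>m\<in>lap_spectrum w. \<bar>m - 0\<bar> < e \<longrightarrow> m = 0"
    using bottom_pos by blast
qed

lemma isolated_bottom: "isolated_finite_eigenvalue w bottom"
  unfolding isolated_finite_eigenvalue_def
proof (intro conjI)
  have 1: "principal \<in> lap_eigenspace w bottom"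
    using principal_L2 bottom_eigenfnD(3)[OF principal(1)]
    by (auto simp: lap_eigenspace_def ae_eq01_def intro!: AE_I2)
  have "\<not> ae_eq01 principal (\<lambda>_. 0)"
    using norm_L2_eq_0_iff[OF principal_L2] principal(2) by (simp add: ae_eq01_def)
  then show "\<exists>f\<in>lap_eigenspace w bottom. \<not> ae_eq01 f (\<lambda>_. 0)" using 1 by blast
  have "\<exists>c. ae_eq01 f (\<lambda>x. \<Sum>b\<in>{principal}. c b * b x)" if "f \<in> lap_eigenspace w bottom" for f
    using bottom_eigenspace[of f] that
    by (intro exI[of _ "\<lambda>_. inner_L2 f principal"]) (simp add: lap_eigenspace_def ae_eq01_def)
  then show "\<exists>B. finite B \<and> B \<subseteq> lap_eigenspace w bottom \<and>
      (\<forall>f\<in>lap_eigenspace w bottom. \<exists>c. ae_eq01 f (\<lambda>x. \<Sum>b\<in>B. c b * b x))"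
    using 1 by (intro exI[of _ "{principal}"]) simp
  have "m = bottom" if "m \<in> lap_spectrum w" "\<bar>m - bottom\<bar> < min bottom gap" for m
  proof -
    have "m < bottom + gap" "0 < m" using that(2) by linarith+
    then show ?thesis using spectrum_below_gap[OF that(1)] by auto
  qed
  then show "\<exists>e>0. \<forall>m\<in>lap_spectrum w. \<bar>m - bottom\<bar> < e \<longrightarrow> m = bottom"
    using bottom_pos gap(1) by (intro exI[of _ "min bottom gap"]) auto
qed

lemma eigenvalue_cases:
  assumes "isolated_finite_eigenvalue w m"
  shows "m = 0 \<or> bottom \<le> m"
proof (rule ccontr)
  assume "\<not> ?thesis"
  then have m: "m \<noteq> 0" "m < bottom" by auto
  obtain f where f: "L2 f" "AE x in unit_measure. lap f x = m * f x" "\<not> (AE x in unit_measure. f x = 0)"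
    using assms unfolding isolated_finite_eigenvalue_def lap_eigenspace_def ae_eq01_def by blast
  have "norm_L2 f = 0" using eigenvalue_below_gap[OF f(1,2) m(1)] m(2) gap(1) by simp
  then show False using f(3) norm_L2_eq_0_iff[OF f(1)] by simp
qed

text \<open>The values 0 and \<open>bottom\<close> are isolated eigenvalues and no other lies below
  \<open>bottom\<close>. A value above \<open>bottom\<close> would have two predecessors, and 0 has
  none.\<close>

lemma fiedler_value_eq_bottom:
  assumes "fiedler_value w l" shows "l = bottom"
proof -
  have l: "isolated_finite_eigenvalue w l" and c: "card {m. isolated_finite_eigenvalue w m \<and> m < l} = 1"
    using assms by (auto simp: fiedler_value_def)
  obtain a where a: "{m. isolated_finite_eigenvalue w m \<and> m < l} = {a}"
    using c by (auto simp: card_1_singleton_iff)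
  have "\<not> bottom < l"
  proof
    assume "bottom < l"
    then have "0 \<in> {m. isolated_finite_eigenvalue w m \<and> m < l}"
      "bottom \<in> {m. isolated_finite_eigenvalue w m \<and> m < l}"
      using isolated_zero isolated_bottom bottom_pos by auto
    then show False unfolding a using bottom_pos by simp
  qed
  moreover have "l \<noteq> 0"
  proof
    assume "l = 0"
    have "a \<in> {m. isolated_finite_eigenvalue w m \<and> m < l}" by (rule equalityD2[OF a, THEN subsetD]) simp
    then show False using eigenvalue_cases[of a] bottom_pos \<open>l = 0\<close> by auto
  qed
  ultimately show ?thesis using eigenvalue_cases[OF l] by simp
qed

lemma fiedler_function_principal:
  assumes \<phi>: "fiedler_function w \<phi>" and n: "norm_L2 \<phi> = 1"
  obtains c where "c = 1 \<or> c = - 1" "L2 \<phi>" "AE x in unit_measure. \<phi> x = c * principal x"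
proof -
  obtain l where l: "fiedler_value w l" "\<phi> \<in> lap_eigenspace w l"
    using \<phi> unfolding fiedler_function_def by blast
  have p: "L2 \<phi>" "AE x in unit_measure. lap \<phi> x = bottom * \<phi> x"
    using l(2) unfolding fiedler_value_eq_bottom[OF l(1)] lap_eigenspace_def ae_eq01_def by auto
  let ?c = "inner_L2 \<phi> principal"
  note ae = bottom_eigenspace[OF p]
  have "inner_L2 \<phi> \<phi> = inner_L2 (\<lambda>x. ?c * principal x) (\<lambda>x. ?c * principal x)"
    using ae p(1) principal_L2 by (intro inner_L2_AE) auto
  also have "\<dots> = ?c * ?c" by (simp add: inner_L2_cmult_left inner_L2_cmult_right principal_inner)
  finally have "?c * ?c = 1" using n norm_L2_sq[of \<phi>] by simp
  then have "?c = 1 \<or> ?c = - 1" by (simp add: square_eq_1_iff)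
  then show thesis using that p(1) ae by blast
qed

end

section \<open>Moments of independent Bernoulli variables and log-convex sequences\<close>

lemma expectation_prod_Pi_pmf_finite:
  fixes f :: "'a \<Rightarrow> 'b \<Rightarrow> real"
  assumes A: "finite A" and fin: "\<And>x. x \<in> A \<Longrightarrow> finite (set_pmf (p x))"
  shows "measure_pmf.expectation (Pi_pmf A d p) (\<lambda>y. \<Prod>x\<in>A. f x (y x))
    = (\<Prod>x\<in>A. measure_pmf.expectation (p x) (f x))"
proof (cases "A = {}")
  case False
  let ?P = "Pi_pmf A d p"
  have comp: "map_pmf (\<lambda>y. y x) ?P = p x" if "x \<in> A" for x
    using Pi_pmf_component[OF A, of x d p] that by simp
  have int: "integrable (measure_pmf ?P) (\<lambda>y. f x (y x))" if "x \<in> A" for x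
  proof -
    have "integrable (map_pmf (\<lambda>y. y x) ?P) (f x)"
      unfolding comp[OF that] by (rule integrable_measure_pmf_finite[OF fin[OF that]])
    then show ?thesis by simp
  qed
  have I: "prob_space.indep_vars (measure_pmf ?P) (\<lambda>_. count_space UNIV) (\<lambda>x y. y x) A"
    by (rule indep_vars_Pi_pmf[OF A])
  have "prob_space.indep_vars (measure_pmf ?P) (\<lambda>_. borel) (\<lambda>x y. f x (y x)) A"
    by (rule prob_space.indep_vars_compose2[OF measure_pmf.prob_space_axioms I]) auto
  then have "measure_pmf.expectation ?P (\<lambda>y. \<Prod>x\<in>A. f x (y x)) = (\<Prod>x\<in>A. measure_pmf.expectation ?P (\<lambda>y. f x (y x)))"
    by (intro prob_space.indep_vars_lebesgue_integral[OF measure_pmf.prob_space_axioms A] int)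
  also have "\<dots> = (\<Prod>x\<in>A. measure_pmf.expectation (map_pmf (\<lambda>y. y x) ?P) (f x))"
    by simp
  also have "\<dots> = (\<Prod>x\<in>A. measure_pmf.expectation (p x) (f x))"
    using comp by (intro prod.cong) simp_all
  finally show ?thesis .
qed simp

text \<open>An edge passed exactly once annihilates the expectation of a walk; an edge passed more
  often costs one factor \<open>r\<close>, whatever its multiplicity.\<close>

lemma bernoulli_centered_moment_le:
  fixes q r :: real
  assumes q: "0 \<le> q" "q \<le> r" "r \<le> 1"
  shows "\<bar>measure_pmf.expectation (bernoulli_pmf q) (\<lambda>b. (of_bool b - q) ^ m)\<bar>
    \<le> (if m = 0 then 1 else if m = 1 then 0 else r)"
proof -
  have e: "measure_pmf.expectation (bernoulli_pmf q) (\<lambda>b. (of_bool b - q) ^ m)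
    = q * (1 - q) ^ m + (1 - q) * (- q) ^ m"
    using q by (simp add: integral_bernoulli_pmf)
  consider "m = 0" | "m = 1" | k where "m = Suc (Suc k)" by (metis One_nat_def not0_implies_Suc)
  then show ?thesis
  proof cases
    case 3
    have "\<bar>q * (1 - q) ^ m + (1 - q) * (- q) ^ m\<bar> \<le> q * (1 - q) ^ m + (1 - q) * q ^ m"
      using abs_triangle_ineq[of "q * (1 - q) ^ m" "(1 - q) * (- q) ^ m"] q
      by (simp add: abs_mult power_abs)
    also have "\<dots> \<le> q * (1 - q) + (1 - q) * q\<^sup>2"
    proof -
      have "(1 - q) ^ m \<le> (1 - q) ^ 1" "q ^ m \<le> q\<^sup>2"
        using q 3 by (intro power_decreasing; simp)+
      then show ?thesis using q by (intro add_mono mult_left_mono) auto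
    qed
    also have "\<dots> = q - q * q\<^sup>2" by (simp add: power2_eq_square algebra_simps)
    also have "\<dots> \<le> r"
    proof -
      have "0 \<le> q * q\<^sup>2" using q by simp
      then show ?thesis using q(2) by linarith
    qed
    finally show ?thesis using 3 unfolding e by simp
  qed (use e in auto)
qed

text \<open>The ratios of consecutive terms increase, so the first ratio is at most the geometric
  mean of the ratios up to \<open>Suc k\<close>. The statement avoids division because terms may
  vanish.\<close>

lemma log_convex_power_le:
  fixes a :: "nat \<Rightarrow> real"
  assumes nn: "\<And>k. 0 \<le> a k" and lc: "\<And>k. (a (Suc k))\<^sup>2 \<le> a k * a (Suc (Suc k))"
  shows "a 1 ^ Suc k \<le> a 0 ^ k * a (Suc k)"
proof (induction k)
  case (Suc k)
  have step: "a 1 * a j \<le> a 0 * a (Suc j)" for j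
  proof (induction j)
    case (Suc j)
    show ?case
    proof (cases "a j = 0")
      case True
      then have "(a (Suc j))\<^sup>2 \<le> 0" using lc[of j] by simp
      then show ?thesis using nn by simp
    next
      case False
      then have p: "a j > 0" using nn[of j] by simp
      have "(a 1 * a (Suc j)) * a j = (a 1 * a j) * a (Suc j)" by simp
      also have "\<dots> \<le> (a 0 * a (Suc j)) * a (Suc j)" using Suc.IH nn by (intro mult_right_mono)
      also have "\<dots> = a 0 * (a (Suc j))\<^sup>2" by (simp add: power2_eq_square)
      also have "\<dots> \<le> a 0 * (a j * a (Suc (Suc j)))" using lc nn by (intro mult_left_mono)
      also have "\<dots> = (a 0 * a (Suc (Suc j))) * a j" by simp
      finally show ?thesis using p by simp
    qed
  qed simp
  have "a 1 ^ Suc (Suc k) = a 1 * a 1 ^ Suc k" by simp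
  also have "\<dots> \<le> a 1 * (a 0 ^ k * a (Suc k))" using Suc.IH nn by (intro mult_left_mono)
  also have "\<dots> = a 0 ^ k * (a 1 * a (Suc k))" by simp
  also have "\<dots> \<le> a 0 ^ k * (a 0 * a (Suc (Suc k)))" using step nn by (intro mult_left_mono) auto
  finally show ?case by (simp add: mult_ac)
qed simp

lemma sum_kronecker:
  fixes x :: "nat \<Rightarrow> real"
  assumes "a < N"
  shows "(\<Sum>b<N. (if a = b then 1 else 0) * x b) = x a" "(\<Sum>b<N. x b * (if b = a then 1 else 0)) = x a"
proof -
  have "(\<Sum>b<N. (if a = b then 1 else 0) * x b) = (\<Sum>b<N. if b = a then x b else 0)"
    "(\<Sum>b<N. x b * (if b = a then 1 else 0)) = (\<Sum>b<N. if b = a then x b else 0)"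
    by (intro sum.cong; simp)+
  then show "(\<Sum>b<N. (if a = b then 1 else 0) * x b) = x a" "(\<Sum>b<N. x b * (if b = a then 1 else 0)) = x a"
    using assms by simp_all
qed

section \<open>Powers of a symmetric matrix\<close>

locale symmetric_kernel =
  fixes N :: nat and h :: "nat \<Rightarrow> nat \<Rightarrow> real"
  assumes h_sym: "h a b = h b a"
begin

text \<open>Entries of matrix powers as iterated sums over indices, the form in which they unfold
  into sums over walks.\<close>

fun kpow :: "nat \<Rightarrow> nat \<Rightarrow> nat \<Rightarrow> real" where
  "kpow 0 a b = (if a = b then 1 else 0)"
| "kpow (Suc k) a b = (\<Sum>c<N. h a c * kpow k c b)"

fun app :: "nat \<Rightarrow> (nat \<Rightarrow> real) \<Rightarrow> nat \<Rightarrow> real" where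
  "app 0 x a = x a"
| "app (Suc k) x a = (\<Sum>c<N. h a c * app k x c)"

definition sqnorm :: "(nat \<Rightarrow> real) \<Rightarrow> real" where "sqnorm x = (\<Sum>a<N. (x a)\<^sup>2)"

lemma app_kpow: "a < N \<Longrightarrow> app k x a = (\<Sum>b<N. kpow k a b * x b)"
proof (induction k arbitrary: a)
  case (Suc k)
  have "app (Suc k) x a = (\<Sum>c<N. h a c * (\<Sum>b<N. kpow k c b * x b))"
    using Suc.IH by simp
  also have "\<dots> = (\<Sum>c<N. \<Sum>b<N. h a c * kpow k c b * x b)"
    by (simp add: sum_distrib_left mult.assoc)
  also have "\<dots> = (\<Sum>b<N. \<Sum>c<N. h a c * kpow k c b * x b)" by (rule sum.swap)
  also have "\<dots> = (\<Sum>b<N. kpow (Suc k) a b * x b)" by (simp add: sum_distrib_right)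
  finally show ?case .
qed (simp add: sum_kronecker)

lemma kpow_add: "a < N \<Longrightarrow> kpow (j + k) a b = (\<Sum>c<N. kpow j a c * kpow k c b)"
proof (induction j arbitrary: a)
  case (Suc j)
  have "kpow (Suc j + k) a b = (\<Sum>d<N. h a d * (\<Sum>c<N. kpow j d c * kpow k c b))"
    using Suc.IH by simp
  also have "\<dots> = (\<Sum>d<N. \<Sum>c<N. h a d * kpow j d c * kpow k c b)"
    by (simp add: sum_distrib_left mult.assoc)
  also have "\<dots> = (\<Sum>c<N. \<Sum>d<N. h a d * kpow j d c * kpow k c b)" by (rule sum.swap)
  also have "\<dots> = (\<Sum>c<N. kpow (Suc j) a c * kpow k c b)" by (simp add: sum_distrib_right)
  finally show ?case .
qed (simp add: sum_kronecker)

lemma kpow_sym: "a < N \<Longrightarrow> b < N \<Longrightarrow> kpow k a b = kpow k b a"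
proof (induction k arbitrary: a b)
  case (Suc k)
  have "kpow (Suc k) a b = (\<Sum>c<N. kpow k b c * h c a)"
    using Suc by (simp add: mult.commute h_sym[of a])
  also have "\<dots> = (\<Sum>c<N. kpow k b c * kpow 1 c a)"
    using Suc.prems by (intro sum.cong) (simp_all add: sum_kronecker)
  also have "\<dots> = kpow (k + 1) b a" using kpow_add[OF Suc.prems(2), of k 1] by simp
  finally show ?case by simp
qed auto

lemma app_sym:
  "(\<Sum>a<N. (\<Sum>c<N. h a c * x c) * y a) = (\<Sum>a<N. x a * (\<Sum>c<N. h a c * y c))"
proof -
  have "(\<Sum>a<N. (\<Sum>c<N. h a c * x c) * y a) = (\<Sum>a<N. \<Sum>c<N. h a c * x c * y a)"
    by (simp add: sum_distrib_right)
  also have "\<dots> = (\<Sum>c<N. \<Sum>a<N. h a c * x c * y a)" by (rule sum.swap)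
  also have "\<dots> = (\<Sum>c<N. x c * (\<Sum>a<N. h c a * y a))"
    by (simp add: sum_distrib_left mult_ac h_sym)
  finally show ?thesis .
qed

text \<open>Symmetry moves one factor across the inner product, so the squared norm at step
  \<open>Suc k\<close> is the inner product of the iterates \<open>k\<close> and
  \<open>Suc (Suc k)\<close>.\<close>

lemma sqnorm_app_log_convex:
  "(sqnorm (app (Suc k) x))\<^sup>2 \<le> sqnorm (app k x) * sqnorm (app (Suc (Suc k)) x)"
proof -
  have "sqnorm (app (Suc k) x) = (\<Sum>a<N. (\<Sum>c<N. h a c * app k x c) * app (Suc k) x a)"
    by (simp add: sqnorm_def power2_eq_square)
  also have "\<dots> = (\<Sum>a<N. app k x a * app (Suc (Suc k)) x a)"
    unfolding app_sym by simp
  finally show ?thesis unfolding sqnorm_def by (simp only: Cauchy_Schwarz_ineq_sum)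
qed

text \<open>The operator norm is below the Frobenius norm, and for a symmetric matrix the squared
  Frobenius norm of the \<open>k\<close>-th power is the trace of the power
  \<open>2 k\<close>.\<close>

lemma sqnorm_app_le_trace:
  "sqnorm (app k x) \<le> (\<Sum>a<N. kpow (k + k) a a) * sqnorm x"
proof -
  have "sqnorm (app k x) = (\<Sum>a<N. (\<Sum>b<N. kpow k a b * x b)\<^sup>2)"
    unfolding sqnorm_def by (intro sum.cong) (simp_all add: app_kpow)
  also have "\<dots> \<le> (\<Sum>a<N. (\<Sum>b<N. (kpow k a b)\<^sup>2) * (\<Sum>b<N. (x b)\<^sup>2))"
    by (intro sum_mono Cauchy_Schwarz_ineq_sum)
  also have "\<dots> = (\<Sum>a<N. (\<Sum>b<N. (kpow k a b)\<^sup>2)) * sqnorm x"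
    by (simp add: sum_distrib_right sqnorm_def)
  also have "(\<Sum>a<N. (\<Sum>b<N. (kpow k a b)\<^sup>2)) = (\<Sum>a<N. kpow (k + k) a a)"
    by (intro sum.cong refl) (simp add: kpow_add power2_eq_square kpow_sym)
  finally show ?thesis .
qed

text \<open>Converts a bound on the trace of a high even power into an operator norm bound without
  diagonalisation: log-convexity of the squared norms along the orbit of \<open>x\<close> carries
  the estimate for the \<open>p\<close>-th power down to the first.\<close>

lemma trace_moment_bound:
  assumes p: "p > 0" and tr: "(\<Sum>a<N. kpow (p + p) a a) \<le> T ^ (2 * p)" and T: "T \<ge> 0"
  shows "sqnorm (\<lambda>a. \<Sum>c<N. h a c * x c) \<le> T\<^sup>2 * sqnorm x"
proof -
  obtain k where k: "p = Suc k" using p by (cases p) auto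
  have nn: "0 \<le> sqnorm y" for y by (simp add: sqnorm_def sum_nonneg)
  let ?a = "\<lambda>k. sqnorm (app k x)"
  have "?a 1 ^ p \<le> ?a 0 ^ k * ?a p"
    unfolding k by (rule log_convex_power_le[of ?a]) (rule nn sqnorm_app_log_convex)+
  also have "?a p \<le> T ^ (2 * p) * sqnorm x"
    by (rule order_trans[OF sqnorm_app_le_trace mult_right_mono[OF tr nn]])
  then have "?a 0 ^ k * ?a p \<le> ?a 0 ^ k * (T ^ (2 * p) * sqnorm x)"
    using nn by (intro mult_left_mono) auto
  also have "\<dots> = (T\<^sup>2 * sqnorm x) ^ p"
  proof -
    have "app 0 x = x" by auto
    then show ?thesis unfolding k power_mult power_mult_distrib by (simp add: mult_ac)
  qed
  finally have "?a 1 ^ Suc k \<le> (T\<^sup>2 * sqnorm x) ^ Suc k" unfolding k .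
  then have "?a 1 \<le> T\<^sup>2 * sqnorm x"
    by (rule power_le_imp_le_base) (simp add: nn)
  then show ?thesis by (simp add: sqnorm_def)
qed

end

section \<open>The centred adjacency matrix\<close>

text \<open>Passes from vertices counted from 0 to the ordered pairs counted from 1 in
  \<open>edge_slots\<close>. A loop \<open>slot a a\<close> falls outside \<open>edge_slots\<close>,
  which is how loops are recognised.\<close>

definition slot :: "nat \<Rightarrow> nat \<Rightarrow> nat \<times> nat" where
  "slot a b = (Suc (min a b), Suc (max a b))"

lemma slot_sym: "slot a b = slot b a"
  by (simp add: slot_def min.commute max.commute)

fun edges :: "nat list \<Rightarrow> (nat \<times> nat) list" where
  "edges (a # b # xs) = slot a b # edges (b # xs)"
| "edges _ = []"

lemma length_edges: "length (edges xs) = length xs - 1"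
  by (induction xs rule: edges.induct) auto

lemma edges_fst_snd:
  "e \<in> set (edges xs) \<Longrightarrow> fst e \<in> Suc ` set xs \<and> snd e \<in> Suc ` set xs"
  by (induction xs rule: edges.induct) (auto simp: slot_def min_def max_def split: if_splits)

text \<open>A vertex visited for the first time is reached through a new edge.\<close>

lemma card_vertices_le: "xs \<noteq> [] \<Longrightarrow> card (set xs) \<le> Suc (card (set (edges xs)))"
proof (induction xs rule: edges.induct)
  case (1 a b xs)
  then have IH: "card (set (b # xs)) \<le> Suc (card (set (edges (b # xs))))" by simp
  show ?case
  proof (cases "a \<in> set (b # xs)")
    case True
    then have "set (a # b # xs) = set (b # xs)" by auto
    then have "card (set (a # b # xs)) \<le> Suc (card (set (edges (b # xs))))" using IH by simp
    also have "\<dots> \<le> Suc (card (set (edges (a # b # xs))))"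
      by (intro Suc_leI le_imp_less_Suc card_mono) auto
    finally show ?thesis .
  next
    case False
    have "slot a b \<notin> set (edges (b # xs))"
    proof
      assume "slot a b \<in> set (edges (b # xs))"
      from edges_fst_snd[OF this] have "a \<in> set (b # xs)"
        by (auto simp: slot_def min_def max_def split: if_splits)
      then show False using False by simp
    qed
    then have "card (set (edges (a # b # xs))) = Suc (card (set (edges (b # xs))))" by simp
    moreover have "card (set (a # b # xs)) = Suc (card (set (b # xs)))"
      using False by (simp only: list.set(2)[of a] card_insert_disjoint List.finite_set not_False_eq_True)
    ultimately show ?thesis using IH by simp
  qed
qed auto

lemma finite_edge_slots [simp]: "finite (edge_slots N)"
proof (rule finite_subset)
  show "edge_slots N \<subseteq> {..N} \<times> {..N}" by (auto simp: edge_slots_def)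
qed simp

lemma slot_in_edge_slots: "a < N \<Longrightarrow> b < N \<Longrightarrow> slot a b \<in> edge_slots N \<longleftrightarrow> a \<noteq> b"
  by (auto simp: slot_def edge_slots_def min_def max_def)

locale bernoulli_graph =
  fixes N :: nat and pr :: "nat \<times> nat \<Rightarrow> real" and \<rho> :: real
  assumes pr_nonneg: "\<And>e. e \<in> edge_slots N \<Longrightarrow> 0 \<le> pr e"
    and pr_le: "\<And>e. e \<in> edge_slots N \<Longrightarrow> pr e \<le> \<rho>"
    and rho: "0 \<le> \<rho>" "\<rho> \<le> 1"
begin

definition P :: "(nat \<times> nat \<Rightarrow> bool) pmf" where
  "P = Pi_pmf (edge_slots N) False (\<lambda>e. bernoulli_pmf (pr e))"

lemma finite_set_P: "finite (set_pmf P)"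
proof -
  have "finite (set_pmf (bernoulli_pmf (pr e)))" for e by (rule finite_subset[OF subset_UNIV]) simp
  then show ?thesis unfolding P_def by (subst set_Pi_pmf) (auto intro!: finite_PiE_dflt)
qed

lemma integrable_P [simp]: "integrable (measure_pmf P) (f :: _ \<Rightarrow> real)"
  by (rule integrable_measure_pmf_finite[OF finite_set_P])

definition cen :: "(nat \<times> nat \<Rightarrow> bool) \<Rightarrow> nat \<times> nat \<Rightarrow> real" where
  "cen E e = of_bool (E e) - pr e"

definition H :: "(nat \<times> nat \<Rightarrow> bool) \<Rightarrow> nat \<Rightarrow> nat \<Rightarrow> real" where
  "H E a b = (if a = b then 0 else cen E (slot a b))"

lemma H_sym: "H E a b = H E b a"
  by (simp add: H_def slot_sym)

sublocale kern: symmetric_kernel N "H E" for E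
  by unfold_locales (rule H_sym)

fun wt :: "(nat \<times> nat \<Rightarrow> bool) \<Rightarrow> nat list \<Rightarrow> real" where
  "wt E (a # b # xs) = H E a b * wt E (b # xs)"
| "wt E _ = 1"

lemma wt_loop:
  "set xs \<subseteq> {..<N} \<Longrightarrow> \<not> set (edges xs) \<subseteq> edge_slots N \<Longrightarrow> wt E xs = 0"
proof (induction xs rule: edges.induct)
  case (1 a b xs)
  then show ?case by (cases "a = b") (auto simp: H_def slot_in_edge_slots)
qed auto

text \<open>Regrouping the weight of a walk by edges with multiplicities turns it into a product of
  functions of independent coordinates, so that its expectation factorises.\<close>

lemma wt_prod:
  "set xs \<subseteq> {..<N} \<Longrightarrow> set (edges xs) \<subseteq> edge_slots N \<Longrightarrow>
    wt E xs = (\<Prod>e\<in>edge_slots N. cen E e ^ count_list (edges xs) e)"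
proof (induction xs rule: edges.induct)
  case (1 a b xs)
  let ?s = "slot a b"
  have s: "?s \<in> edge_slots N" using 1 by simp
  have ab: "a \<noteq> b" using s 1(2) slot_in_edge_slots[of a N b] by simp
  have "(\<Prod>e\<in>edge_slots N. cen E e ^ count_list (edges (a # b # xs)) e)
    = (\<Prod>e\<in>edge_slots N. (if e = ?s then cen E e else 1) * cen E e ^ count_list (edges (b # xs)) e)"
    by (intro prod.cong) auto
  also have "\<dots> = (\<Prod>e\<in>edge_slots N. if e = ?s then cen E e else 1) *
      (\<Prod>e\<in>edge_slots N. cen E e ^ count_list (edges (b # xs)) e)"
    by (rule prod.distrib)
  also have "(\<Prod>e\<in>edge_slots N. if e = ?s then cen E e else 1) = cen E ?s"
    using s by simp
  also have "(\<Prod>e\<in>edge_slots N. cen E e ^ count_list (edges (b # xs)) e) = wt E (b # xs)"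
    using 1 by simp
  finally show ?case using ab by (simp add: H_def)
qed auto

text \<open>Only walks using every edge at least twice contribute. Their \<open>2 k\<close> steps
  use at most \<open>k\<close> distinct edges, hence at most \<open>k + 1\<close> vertices. Each
  distinct edge gives a factor \<open>\<rho>\<close>, and there are at least as many edges as
  vertices minus one.\<close>

lemma expectation_wt_le:
  assumes xs: "set xs \<subseteq> {..<N}" "length xs = Suc (2 * k)"
  shows "\<bar>measure_pmf.expectation P (\<lambda>E. wt E xs)\<bar>
    \<le> (if card (set xs) \<le> Suc k then \<rho> ^ (card (set xs) - 1) else 0)"
proof (cases "set (edges xs) \<subseteq> edge_slots N")
  case False
  then show ?thesis using wt_loop[OF xs(1)] rho by simp
next
  case True
  let ?c = "count_list (edges xs)"
  have e: "measure_pmf.expectation P (\<lambda>E. wt E xs)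
    = (\<Prod>e\<in>edge_slots N. measure_pmf.expectation (bernoulli_pmf (pr e)) (\<lambda>b. (of_bool b - pr e) ^ ?c e))"
    unfolding wt_prod[OF xs(1) True] cen_def P_def
    by (rule expectation_prod_Pi_pmf_finite) (auto intro: finite_subset[OF subset_UNIV])
  have "\<bar>measure_pmf.expectation P (\<lambda>E. wt E xs)\<bar>
    \<le> (\<Prod>e\<in>edge_slots N. if ?c e = 0 then 1 else if ?c e = 1 then 0 else \<rho>)"
    unfolding e abs_prod
    using pr_nonneg pr_le rho by (intro prod_mono conjI bernoulli_centered_moment_le) auto
  also have "\<dots> \<le> (if card (set xs) \<le> Suc k then \<rho> ^ (card (set xs) - 1) else 0)"
  proof (cases "\<exists>e\<in>edge_slots N. ?c e = 1")
    case True
    then have z: "(\<Prod>e\<in>edge_slots N. if ?c e = 0 then 1 else if ?c e = 1 then 0 else \<rho>) = 0"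
      by (intro prod_zero) auto
    show ?thesis unfolding z using rho by simp
  next
    case False
    have ne: "xs \<noteq> []" using xs(2) by auto
    have "(\<Prod>e\<in>edge_slots N. if ?c e = 0 then 1 else if ?c e = 1 then 0 else \<rho>)
      = (\<Prod>e\<in>edge_slots N. if e \<in> set (edges xs) then \<rho> else 1)"
      using False by (intro prod.cong) (auto simp: count_list_0_iff)
    also have "\<dots> = (\<Prod>e\<in>set (edges xs). \<rho>)"
      using True by (subst prod.inter_restrict[symmetric]) (auto simp: Int_absorb1)
    also have "\<dots> = \<rho> ^ card (set (edges xs))" by simp
    also have "\<dots> \<le> \<rho> ^ (card (set xs) - 1)"
      using card_vertices_le[OF ne] rho by (intro power_decreasing) auto
    finally have le: "(\<Prod>e\<in>edge_slots N. if ?c e = 0 then 1 else if ?c e = 1 then 0 else \<rho>)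
      \<le> \<rho> ^ (card (set xs) - 1)" .
    have "2 * card (set (edges xs)) = (\<Sum>e\<in>set (edges xs). 2)" by simp
    also have "\<dots> \<le> (\<Sum>e\<in>set (edges xs). ?c e)"
    proof (intro sum_mono)
      fix e assume "e \<in> set (edges xs)"
      then have "?c e \<noteq> 0" "?c e \<noteq> 1" using False True by (auto simp: count_list_0_iff)
      then show "2 \<le> ?c e" by simp
    qed
    also have "\<dots> = length (edges xs)" by (rule sum_count_set) auto
    also have "\<dots> = 2 * k" using xs(2) by (simp add: length_edges)
    finally have "card (set xs) \<le> Suc k" using card_vertices_le[OF ne] by simp
    then show ?thesis using le by simp
  qed
  finally show ?thesis .
qed

abbreviation walks :: "nat \<Rightarrow> nat list set" where
  "walks n \<equiv> {xs. set xs \<subseteq> {..<N} \<and> length xs = n}"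

lemma finite_walks [simp]: "finite (walks n)"
  by (rule finite_lists_length_eq) simp

lemma sum_walks_Suc:
  fixes f :: "nat list \<Rightarrow> real"
  shows "(\<Sum>xs\<in>walks (Suc n). f xs) = (\<Sum>a<N. \<Sum>xs\<in>walks n. f (a # xs))"
proof -
  have "walks (Suc n) = (\<lambda>(a, xs). a # xs) ` ({..<N} \<times> walks n)"
    by (auto simp: length_Suc_conv image_iff)
  then have "(\<Sum>xs\<in>walks (Suc n). f xs) = (\<Sum>(a, xs)\<in>{..<N} \<times> walks n. f (a # xs))"
    by (simp add: sum.reindex inj_on_def case_prod_unfold)
  then show ?thesis by (simp add: sum.cartesian_product)
qed

lemma kpow_walks:
  "kern.kpow E k a b = (\<Sum>xs\<in>walks k. wt E (a # xs) * of_bool (last (a # xs) = b))"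
proof (induction k arbitrary: a)
  case 0
  have "walks 0 = {[]}" by auto
  then show ?case by simp
next
  case (Suc k)
  have "kern.kpow E (Suc k) a b = (\<Sum>c<N. H E a c * (\<Sum>xs\<in>walks k. wt E (c # xs) * of_bool (last (c # xs) = b)))"
    using Suc.IH by simp
  also have "\<dots> = (\<Sum>c<N. \<Sum>xs\<in>walks k. wt E (a # c # xs) * of_bool (last (a # c # xs) = b))"
    unfolding sum_distrib_left by (intro sum.cong refl) (simp add: mult.assoc)
  also have "\<dots> = (\<Sum>xs\<in>walks (Suc k). wt E (a # xs) * of_bool (last (a # xs) = b))"
    by (rule sum_walks_Suc[symmetric])
  finally show ?case .
qed

lemma trace_walks:
  "(\<Sum>a<N. kern.kpow E k a a) = (\<Sum>xs\<in>walks (Suc k). wt E xs * of_bool (last xs = hd xs))"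
  unfolding sum_walks_Suc kpow_walks by (intro sum.cong refl) simp

text \<open>There are at most \<open>N ^ v\<close> supports with \<open>v\<close> vertices and at
  most \<open>(k + 1) ^ (2 k + 1)\<close> walks on each. The sum over \<open>v\<close> gives the
  last factor \<open>k + 1\<close>. This crude count is affordable because \<open>k\<close> will be
  polylogarithmic in \<open>N\<close>.\<close>

lemma sum_walks_by_support:
  assumes d: "1 \<le> real N * \<rho>"
  shows "(\<Sum>xs\<in>walks (Suc (2 * k)). if card (set xs) \<le> Suc k then \<rho> ^ (card (set xs) - 1) else 0)
    \<le> real N * (real N * \<rho>) ^ k * real (Suc k) ^ (2 * k + 2)"
proof -
  let ?n = "Suc (2 * k)"
  let ?B = "{B. B \<subseteq> {..<N} \<and> card B \<in> {1..Suc k}}"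
  let ?F = "\<lambda>B. if card B \<le> Suc k then \<rho> ^ (card B - 1) else 0"
  have finB: "finite ?B" by (rule finite_subset[of _ "Pow {..<N}"]) auto
  have nn: "0 \<le> ?F B" for B using rho by simp
  have "(\<Sum>xs\<in>walks ?n. ?F (set xs)) = (\<Sum>xs\<in>{xs \<in> walks ?n. card (set xs) \<le> Suc k}. ?F (set xs))"
    by (rule sum.mono_neutral_right) auto
  also have "\<dots> = (\<Sum>B\<in>?B. \<Sum>xs\<in>{xs \<in> {xs \<in> walks ?n. card (set xs) \<le> Suc k}. set xs = B}. ?F (set xs))"
  proof (rule sum.group[symmetric])
    show "set ` {xs \<in> walks ?n. card (set xs) \<le> Suc k} \<subseteq> ?B"
    proof
      fix B assume "B \<in> set ` {xs \<in> walks ?n. card (set xs) \<le> Suc k}"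
      then obtain xs where xs: "B = set xs" "set xs \<subseteq> {..<N}" "length xs = ?n" "card (set xs) \<le> Suc k" by auto
      then have "set xs \<noteq> {}" by auto
      then have "1 \<le> card (set xs)" by (simp add: Suc_le_eq card_gt_0_iff)
      then show "B \<in> ?B" using xs by simp
    qed
    show "finite {xs \<in> walks ?n. card (set xs) \<le> Suc k}"
      by (rule finite_subset[OF _ finite_walks[of ?n]]) auto
  qed (rule finB)
  also have "\<dots> \<le> (\<Sum>B\<in>?B. real (Suc k) ^ ?n * \<rho> ^ (card B - 1))"
  proof (rule sum_mono)
    fix B assume B: "B \<in> ?B"
    then have fB: "finite B" by (auto intro: finite_subset)
    have "(\<Sum>xs\<in>{xs \<in> {xs \<in> walks ?n. card (set xs) \<le> Suc k}. set xs = B}. ?F (set xs))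
      = (\<Sum>xs\<in>{xs \<in> {xs \<in> walks ?n. card (set xs) \<le> Suc k}. set xs = B}. \<rho> ^ (card B - 1))"
      using B by (intro sum.cong) auto
    also have "\<dots> = real (card {xs \<in> {xs \<in> walks ?n. card (set xs) \<le> Suc k}. set xs = B}) * \<rho> ^ (card B - 1)"
      by simp
    also have "\<dots> \<le> real (Suc k ^ ?n) * \<rho> ^ (card B - 1)"
    proof (intro mult_right_mono of_nat_mono)
      have "card {xs \<in> {xs \<in> walks ?n. card (set xs) \<le> Suc k}. set xs = B} \<le> card {xs. set xs \<subseteq> B \<and> length xs = ?n}"
        by (rule card_mono[OF finite_lists_length_eq[OF fB]]) auto
      also have "\<dots> = card B ^ ?n" by (rule card_lists_length_eq[OF fB])
      also have "\<dots> \<le> Suc k ^ ?n" using B by (intro power_mono) auto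
      finally show "card {xs \<in> {xs \<in> walks ?n. card (set xs) \<le> Suc k}. set xs = B} \<le> Suc k ^ ?n" .
    qed (use rho in simp)
    finally show "(\<Sum>xs\<in>{xs \<in> {xs \<in> walks ?n. card (set xs) \<le> Suc k}. set xs = B}. ?F (set xs))
      \<le> real (Suc k) ^ ?n * \<rho> ^ (card B - 1)" unfolding of_nat_power .
  qed
  also have "\<dots> = real (Suc k) ^ ?n * (\<Sum>B\<in>?B. \<rho> ^ (card B - 1))"
    by (rule sum_distrib_left[symmetric])
  also have "(\<Sum>B\<in>?B. \<rho> ^ (card B - 1)) = (\<Sum>v\<in>{1..Suc k}. \<Sum>B\<in>{B \<in> ?B. card B = v}. \<rho> ^ (card B - 1))"
    by (rule sum.group[symmetric]) (use finB in auto)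
  also have "\<dots> \<le> (\<Sum>v\<in>{1..Suc k}. real N * (real N * \<rho>) ^ k)"
  proof (rule sum_mono)
    fix v assume v: "v \<in> {1..Suc k}"
    have setq: "{B \<in> ?B. card B = v} = {B. B \<subseteq> {..<N} \<and> card B = v}" using v by auto
    have cardq: "card {B. B \<subseteq> {..<N} \<and> card B = v} = N choose v" using n_subsets[of "{..<N}" v] by simp
    have "(\<Sum>B\<in>{B \<in> ?B. card B = v}. \<rho> ^ (card B - 1)) = real (N choose v) * \<rho> ^ (v - 1)"
      unfolding setq cardq[symmetric] by simp
    also have "real (N choose v) * \<rho> ^ (v - 1) \<le> real (N ^ v) * \<rho> ^ (v - 1)"
    proof (intro mult_right_mono of_nat_mono)
      show "N choose v \<le> N ^ v"
        by (cases "v \<le> N") (auto intro: binomial_le_pow simp: binomial_eq_0)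
    qed (use rho in simp)
    also have "\<dots> = real N * (real N * \<rho>) ^ (v - 1)"
      using v by (cases v) (auto simp: power_mult_distrib)
    also have "\<dots> \<le> real N * (real N * \<rho>) ^ k"
      using v d by (intro mult_left_mono power_increasing) auto
    finally show "(\<Sum>B\<in>{B \<in> ?B. card B = v}. \<rho> ^ (card B - 1)) \<le> real N * (real N * \<rho>) ^ k" .
  qed
  also have "\<dots> = real (Suc k) * (real N * (real N * \<rho>) ^ k)" by simp
  finally have "(\<Sum>xs\<in>walks ?n. ?F (set xs)) \<le> real (Suc k) ^ ?n * (real (Suc k) * (real N * (real N * \<rho>) ^ k))"
    by (simp only: mult_left_mono zero_le_power of_nat_0_le_iff)
  also have "\<dots> = real N * (real N * \<rho>) ^ k * real (Suc k) ^ (2 * k + 2)"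
    by (simp only: power_Suc mult_ac numeral_2_eq_2 add_Suc_right add_0_right)
  finally show ?thesis .
qed

lemma expectation_trace_le:
  assumes d: "1 \<le> real N * \<rho>"
  shows "measure_pmf.expectation P (\<lambda>E. \<Sum>a<N. kern.kpow E (k + k) a a)
    \<le> real N * (real N * \<rho>) ^ k * real (Suc k) ^ (2 * k + 2)"
proof -
  have kk: "Suc (k + k) = Suc (2 * k)" by simp
  have "measure_pmf.expectation P (\<lambda>E. \<Sum>a<N. kern.kpow E (k + k) a a)
    = (\<Sum>xs\<in>walks (Suc (2 * k)). measure_pmf.expectation P (\<lambda>E. wt E xs) * of_bool (last xs = hd xs))"
    unfolding trace_walks kk by simp
  also have "\<dots> \<le> (\<Sum>xs\<in>walks (Suc (2 * k)). if card (set xs) \<le> Suc k then \<rho> ^ (card (set xs) - 1) else 0)"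
  proof (rule sum_mono)
    fix xs assume "xs \<in> walks (Suc (2 * k))"
    then have "\<bar>measure_pmf.expectation P (\<lambda>E. wt E xs)\<bar>
      \<le> (if card (set xs) \<le> Suc k then \<rho> ^ (card (set xs) - 1) else 0)"
      by (intro expectation_wt_le) auto
    \<comment> \<open>The condition that the walk is closed is dropped; the bound is nonnegative, so
      this only enlarges it.\<close>
    then show "measure_pmf.expectation P (\<lambda>E. wt E xs) * of_bool (last xs = hd xs)
      \<le> (if card (set xs) \<le> Suc k then \<rho> ^ (card (set xs) - 1) else 0)"
      by (auto simp: abs_le_iff)
  qed
  also have "\<dots> \<le> real N * (real N * \<rho>) ^ k * real (Suc k) ^ (2 * k + 2)"
    by (rule sum_walks_by_support[OF d])
  finally show ?thesis .
qed

end

section \<open>Exponential moments and tails of row sums\<close>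

lemma exp_le_quadratic:
  fixes x :: real
  assumes "\<bar>x\<bar> \<le> 1"
  shows "exp x \<le> 1 + x + x\<^sup>2"
proof (cases "0 \<le> x")
  case True
  then show ?thesis using assms by (intro exp_bound) auto
next
  case False
  \<comment> \<open>For negative arguments the bound is the reciprocal of
    \<open>exp y >= 1 + y + y\<^sup>2 / 2\<close>, as the product of this polynomial with
    \<open>1 - y + y\<^sup>2\<close> is at least 1.\<close>
  define y where "y = - x"
  have y: "0 \<le> y" "x = - y" using False by (auto simp: y_def)
  have q: "0 < 1 + y + y\<^sup>2 / 2" using y(1) by (intro add_pos_nonneg) auto
  have "0 \<le> y\<^sup>2 / 2 + y ^ 3 / 2 + y ^ 4 / 2" using y(1) by simp
  moreover have "(1 - y + y\<^sup>2) * (1 + y + y\<^sup>2 / 2) = 1 + (y\<^sup>2 / 2 + y ^ 3 / 2 + y ^ 4 / 2)"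
    by (simp add: field_simps power2_eq_square power3_eq_cube power4_eq_xxxx)
  ultimately have "1 \<le> (1 - y + y\<^sup>2) * (1 + y + y\<^sup>2 / 2)" by simp
  then have "1 / (1 + y + y\<^sup>2 / 2) \<le> 1 - y + y\<^sup>2" using q by (simp add: divide_le_eq)
  moreover have "exp x \<le> 1 / (1 + y + y\<^sup>2 / 2)"
    using exp_lower_Taylor_quadratic[OF y(1)] q unfolding y(2) exp_minus
    by (simp add: inverse_eq_divide frac_le)
  ultimately show ?thesis using y(2) by simp
qed

text \<open>After the quadratic bound for the exponential, centring cancels the linear term and the
  variance \<open>q - q\<^sup>2 <= r\<close> remains.\<close>

lemma bernoulli_centered_mgf_le:
  fixes q r t :: real
  assumes q: "0 \<le> q" "q \<le> r" "r \<le> 1" and t: "\<bar>t\<bar> \<le> 1"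
  shows "measure_pmf.expectation (bernoulli_pmf q) (\<lambda>b. exp (t * (of_bool b - q))) \<le> exp (t\<^sup>2 * r)"
proof -
  have "measure_pmf.expectation (bernoulli_pmf q) (\<lambda>b. exp (t * (of_bool b - q)))
    = q * exp (t * (1 - q)) + (1 - q) * exp (t * (- q))"
    using q by (simp add: integral_bernoulli_pmf)
  also have "\<dots> \<le> q * (1 + t * (1 - q) + (t * (1 - q))\<^sup>2) + (1 - q) * (1 + t * (- q) + (t * (- q))\<^sup>2)"
  proof -
    have "\<bar>t * (1 - q)\<bar> \<le> 1" "\<bar>t * (- q)\<bar> \<le> 1"
      using mult_mono[of "\<bar>t\<bar>" 1 "\<bar>1 - q\<bar>" 1] mult_mono[of "\<bar>t\<bar>" 1 "\<bar>q\<bar>" 1] q t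
      by (auto simp: abs_mult)
    from this[THEN exp_le_quadratic] show ?thesis
      using q by (intro add_mono[OF mult_left_mono mult_left_mono]) auto
  qed
  also have "\<dots> = 1 + t\<^sup>2 * (q - q\<^sup>2)"
    by (simp add: algebra_simps power2_eq_square)
  also have "\<dots> \<le> 1 + t\<^sup>2 * r"
    using q by (intro add_left_mono mult_left_mono) (auto simp: power2_eq_square intro: order_trans[of _ q])
  also have "\<dots> \<le> exp (t\<^sup>2 * r)" by (rule exp_ge_add_one_self)
  finally show ?thesis .
qed

context bernoulli_graph
begin

definition rowsum :: "(nat \<times> nat \<Rightarrow> bool) \<Rightarrow> nat \<Rightarrow> real" where
  "rowsum E a = (\<Sum>b<N. H E a b)"

text \<open>The entries of one row sit in distinct slots. Writing the sum over all slots gives the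
  shape required by the product formula for expectations.\<close>

lemma rowsum_slots:
  assumes a: "a < N"
  shows "rowsum E a = (\<Sum>e\<in>edge_slots N. if e \<in> slot a ` ({..<N} - {a}) then cen E e else 0)"
proof -
  have inj: "inj_on (slot a) ({..<N} - {a})"
    by (auto simp: inj_on_def slot_def min_def max_def split: if_splits)
  have sub: "slot a ` ({..<N} - {a}) \<subseteq> edge_slots N"
    using slot_in_edge_slots[OF a] by auto
  have "rowsum E a = (\<Sum>b\<in>{..<N} - {a}. H E a b)"
    unfolding rowsum_def using a by (intro sum.mono_neutral_right) (auto simp: H_def)
  also have "\<dots> = (\<Sum>b\<in>{..<N} - {a}. cen E (slot a b))"
    by (intro sum.cong) (auto simp: H_def)
  also have "\<dots> = (\<Sum>e\<in>slot a ` ({..<N} - {a}). cen E e)"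
    by (simp add: sum.reindex[OF inj])
  also have "\<dots> = (\<Sum>e\<in>edge_slots N. if e \<in> slot a ` ({..<N} - {a}) then cen E e else 0)"
    using sub by (subst sum.inter_restrict[symmetric]) (auto simp: Int_absorb1)
  finally show ?thesis .
qed

lemma rowsum_mgf:
  assumes a: "a < N" and t: "\<bar>t\<bar> \<le> 1"
  shows "measure_pmf.expectation P (\<lambda>E. exp (t * rowsum E a)) \<le> exp (t\<^sup>2 * (real N * \<rho>))"
proof -
  let ?A = "slot a ` ({..<N} - {a})"
  let ?f = "\<lambda>e b. if e \<in> ?A then exp (t * (of_bool b - pr e)) else 1"
  have sub: "?A \<subseteq> edge_slots N"
    using slot_in_edge_slots[OF a] by auto
  have "exp (t * rowsum E a) = (\<Prod>e\<in>edge_slots N. ?f e (E e))" for E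
    unfolding rowsum_slots[OF a] sum_distrib_left
    by (subst exp_sum) (auto simp: cen_def intro!: prod.cong)
  then have "measure_pmf.expectation P (\<lambda>E. exp (t * rowsum E a))
    = (\<Prod>e\<in>edge_slots N. measure_pmf.expectation (bernoulli_pmf (pr e)) (?f e))"
    unfolding P_def by (simp only:) (rule expectation_prod_Pi_pmf_finite, auto intro: finite_subset[OF subset_UNIV])
  also have "\<dots> \<le> (\<Prod>e\<in>edge_slots N. if e \<in> ?A then exp (t\<^sup>2 * \<rho>) else 1)"
  proof (intro prod_mono conjI)
    fix e assume e: "e \<in> edge_slots N"
    show "0 \<le> measure_pmf.expectation (bernoulli_pmf (pr e)) (?f e)"
      by (intro Bochner_Integration.integral_nonneg) auto
    show "measure_pmf.expectation (bernoulli_pmf (pr e)) (?f e) \<le> (if e \<in> ?A then exp (t\<^sup>2 * \<rho>) else 1)"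
    proof (cases "e \<in> ?A")
      case True
      show ?thesis
        unfolding if_P[OF True] by (rule bernoulli_centered_mgf_le[OF pr_nonneg[OF e] pr_le[OF e] rho(2) t])
    qed simp
  qed
  also have "\<dots> = (\<Prod>e\<in>?A. exp (t\<^sup>2 * \<rho>))"
    using sub by (subst prod.inter_restrict[symmetric]) (auto simp: Int_absorb1)
  also have "\<dots> = exp (real (card ?A) * (t\<^sup>2 * \<rho>))" by (simp add: exp_of_nat_mult)
  also have "\<dots> \<le> exp (real N * (t\<^sup>2 * \<rho>))"
  proof -
    have "card ?A \<le> card ({..<N} - {a})" by (rule card_image_le) simp
    also have "\<dots> \<le> N" by (rule order_trans[OF card_mono[of "{..<N}"]]) auto
    finally show ?thesis using rho(1) by (simp add: mult_right_mono)
  qed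
  finally show ?thesis by (simp add: mult_ac)
qed

lemma Markov_P:
  assumes "\<And>E. 0 \<le> X E" "c > (0::real)"
  shows "measure_pmf.prob P {E. c \<le> X E} \<le> measure_pmf.expectation P X / c"
  using integral_Markov_inequality_measure[of "measure_pmf P" X "{}" c] assms by simp

lemma rowsum_tail:
  assumes a: "a < N" and d: "1 \<le> real N * \<rho>"
  shows "measure_pmf.prob P {E. s \<le> \<bar>rowsum E a\<bar>} \<le> 2 * exp (1 - s / sqrt (real N * \<rho>))"
proof -
  \<comment> \<open>With this parameter the exponential moment is at most \<open>exp 1\<close>. The
    resulting tail is exponential in \<open>s / sqrt (N * \<rho>)\<close>, which is a positive power
    of \<open>N\<close> in the application.\<close>
  define t where "t = 1 / sqrt (real N * \<rho>)"
  have sq: "sqrt (real N * \<rho>) \<ge> 1" using d by simp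
  have t: "0 < t" "t \<le> 1" "t\<^sup>2 * (real N * \<rho>) = 1"
    using sq d by (auto simp: t_def power_divide divide_le_eq intro: gr0I)
  have one: "measure_pmf.prob P {E. s \<le> v * rowsum E a} \<le> exp (1 - s / sqrt (real N * \<rho>))"
    if v: "v = 1 \<or> v = - 1" for v
  proof -
    have set: "{E. s \<le> v * rowsum E a} = {E. exp (t * s) \<le> exp ((t * v) * rowsum E a)}"
      unfolding exp_le_cancel_iff mult.assoc mult_le_cancel_left_pos[OF t(1)] ..
    have "measure_pmf.prob P {E. s \<le> v * rowsum E a}
      \<le> measure_pmf.expectation P (\<lambda>E. exp ((t * v) * rowsum E a)) / exp (t * s)"
      unfolding set by (rule Markov_P) auto
    also have "\<dots> \<le> exp ((t * v)\<^sup>2 * (real N * \<rho>)) / exp (t * s)"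
      using v t by (intro divide_right_mono rowsum_mgf a) (auto simp: abs_mult)
    also have "(t * v)\<^sup>2 * (real N * \<rho>) = 1" using v t(3) by auto
    also have "exp 1 / exp (t * s) = exp (1 - s / sqrt (real N * \<rho>))"
      by (simp add: exp_diff t_def)
    finally show ?thesis .
  qed
  have "{E. s \<le> \<bar>rowsum E a\<bar>} \<subseteq> {E. s \<le> 1 * rowsum E a} \<union> {E. s \<le> (- 1) * rowsum E a}"
    by (auto simp: abs_if split: if_splits)
  then have "measure_pmf.prob P {E. s \<le> \<bar>rowsum E a\<bar>}
    \<le> measure_pmf.prob P ({E. s \<le> 1 * rowsum E a} \<union> {E. s \<le> (- 1) * rowsum E a})"
    by (intro measure_pmf.finite_measure_mono) auto
  also have "\<dots> \<le> measure_pmf.prob P {E. s \<le> 1 * rowsum E a} + measure_pmf.prob P {E. s \<le> (- 1) * rowsum E a}"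
    by (rule measure_Un_le) simp_all
  finally show ?thesis using one[of 1] one[of "-1"] by simp
qed

text \<open>The only information about the graph used later: both parts of the noise in the
  Laplacian, the diagonal matrix of row sums and the centred adjacency matrix, have operator norm at
  most \<open>s\<close>.\<close>

definition good :: "real \<Rightarrow> (nat \<times> nat \<Rightarrow> bool) set" where
  "good s = {E. (\<forall>a<N. \<bar>rowsum E a\<bar> \<le> s) \<and>
    (\<forall>x. (\<Sum>a<N. (\<Sum>b<N. H E a b * x b)\<^sup>2) \<le> s\<^sup>2 * (\<Sum>a<N. (x a)\<^sup>2))}"

lemma prob_good:
  assumes d: "1 \<le> real N * \<rho>" and k: "k > 0" and s: "s > 0"
  shows "measure_pmf.prob P (good s)
    \<ge> 1 - (real N * (2 * exp (1 - s / sqrt (real N * \<rho>)))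
        + real N * (real N * \<rho>) ^ k * real (Suc k) ^ (2 * k + 2) / s ^ (2 * k))"
proof -
  let ?tr = "\<lambda>E. \<Sum>a<N. kern.kpow E (k + k) a a"
  let ?bad1 = "\<Union>a<N. {E. s \<le> \<bar>rowsum E a\<bar>}"
  let ?bad2 = "{E. s ^ (2 * k) \<le> ?tr E}"
  \<comment> \<open>The trace of an even power is a sum of squares; Markov's inequality needs its
    nonnegativity.\<close>
  have trnn: "0 \<le> ?tr E" for E
  proof (intro sum_nonneg)
    fix a assume "a \<in> {..<N}"
    then have a: "a < N" by simp
    have "kern.kpow E (k + k) a a = (\<Sum>c<N. kern.kpow E k a c * kern.kpow E k a c)"
      unfolding kern.kpow_add[OF a] using a by (intro sum.cong refl) (simp add: kern.kpow_sym[of a])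
    then show "0 \<le> kern.kpow E (k + k) a a" by (simp add: sum_nonneg)
  qed
  have sub: "UNIV - good s \<subseteq> ?bad1 \<union> ?bad2"
  proof
    fix E assume E: "E \<in> UNIV - good s"
    show "E \<in> ?bad1 \<union> ?bad2"
    proof (rule ccontr)
      assume n: "E \<notin> ?bad1 \<union> ?bad2"
      then have "?tr E \<le> s ^ (2 * k)" by simp
      from kern.trace_moment_bound[OF k this]
      have "kern.sqnorm (\<lambda>a. \<Sum>b<N. H E a b * x b) \<le> s\<^sup>2 * kern.sqnorm x" for x
        using s by simp
      moreover have "\<bar>rowsum E a\<bar> \<le> s" if "a < N" for a using n that by fastforce
      ultimately have "E \<in> good s" by (simp add: good_def kern.sqnorm_def)
      then show False using E by simp
    qed
  qed
  have b1: "measure_pmf.prob P ?bad1 \<le> real N * (2 * exp (1 - s / sqrt (real N * \<rho>)))"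
  proof -
    have "measure_pmf.prob P ?bad1 \<le> (\<Sum>a<N. measure_pmf.prob P {E. s \<le> \<bar>rowsum E a\<bar>})"
      by (rule measure_UNION_le) simp_all
    also have "\<dots> \<le> (\<Sum>a<N. 2 * exp (1 - s / sqrt (real N * \<rho>)))"
      by (rule sum_mono, rule rowsum_tail[OF _ d]) simp
    finally show ?thesis by simp
  qed
  have b2: "measure_pmf.prob P ?bad2 \<le> real N * (real N * \<rho>) ^ k * real (Suc k) ^ (2 * k + 2) / s ^ (2 * k)"
    using s by (intro order_trans[OF Markov_P[OF trnn]] divide_right_mono expectation_trace_le d) auto
  have "measure_pmf.prob P (UNIV - good s) \<le> measure_pmf.prob P (?bad1 \<union> ?bad2)"
    using sub by (intro measure_pmf.finite_measure_mono) auto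
  also have "\<dots> \<le> measure_pmf.prob P ?bad1 + measure_pmf.prob P ?bad2"
    by (rule measure_Un_le) simp_all
  finally have "measure_pmf.prob P (UNIV - good s) \<le> measure_pmf.prob P ?bad1 + measure_pmf.prob P ?bad2" .
  moreover have "measure_pmf.prob P (UNIV - good s) = 1 - measure_pmf.prob P (good s)"
    using measure_pmf.prob_compl[of "good s" P] by simp
  ultimately show ?thesis using b1 b2 by linarith
qed

end

section \<open>Symmetric matrices with zero row sums\<close>

locale laplacian_matrix =
  fixes N :: nat and L :: "nat \<Rightarrow> nat \<Rightarrow> real"
  assumes N_pos: "N > 0"
    and L_sym: "\<And>a b. a < N \<Longrightarrow> b < N \<Longrightarrow> L a b = L b a"
    and L_row: "\<And>a. a < N \<Longrightarrow> (\<Sum>b<N. L a b) = 0"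
begin

definition A :: "real mat" where "A = mat N N (\<lambda>(a, b). L a b)"

definition Lop :: "(nat \<Rightarrow> real) \<Rightarrow> nat \<Rightarrow> real" where "Lop x a = (\<Sum>b<N. L a b * x b)"

definition dot :: "(nat \<Rightarrow> real) \<Rightarrow> (nat \<Rightarrow> real) \<Rightarrow> real" where "dot x y = (\<Sum>a<N. x a * y a)"

lemma A_carrier [simp]: "A \<in> carrier_mat N N"
  by (simp add: A_def)

lemma Lop_sym: "dot (Lop x) y = dot x (Lop y)"
proof -
  have "dot (Lop x) y = (\<Sum>a<N. \<Sum>b<N. L a b * x b * y a)"
    by (simp add: dot_def Lop_def sum_distrib_right)
  also have "\<dots> = (\<Sum>b<N. \<Sum>a<N. L a b * x b * y a)" by (rule sum.swap)
  also have "\<dots> = (\<Sum>b<N. \<Sum>a<N. x b * (L b a * y a))"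
    by (intro sum.cong refl) (simp add: L_sym mult_ac)
  finally show ?thesis by (simp add: dot_def Lop_def sum_distrib_left)
qed

lemma Lop_lincomb: "Lop (\<lambda>a. x a + t * y a) a = Lop x a + t * Lop y a"
  by (simp add: Lop_def sum.distrib sum_distrib_left algebra_simps)

lemma Lop_const: "a < N \<Longrightarrow> Lop (\<lambda>_. c) a = 0"
  using L_row[of a] by (simp add: Lop_def sum_distrib_right[symmetric])

lemma Lop_shift: "a < N \<Longrightarrow> Lop (\<lambda>a. x a - c) a = Lop x a"
  using Lop_lincomb[of x "- 1" "\<lambda>_. c" a] Lop_const[of a c] by simp

lemma sum_Lop: "(\<Sum>a<N. Lop x a) = 0"
proof -
  have "(\<Sum>a<N. Lop x a) = dot (Lop x) (\<lambda>_. 1)" by (simp add: dot_def)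
  also have "\<dots> = dot x (Lop (\<lambda>_. 1))" by (rule Lop_sym)
  also have "\<dots> = 0" by (simp add: dot_def Lop_const)
  finally show ?thesis .
qed

lemma dot_self_nonneg: "0 \<le> dot x x"
  by (simp add: dot_def sum_nonneg)

lemma dot_self_zero: "dot x x = 0 \<longleftrightarrow> (\<forall>a<N. x a = 0)"
  by (auto simp: dot_def sum_nonneg_eq_0_iff)

lemma A_mult_vec: "v \<in> carrier_vec N \<Longrightarrow> a < N \<Longrightarrow> (A *\<^sub>v v) $ a = Lop (\<lambda>b. v $ b) a"
  by (simp add: A_def Lop_def scalar_prod_def lessThan_atLeast0)

lemma eigenvectorD:
  assumes "eigenvector A v l"
  shows "v \<in> carrier_vec N" "a < N \<Longrightarrow> Lop (\<lambda>b. v $ b) a = l * v $ a" "dot (\<lambda>b. v $ b) (\<lambda>b. v $ b) > 0"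
proof -
  have d: "dim_row A = N" by (simp add: A_def)
  show v: "v \<in> carrier_vec N" using assms by (simp add: eigenvector_def d)
  have ev: "A *\<^sub>v v = l \<cdot>\<^sub>v v" and nz: "v \<noteq> 0\<^sub>v N" using assms by (simp_all add: eigenvector_def d)
  show "Lop (\<lambda>b. v $ b) a = l * v $ a" if "a < N"
    using A_mult_vec[OF v that] ev that v by simp
  have "dot (\<lambda>b. v $ b) (\<lambda>b. v $ b) \<noteq> 0"
  proof
    assume "dot (\<lambda>b. v $ b) (\<lambda>b. v $ b) = 0"
    then have "v = 0\<^sub>v N" using v by (intro eq_vecI) (auto simp: dot_self_zero)
    then show False using nz by simp
  qed
  then show "dot (\<lambda>b. v $ b) (\<lambda>b. v $ b) > 0" using dot_self_nonneg[of "\<lambda>b. v $ b"] by simp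
qed

lemma eigenvalueI:
  assumes "\<And>a. a < N \<Longrightarrow> Lop x a = l * x a" "a0 < N" "x a0 \<noteq> 0"
  shows "eigenvalue A l"
proof -
  have d: "dim_row A = N" by (simp add: A_def)
  have nz: "vec N x \<noteq> 0\<^sub>v N"
  proof
    assume "vec N x = 0\<^sub>v N"
    then have "vec N x $ a0 = 0\<^sub>v N $ a0" by simp
    then show False using assms(2,3) by simp
  qed
  have "A *\<^sub>v vec N x = l \<cdot>\<^sub>v vec N x"
  proof (rule eq_vecI)
    fix a assume "a < dim_vec (l \<cdot>\<^sub>v vec N x)"
    then have a: "a < N" by simp
    have "Lop (\<lambda>b. vec N x $ b) a = Lop x a" unfolding Lop_def by (intro sum.cong) auto
    then show "(A *\<^sub>v vec N x) $ a = (l \<cdot>\<^sub>v vec N x) $ a"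
      using A_mult_vec[of "vec N x" a] assms(1)[OF a] a by simp
  qed (simp add: d)
  then have "eigenvector A (vec N x) l" using nz by (simp add: eigenvector_def d)
  then show ?thesis by (auto simp: eigenvalue_def)
qed

lemma root_iff_eigenvalue: "poly (char_poly A) m = 0 \<longleftrightarrow> eigenvalue A m"
  using eigenvalue_root_char_poly[OF A_carrier] by simp

lemma char_poly_nonzero: "char_poly A \<noteq> 0"
  using degree_monic_char_poly[OF A_carrier] by auto

text \<open>By symmetry the column sums vanish as well, so every vector in the range of
  \<open>Lop\<close> has sum zero.\<close>

lemma eigenvector_mean_zero:
  assumes "eigenvector A v l" "l \<noteq> 0"
  shows "(\<Sum>a<N. v $ a) = 0"
proof -
  have "0 = (\<Sum>a<N. l * v $ a)"
    using sum_Lop[of "\<lambda>b. v $ b"] eigenvectorD(2)[OF assms(1)] by simp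
  then show ?thesis using assms(2) by (simp flip: sum_distrib_left)
qed

text \<open>Conjugating with the unipotent matrix whose first column is constant makes the first column
  of \<open>A\<close> vanish, which splits off the root \<open>0\<close>.\<close>

lemma zero_root_simple:
  assumes ker: "\<And>x a. (\<And>a. a < N \<Longrightarrow> Lop x a = 0) \<Longrightarrow> a < N \<Longrightarrow> x a = x 0"
  shows "order 0 (char_poly A) \<le> 1"
proof -
  \<comment> \<open>The identity with its first column replaced by ones; \<open>Q\<close> has -1
    below the diagonal entry of that column and is its inverse.\<close>
  define P where "P = mat N N (\<lambda>(i, k). (if k = i then 1 else 0) + (if k = 0 then (if i = 0 then 0 else 1) else (0::real)))"
  define Q where "Q = mat N N (\<lambda>(i, k). (if k = i then 1 else 0) - (if k = 0 then (if i = 0 then 0 else 1) else (0::real)))"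
  have PQ [simp]: "P \<in> carrier_mat N N" "Q \<in> carrier_mat N N" by (simp_all add: P_def Q_def)
  have ent: "(X * Y) $$ (i, j) = (\<Sum>k<N. X $$ (i, k) * Y $$ (k, j))"
    if "X \<in> carrier_mat N N" "Y \<in> carrier_mat N N" "i < N" "j < N" for X Y :: "real mat" and i j
    using that by (simp add: times_mat_def scalar_prod_def lessThan_atLeast0)
  have Pl: "(\<Sum>k<N. P $$ (i, k) * f k) = f i + (if i = 0 then 0 else f 0)" if "i < N" for f i
    using that N_pos by (simp add: P_def distrib_right sum.distrib if_distrib[of "\<lambda>z. z * _"] cong: if_cong)
  have Ql: "(\<Sum>k<N. Q $$ (i, k) * f k) = f i - (if i = 0 then 0 else f 0)" if "i < N" for f i
    using that N_pos by (simp add: Q_def left_diff_distrib sum_subtractf if_distrib[of "\<lambda>z. z * _"] cong: if_cong)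
  have Pr: "(\<Sum>k<N. f k * P $$ (k, j)) = (if j = 0 then (\<Sum>k<N. f k) else f j)" if "j < N" for f j
  proof (cases "j = 0")
    case True
    have "(\<Sum>k<N. f k * P $$ (k, j)) = (\<Sum>k<N. f k)"
      using True N_pos by (intro sum.cong) (auto simp: P_def)
    then show ?thesis using True by simp
  next
    case False
    have "(\<Sum>k<N. f k * P $$ (k, j)) = (\<Sum>k<N. if k = j then f k else 0)"
      using False that by (intro sum.cong) (auto simp: P_def)
    then show ?thesis using False that by simp
  qed
  have inv1: "P * Q = 1\<^sub>m N"
  proof (rule eq_matI)
    fix i j assume "i < dim_row (1\<^sub>m N)" "j < dim_col (1\<^sub>m N)"
    then have "i < N" "j < N" by auto
    then show "(P * Q) $$ (i, j) = 1\<^sub>m N $$ (i, j)"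
      using N_pos by (subst ent) (auto simp: Pl Q_def)
  qed (simp_all add: P_def Q_def)
  have inv2: "Q * P = 1\<^sub>m N"
  proof (rule eq_matI)
    fix i j assume "i < dim_row (1\<^sub>m N)" "j < dim_col (1\<^sub>m N)"
    then have "i < N" "j < N" by auto
    then show "(Q * P) $$ (i, j) = 1\<^sub>m N $$ (i, j)"
      using N_pos by (subst ent) (auto simp: Ql P_def)
  qed (simp_all add: P_def Q_def)
  define B where "B = Q * (A * P)"
  have AP_carrier: "A * P \<in> carrier_mat N N" by (rule mult_carrier_mat[OF A_carrier PQ(1)])
  have B [simp]: "B \<in> carrier_mat N N" unfolding B_def by (rule mult_carrier_mat[OF PQ(2) AP_carrier])
  have PB: "P * B = A * P"
    unfolding B_def assoc_mult_mat[OF PQ(1) PQ(2) AP_carrier, symmetric] inv1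
    by (rule left_mult_one_mat[OF AP_carrier])
  have "A = P * B * Q"
    unfolding PB assoc_mult_mat[OF A_carrier PQ(1) PQ(2)] inv1 by (rule right_mult_one_mat[OF A_carrier, symmetric])
  moreover have "{A, B, P, Q} \<subseteq> carrier_mat N N" by simp
  ultimately have "similar_mat A B"
    using inv1 inv2 by (intro similar_matI[where P = P and Q = Q and n = N])
  then have cp: "char_poly A = char_poly B" by (rule char_poly_similar)
  have AP: "(A * P) $$ (k, j) = (if j = 0 then 0 else L k j)" if "k < N" "j < N" for k j
    using that L_row[OF that(1)] by (subst ent) (auto simp: Pr A_def)
  have Bent: "B $$ (i, j) = (if j = 0 then 0 else L i j - (if i = 0 then 0 else L 0 j))" if "i < N" "j < N" for i j
    unfolding B_def ent[OF PQ(2) AP_carrier that] Ql[OF that(1)] using that N_pos by (simp add: AP)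
  let ?D = "mat_delete B 0 0"
  have D [simp]: "?D \<in> carrier_mat (N - 1) (N - 1)" by (rule mat_delete_carrier[OF B])
  have Dent: "?D $$ (i, j) = L (Suc i) (Suc j) - L 0 (Suc j)" if "i < N - 1" "j < N - 1" for i j
    using that carrier_matD[OF B] Bent[of "Suc i" "Suc j"] by (simp add: mat_delete_def)
  have cB: "char_poly B = monom 1 1 * char_poly ?D"
    by (rule char_poly_0_column[OF _ B N_pos]) (simp add: Bent N_pos)
  have "poly (char_poly ?D) 0 \<noteq> 0"
  proof
    assume "poly (char_poly ?D) 0 = 0"
    then obtain z where z: "z \<in> carrier_vec (N - 1)" "z \<noteq> 0\<^sub>v (N - 1)" "?D *\<^sub>v z = 0 \<cdot>\<^sub>v z"
      using eigenvalue_root_char_poly[OF D] unfolding eigenvalue_def eigenvector_def carrier_matD(1)[OF D] by blast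
    \<comment> \<open>A null vector of the minor, extended by 0 at index 0, has a constant image
      under \<open>Lop\<close>. Images have sum zero, so the image vanishes, \<open>x\<close> is
      constant by \<open>ker\<close>, and its value at index 0 makes it zero.\<close>
    define x where "x a = (if a = 0 then 0 else z $ (a - 1))" for a
    have Lx: "Lop x a = (\<Sum>j<N - 1. L a (Suc j) * z $ j)" for a
    proof -
      have "{..<N} = {..<Suc (N - 1)}" using N_pos by simp
      then have "Lop x a = (\<Sum>j<Suc (N - 1). L a j * x j)" unfolding Lop_def by (simp only:)
      then show ?thesis unfolding sum.lessThan_Suc_shift by (simp add: x_def)
    qed
    have s: "Lop x a = Lop x 0" if "a < N" for a
    proof (cases a)
      case (Suc i)
      then have i: "i < N - 1" using \<open>a < N\<close> by simp
      have "(?D *\<^sub>v z) $ i = (\<Sum>j<N - 1. ?D $$ (i, j) * z $ j)"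
        using i carrier_matD[OF D] carrier_vecD[OF z(1)] by (simp add: scalar_prod_def lessThan_atLeast0)
      also have "\<dots> = (\<Sum>j<N - 1. L (Suc i) (Suc j) * z $ j - L 0 (Suc j) * z $ j)"
        using i by (intro sum.cong refl) (simp add: Dent left_diff_distrib)
      also have "\<dots> = Lop x a - Lop x 0" by (simp add: Lx Suc sum_subtractf)
      finally have "(?D *\<^sub>v z) $ i = Lop x a - Lop x 0" .
      moreover have "(?D *\<^sub>v z) $ i = 0" unfolding z(3) using i carrier_vecD[OF z(1)] by simp
      ultimately show ?thesis by linarith
    qed simp
    have "(\<Sum>a<N. Lop x a) = (\<Sum>a<N. Lop x 0)" by (rule sum.cong[OF refl]) (use s in blast)
    then have "0 = real N * Lop x 0" using sum_Lop[of x] by simp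
    then have "Lop x 0 = 0" using N_pos by simp
    then have "Lop x a = 0" if "a < N" for a using s[OF that] by simp
    then have xa: "x a = x 0" if "a < N" for a using that by (rule ker)
    have "z $ j = 0" if "j < N - 1" for j using xa[of "Suc j"] that by (simp add: x_def)
    then have "z = 0\<^sub>v (N - 1)" using z(1) by (intro eq_vecI) auto
    then show False using z(2) by simp
  qed
  then have "order 0 (char_poly ?D) = 0" by (simp add: order_root)
  moreover have "monom 1 1 * char_poly ?D \<noteq> 0"
    using char_poly_nonzero cp cB by simp
  ultimately have "order 0 (char_poly A) = order 0 (monom 1 1 :: real poly)"
    unfolding cp cB by (simp add: order_mult)
  also have "\<dots> \<le> degree (monom 1 1 :: real poly)" by (rule order_degree) simp
  also have "\<dots> \<le> 1" by (rule degree_monom_le)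
  finally show ?thesis .
qed

text \<open>Courant-Fischer on vectors of mean zero: the unit sphere is compact, so the form attains
  its minimum, and the minimiser is an eigenvector. The vector \<open>x0\<close> guarantees that
  this sphere is nonempty.\<close>

lemma minimizer_eigenvalue:
  assumes \<kappa>: "\<And>x. (\<Sum>a<N. x a) = 0 \<Longrightarrow> \<kappa> * dot x x \<le> dot (Lop x) x"
    and x0: "(\<Sum>a<N. x0 a) = 0" "dot x0 x0 > 0"
  obtains \<nu> where "eigenvalue A \<nu>" "\<kappa> \<le> \<nu>"
    "\<And>x. (\<Sum>a<N. x a) = 0 \<Longrightarrow> \<nu> * dot x x \<le> dot (Lop x) x"
proof -
  let ?S = "{x. (\<Sum>a<N. x a) = 0 \<and> dot x x = 1}"
  define \<nu> where "\<nu> = (INF x\<in>?S. dot (Lop x) x)"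
  have bdd: "bdd_below ((\<lambda>x. dot (Lop x) x) ` ?S)"
  proof (rule bdd_belowI2)
    fix x assume "x \<in> ?S"
    then show "\<kappa> \<le> dot (Lop x) x" using \<kappa>[of x] by simp
  qed
  have scale: "\<exists>k>0. (\<lambda>a. k * x a) \<in> ?S \<and> k * k * dot x x = 1 \<and>
      dot (Lop (\<lambda>a. k * x a)) (\<lambda>a. k * x a) = k * k * dot (Lop x) x"
    if x: "(\<Sum>a<N. x a) = 0" "dot x x > 0" for x
  proof -
    define k where "k = 1 / sqrt (dot x x)"
    have k: "k > 0" "k * k * dot x x = 1" using x(2) by (simp_all add: k_def)
    have "dot (\<lambda>a. k * x a) (\<lambda>a. k * x a) = k * k * dot x x"
      by (simp add: dot_def sum_distrib_left mult_ac)
    moreover have "Lop (\<lambda>a. k * x a) a = k * Lop x a" for a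
      by (simp add: Lop_def sum_distrib_left mult_ac)
    then have "dot (Lop (\<lambda>a. k * x a)) (\<lambda>a. k * x a) = k * k * dot (Lop x) x"
      by (simp add: dot_def sum_distrib_left mult_ac)
    moreover have "(\<Sum>a<N. k * x a) = 0" using x(1) by (simp flip: sum_distrib_left)
    ultimately show ?thesis using k by auto
  qed
  have ne: "?S \<noteq> {}" using scale[OF x0] by blast
  have lower: "\<nu> * dot x x \<le> dot (Lop x) x" if x: "(\<Sum>a<N. x a) = 0" for x
  proof (cases "dot x x = 0")
    case True
    then have "dot (Lop x) x = 0" by (simp add: dot_self_zero) (simp add: dot_def)
    then show ?thesis using True by simp
  next
    case False
    then have "dot x x > 0" using dot_self_nonneg[of x] by simp
    from scale[OF x this] obtain k where k: "k > 0" "(\<lambda>a. k * x a) \<in> ?S" "k * k * dot x x = 1"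
      "dot (Lop (\<lambda>a. k * x a)) (\<lambda>a. k * x a) = k * k * dot (Lop x) x" by blast
    have "\<nu> \<le> k * k * dot (Lop x) x"
      unfolding \<nu>_def k(4)[symmetric] by (rule cINF_lower[OF bdd k(2)])
    then have "(k * k) * (\<nu> * dot x x) \<le> (k * k) * dot (Lop x) x"
      using k(3) by (simp add: mult.left_commute[of "k * k"])
    then show ?thesis using k(1) by simp
  qed
  have ex: "\<exists>x. x \<in> ?S \<and> dot (Lop x) x < \<nu> + 1 / real (Suc n)" for n
  proof -
    have "\<nu> < \<nu> + 1 / real (Suc n)" by simp
    then show ?thesis
      using cINF_less_iff[OF ne bdd, of "\<nu> + 1 / real (Suc n)"] unfolding \<nu>_def[symmetric] by blast
  qed
  define f where "f n = (SOME x. x \<in> ?S \<and> dot (Lop x) x < \<nu> + 1 / real (Suc n))" for n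
  have f: "f n \<in> ?S" "dot (Lop (f n)) (f n) < \<nu> + 1 / real (Suc n)" for n
    using someI_ex[OF ex[of n]] unfolding f_def by blast+
  have bounded: "bounded ((\<lambda>x. x k) ` range f)" if k: "k \<in> {..<N}" for k
  proof -
    have "\<bar>f n k\<bar> \<le> 1" for n
    proof -
      have "f n k * f n k \<le> (\<Sum>a<N. f n a * f n a)"
        using k by (intro member_le_sum) auto
      also have "\<dots> = 1" using f(1)[of n] by (simp add: dot_def)
      finally show ?thesis by (simp add: abs_square_le_1 power2_eq_square[symmetric])
    qed
    then show ?thesis by (auto simp: bounded_iff)
  qed
  have "\<forall>d\<subseteq>{..<N}. \<exists>l. \<exists>r::nat\<Rightarrow>nat. strict_mono r \<and>
      (\<forall>e>0. eventually (\<lambda>n. \<forall>i\<in>d. dist (f (r n) i) (l i) < e) sequentially)"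
    by (rule compact_lemma_general[where proj = "\<lambda>x k. x k" and unproj = "\<lambda>x. x"])
       (use bounded in auto)
  then obtain u and r :: "nat \<Rightarrow> nat" where r: "strict_mono r"
    "\<And>e. e > 0 \<Longrightarrow> eventually (\<lambda>n. \<forall>i\<in>{..<N}. dist (f (r n) i) (u i) < e) sequentially"
    by blast
  have lim: "(\<lambda>n. f (r n) i) \<longlonglongrightarrow> u i" if "i < N" for i
    unfolding tendsto_iff
  proof (intro allI impI)
    fix e :: real assume "e > 0"
    from r(2)[OF this] show "\<forall>\<^sub>F n in sequentially. dist (f (r n) i) (u i) < e"
      by eventually_elim (use that in auto)
  qed
  have "(\<lambda>n. \<Sum>a<N. f (r n) a) \<longlonglongrightarrow> (\<Sum>a<N. u a)"
    using lim by (intro tendsto_sum) auto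
  then have u0: "(\<Sum>a<N. u a) = 0" using f(1) by (simp add: LIMSEQ_const_iff)
  have "(\<lambda>n. dot (f (r n)) (f (r n))) \<longlonglongrightarrow> dot u u"
    unfolding dot_def using lim by (intro tendsto_sum tendsto_mult) auto
  then have u1: "dot u u = 1" using f(1) by (simp add: LIMSEQ_const_iff)
  have "(\<lambda>n. dot (Lop (f (r n))) (f (r n))) \<longlonglongrightarrow> dot (Lop u) u"
    unfolding dot_def Lop_def using lim by (intro tendsto_sum tendsto_mult tendsto_const) auto
  moreover have "(\<lambda>n. \<nu> + 1 / real (Suc (r n))) \<longlonglongrightarrow> \<nu>"
    using LIMSEQ_subseq_LIMSEQ[OF LIMSEQ_inverse_real_of_nat_add[of \<nu>] r(1)]
    by (simp add: o_def inverse_eq_divide)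
  ultimately have "dot (Lop u) u \<le> \<nu>"
    using f(2) by (intro LIMSEQ_le[of _ "dot (Lop u) u" _ \<nu>]) (auto intro: less_imp_le)
  then have form0: "dot (Lop u) u - \<nu> * dot u u \<le> 0" using u1 by simp
  define g where "g a = Lop u a - \<nu> * u a" for a
  have g0: "(\<Sum>a<N. g a) = 0"
    using sum_Lop[of u] u0 by (simp add: g_def sum_subtractf flip: sum_distrib_left)
  have bil: "dot (\<lambda>a. x a + t * y a) z = dot x z + t * dot y z" "dot z (\<lambda>a. x a + t * y a) = dot z x + t * dot z y" for x y z t
    by (simp_all add: dot_def sum.distrib sum_distrib_left algebra_simps)
  have dcomm: "dot x y = dot y x" for x y by (simp add: dot_def mult.commute)
  let ?B = "\<lambda>x y. dot (Lop x) y - \<nu> * dot x y"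
  \<comment> \<open>Cauchy-Schwarz for the nonnegative form \<open>?B\<close>: it is at most zero at
    the minimiser \<open>u\<close>, hence \<open>?B u g\<close>, which equals the squared length of
    the residual \<open>g\<close>, is zero.\<close>
  have "(?B u g)\<^sup>2 \<le> ?B u u * ?B g g"
  proof (rule discriminant_le)
    fix t :: real
    let ?x = "\<lambda>a. u a + t * g a"
    have s: "(\<Sum>a<N. ?x a) = 0" using u0 g0 by (simp add: sum.distrib flip: sum_distrib_left)
    have "Lop ?x = (\<lambda>a. Lop u a + t * Lop g a)" by (rule ext) (rule Lop_lincomb)
    then have "dot (Lop ?x) ?x = dot (Lop u) u + t * dot (Lop u) g + t * (dot (Lop g) u + t * dot (Lop g) g)"
      by (simp add: bil)
    moreover have "dot (Lop g) u = dot (Lop u) g" using Lop_sym[of g u] dcomm by simp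
    moreover have "dot ?x ?x = dot u u + t * dot u g + t * (dot u g + t * dot g g)"
      by (simp add: bil dcomm[of g u])
    ultimately show "0 \<le> ?B u u + 2 * t * ?B u g + t\<^sup>2 * ?B g g"
      using lower[OF s] by (simp add: algebra_simps power2_eq_square)
  qed
  also have "\<dots> \<le> 0" using form0 lower[OF g0] by (intro mult_nonpos_nonneg) auto
  finally have "?B u g = 0" by simp
  moreover have "?B u g = dot g g"
  proof -
    have "g = (\<lambda>a. Lop u a + (- \<nu>) * u a)" by (simp add: g_def fun_eq_iff)
    then have "dot g g = dot (\<lambda>a. Lop u a + (- \<nu>) * u a) g" by simp
    then show ?thesis unfolding bil(1) by simp
  qed
  ultimately have "g a = 0" if "a < N" for a using that by (simp add: dot_self_zero)
  then have ev: "Lop u a = \<nu> * u a" if "a < N" for a using that by (simp add: g_def)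
  obtain a0 where "a0 < N" "u a0 \<noteq> 0"
    using u1 dot_self_zero[of u] by auto
  then have "eigenvalue A \<nu>" using ev by (intro eigenvalueI) auto
  moreover have "\<kappa> \<le> \<nu>"
    unfolding \<nu>_def
  proof (rule cINF_greatest[OF ne])
    fix x assume "x \<in> ?S"
    then show "\<kappa> \<le> dot (Lop x) x" using \<kappa>[of x] by simp
  qed
  ultimately show thesis using lower that by blast
qed

text \<open>The eigenvalue is specified by counting roots with multiplicity. No root is negative and
  0 is a simple root, so \<open>l = 0\<close> would leave at most one root up to \<open>l\<close>.
  The minimum \<open>\<nu>\<close> of the form is a positive eigenvalue; if it were below
  \<open>l\<close>, then 0 and \<open>\<nu>\<close> would be two roots below
  \<open>l\<close>.\<close>

lemma second_smallest_eigenvalue_bounds: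
  assumes \<kappa>: "\<kappa> > 0" "\<And>x. (\<Sum>a<N. x a) = 0 \<Longrightarrow> \<kappa> * dot x x \<le> dot (Lop x) x"
    and l: "second_smallest_eigenvalue A l"
  shows "l \<noteq> 0" "(\<Sum>a<N. x a) = 0 \<Longrightarrow> l * dot x x \<le> dot (Lop x) x"
proof -
  have fin: "finite {m. poly (char_poly A) m = 0}" by (rule poly_roots_finite[OF char_poly_nonzero])
  have ker: "x a = x 0" if "\<And>a. a < N \<Longrightarrow> Lop x a = 0" "a < N" for x a
  proof -
    define c where "c = (\<Sum>a<N. x a) / real N"
    let ?x = "\<lambda>a. x a - c"
    have "(\<Sum>a<N. ?x a) = 0" using N_pos by (simp add: sum_subtractf c_def)
    from \<kappa>(2)[OF this] have "\<kappa> * dot ?x ?x \<le> dot (Lop ?x) ?x" .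
    also have "\<dots> = 0" unfolding dot_def using that(1) Lop_shift[of _ x c] by simp
    finally have "dot ?x ?x \<le> 0" using \<kappa>(1) by (simp add: mult_le_0_iff)
    then have "dot ?x ?x = 0" using dot_self_nonneg[of ?x] by simp
    then show ?thesis using that(2) N_pos by (simp add: dot_self_zero)
  qed
  have order0: "order 0 (char_poly A) \<le> 1" by (rule zero_root_simple[OF ker])
  have nonneg: "0 \<le> m" if "eigenvalue A m" for m
  proof (rule ccontr)
    assume m: "\<not> 0 \<le> m"
    obtain v where v: "eigenvector A v m" using \<open>eigenvalue A m\<close> by (auto simp: eigenvalue_def)
    let ?v = "\<lambda>b. v $ b"
    have "\<kappa> * dot ?v ?v \<le> dot (Lop ?v) ?v"
      using eigenvector_mean_zero[OF v] m by (intro \<kappa>(2)) auto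
    also have "\<dots> = m * dot ?v ?v"
      using eigenvectorD(2)[OF v] by (simp add: dot_def sum_distrib_left mult_ac)
    also have "\<dots> \<le> 0" using m dot_self_nonneg[of ?v] by (intro mult_nonpos_nonneg) auto
    finally show False using \<kappa>(1) eigenvectorD(3)[OF v] by (simp add: mult_le_0_iff)
  qed
  show "l \<noteq> 0"
  proof
    assume "l = 0"
    then have "2 \<le> (\<Sum>m\<in>{m. poly (char_poly A) m = 0 \<and> m \<le> 0}. order m (char_poly A))"
      using l by (simp add: second_smallest_eigenvalue_def eig_count_le_def)
    also have "\<dots> \<le> (\<Sum>m\<in>{0}. order m (char_poly A))"
      using nonneg by (intro sum_mono2) (auto simp: root_iff_eigenvalue intro: antisym)
    finally show False using order0 by simp
  qed
  show "l * dot x x \<le> dot (Lop x) x" if x: "(\<Sum>a<N. x a) = 0"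
  proof (cases "dot x x = 0")
    case True
    then have "dot (Lop x) x = 0" by (simp add: dot_self_zero) (simp add: dot_def)
    then show ?thesis using True by simp
  next
    case False
    then have "dot x x > 0" using dot_self_nonneg[of x] by simp
    then obtain \<nu> where \<nu>: "eigenvalue A \<nu>" "\<kappa> \<le> \<nu>"
      "\<And>x. (\<Sum>a<N. x a) = 0 \<Longrightarrow> \<nu> * dot x x \<le> dot (Lop x) x"
      using minimizer_eigenvalue[OF \<kappa>(2) x] by blast
    have "l \<le> \<nu>"
    proof (rule ccontr)
      assume "\<not> l \<le> \<nu>"
      then have lt: "\<nu> < l" by simp
      have ev0: "eigenvalue A 0" by (rule eigenvalueI[of "\<lambda>_. 1" 0 0]) (use Lop_const N_pos in auto)
      have ord: "1 \<le> order m (char_poly A)" if "eigenvalue A m" for m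
        using that char_poly_nonzero order_root[of "char_poly A" m] by (simp add: root_iff_eigenvalue Suc_le_eq)
      have "2 \<le> (\<Sum>m\<in>{0, \<nu>}. order m (char_poly A))"
        using ord[OF ev0] ord[OF \<nu>(1)] \<nu>(2) \<kappa>(1) by simp
      also have "\<dots> \<le> eig_count_less A l"
        unfolding eig_count_less_def
        using fin ev0 \<nu>(1,2) \<kappa>(1) lt by (intro sum_mono2) (auto simp: root_iff_eigenvalue)
      finally show False using l by (simp add: second_smallest_eigenvalue_def)
    qed
    then have "l * dot x x \<le> \<nu> * dot x x" using dot_self_nonneg by (intro mult_right_mono)
    then show ?thesis using \<nu>(3)[OF x] by simp
  qed
qed

end

section \<open>Step functions\<close>

definition stepf :: "nat \<Rightarrow> (nat \<Rightarrow> real) \<Rightarrow> real \<Rightarrow> real" where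
  "stepf N y x = (\<Sum>a<N. y a * indicator (step_interval N (Suc a)) x)"

text \<open>The index, counted from 0, of the interval containing \<open>x\<close>. Truncated
  subtraction puts \<open>x = 0\<close> into cell 0, in accordance with the closed first
  interval.\<close>

definition cell :: "nat \<Rightarrow> real \<Rightarrow> nat" where
  "cell N x = nat \<lceil>real N * x\<rceil> - 1"

lemma step_fun_eq_stepf: "step_fun N v = stepf N (\<lambda>a. vec_index v a)"
  by (simp add: step_fun_def[abs_def] stepf_def[abs_def])

lemma cell_bounds:
  assumes N: "N > 0" and x: "x \<in> {0..1}"
  shows "cell N x < N" "\<bar>x - (real (cell N x) + 1) / real N\<bar> \<le> 1 / real N"
proof -
  have "\<lceil>real N * x\<rceil> \<le> int N"
    using x mult_left_mono[of x 1 "real N"] by (simp add: ceiling_le_iff)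
  then show "cell N x < N" using N by (simp add: cell_def)
  have "\<bar>real N * x - (real (cell N x) + 1)\<bar> \<le> 1"
  proof (cases "x = 0")
    case False
    then have "real N * x > 0" using N x by simp
    then have "\<lceil>real N * x\<rceil> \<ge> 1" by linarith
    then have "real (cell N x) = of_int \<lceil>real N * x\<rceil> - 1" unfolding cell_def by linarith
    then show ?thesis by linarith
  qed (simp add: cell_def)
  moreover have "x - (real (cell N x) + 1) / real N = (real N * x - (real (cell N x) + 1)) / real N"
    using N by (simp add: field_simps)
  ultimately show "\<bar>x - (real (cell N x) + 1) / real N\<bar> \<le> 1 / real N"
    by (simp add: abs_divide divide_right_mono)
qed

lemma grid_in_unit: "a < N \<Longrightarrow> (real a + 1) / real N \<in> {0..1}"
  by (simp add: divide_le_eq)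

lemma in_step_interval_iff:
  assumes N: "N > 0" and x: "x \<in> {0..1}"
  shows "x \<in> step_interval N (Suc a) \<longleftrightarrow> a = cell N x"
proof (cases "x = 0")
  case True
  then show ?thesis using N by (auto simp: step_interval_def cell_def divide_less_eq)
next
  case False
  then have p: "real N * x > 0" using N x by simp
  then have c: "\<lceil>real N * x\<rceil> \<ge> 1" by linarith
  have "x \<in> step_interval N (Suc a) \<longleftrightarrow> real a < real N * x \<and> real N * x \<le> real a + 1"
    using N x False p by (auto simp: step_interval_def field_simps)
  also have "\<dots> \<longleftrightarrow> \<lceil>real N * x\<rceil> = int a + 1" by (auto simp: ceiling_eq_iff)
  also have "\<dots> \<longleftrightarrow> a = cell N x" using c unfolding cell_def by linarith
  finally show ?thesis .
qed

lemma stepf_cell: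
  assumes N: "N > 0" and x: "x \<in> {0..1}"
  shows "stepf N y x = y (cell N x)"
proof -
  have "stepf N y x = (\<Sum>a<N. if a = cell N x then y a else 0)"
    unfolding stepf_def by (intro sum.cong refl) (simp add: indicator_def in_step_interval_iff[OF N x])
  then show ?thesis using cell_bounds(1)[OF N x] by (simp add: sum.delta)
qed

lemma step_interval_measure:
  assumes "N > 0" "a < N"
  shows "measure unit_measure (step_interval N (Suc a)) = 1 / real N"
    "step_interval N (Suc a) \<in> sets unit_measure"
proof -
  have sub: "step_interval N (Suc a) \<subseteq> {0..1}"
  proof
    fix x assume x: "x \<in> step_interval N (Suc a)"
    then have "real a / real N \<le> x" "x \<le> (real a + 1) / real N"
      by (auto simp: step_interval_def add.commute split: if_splits)
    moreover have "0 \<le> real a / real N" by simp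
    moreover have "(real a + 1) / real N \<le> 1" using assms by simp
    ultimately show "x \<in> {0..1}" unfolding atLeastAtMost_iff by linarith
  qed
  have leb: "step_interval N (Suc a) \<in> sets lebesgue" by (auto simp: step_interval_def)
  show "step_interval N (Suc a) \<in> sets unit_measure"
    using sub leb by (auto simp: sets_restrict_space image_iff intro!: bexI[of _ "step_interval N (Suc a)"])
  have "measure unit_measure (step_interval N (Suc a)) = measure lebesgue (step_interval N (Suc a))"
    using sub leb by (intro measure_restrict_space) auto
  also have "\<dots> = 1 / real N"
    using assms by (auto simp: step_interval_def field_simps)
  finally show "measure unit_measure (step_interval N (Suc a)) = 1 / real N" .
qed

lemma stepf_measurable:
  assumes "N > 0" shows "stepf N y \<in> borel_measurable unit_measure"
  unfolding stepf_def[abs_def]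
  by (intro borel_measurable_sum borel_measurable_times borel_measurable_const borel_measurable_indicator
      step_interval_measure(2)[OF assms]) (rule lessThan_iff[THEN iffD1])

lemma stepf_L2:
  assumes N: "N > 0" shows "L2 (stepf N y)"
proof (rule L2_bounded[OF stepf_measurable[OF N]])
  fix x :: real assume x: "x \<in> {0..1}"
  have "\<bar>y (cell N x)\<bar> \<le> (\<Sum>a<N. \<bar>y a\<bar>)"
    using cell_bounds(1)[OF N x] by (intro member_le_sum) auto
  then show "\<bar>stepf N y x\<bar> \<le> (\<Sum>a<N. \<bar>y a\<bar>)" using stepf_cell[OF N x] by simp
qed

lemma integral_stepf:
  assumes N: "N > 0"
  shows "integral\<^sup>L unit_measure (stepf N y) = (\<Sum>a<N. y a) / real N"
proof -
  have m: "step_interval N (Suc a) \<in> sets unit_measure" if "a \<in> {..<N}" for a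
    using step_interval_measure(2)[OF N] that by simp
  have I: "has_bochner_integral unit_measure (\<lambda>x. y a * indicat_real (step_interval N (Suc a)) x) (y a * (1 / real N))"
    if a: "a \<in> {..<N}" for a
  proof -
    have "has_bochner_integral unit_measure (indicat_real (step_interval N (Suc a)))
      (measure unit_measure (step_interval N (Suc a)))"
      by (rule has_bochner_integral_real_indicator[OF m[OF a]]) (simp add: unit.emeasure_eq_measure)
    then show ?thesis
      using step_interval_measure(1)[OF N] a by (intro has_bochner_integral_mult_right) simp
  qed
  have "has_bochner_integral unit_measure (stepf N y) (\<Sum>a<N. y a * (1 / real N))"
    unfolding stepf_def[abs_def] by (rule has_bochner_integral_sum) (rule I)
  then show ?thesis by (simp add: has_bochner_integral_integral_eq sum_divide_distrib)
qed

lemma integral_cell: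
  assumes N: "N > 0"
  shows "(\<integral>x. G (cell N x) \<partial>unit_measure) = (\<Sum>a<N. G a) / real N"
proof -
  have "(\<integral>x. G (cell N x) \<partial>unit_measure) = integral\<^sup>L unit_measure (stepf N G)"
    using stepf_cell[OF N] by (intro unit_integral_cong) simp
  then show ?thesis using integral_stepf[OF N] by simp
qed

lemma inner_stepf:
  assumes N: "N > 0"
  shows "inner_L2 (stepf N y) (stepf N z) = (\<Sum>a<N. y a * z a) / real N"
proof -
  have "inner_L2 (stepf N y) (stepf N z) = (\<integral>x. y (cell N x) * z (cell N x) \<partial>unit_measure)"
    unfolding inner_L2_def using stepf_cell[OF N] by (intro unit_integral_cong) simp
  then show ?thesis using integral_cell[OF N, of "\<lambda>a. y a * z a"] by simp
qed

lemma mean_stepf: "N > 0 \<Longrightarrow> inner_L2 (stepf N y) (\<lambda>_. 1) = (\<Sum>a<N. y a) / real N"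
  using integral_stepf[of N y] by (simp add: inner_L2_def)

lemma norm_stepf_le:
  assumes N: "N > 0" and le: "(\<Sum>a<N. (y a)\<^sup>2) \<le> B\<^sup>2 * (\<Sum>a<N. (z a)\<^sup>2)" and B: "B \<ge> 0"
  shows "norm_L2 (stepf N y) \<le> B * norm_L2 (stepf N z)"
proof (rule power2_le_imp_le)
  have "(\<Sum>a<N. (y a)\<^sup>2) / real N \<le> B\<^sup>2 * (\<Sum>a<N. (z a)\<^sup>2) / real N"
    using le by (rule divide_right_mono) simp
  then show "(norm_L2 (stepf N y))\<^sup>2 \<le> (B * norm_L2 (stepf N z))\<^sup>2"
    by (simp add: power_mult_distrib norm_L2_sq inner_stepf[OF N] flip: power2_eq_square)
qed (use B in simp)

context lipschitz_graphon
begin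

text \<open>The expected graph Laplacian divided by \<open>N * \<rho>\<close>; index
  \<open>a\<close> stands for the vertex at \<open>(a + 1) / N\<close>.\<close>

definition grid_lap :: "nat \<Rightarrow> (nat \<Rightarrow> real) \<Rightarrow> nat \<Rightarrow> real" where
  "grid_lap N y a = (\<Sum>b<N. w ((real a + 1) / real N) ((real b + 1) / real N) * (y a - y b)) / real N"

text \<open>On step functions \<open>grid_lap\<close> is the Laplacian of the sampled kernel, which
  differs from \<open>w\<close> by at most \<open>2 * K / N\<close>. The estimate is relative to the
  norm of the step function and needs no regularity of \<open>y\<close>. The factor doubles because
  both \<open>f x\<close> and \<open>f y\<close> enter.\<close>

lemma lap_stepf_close:
  assumes N: "N > 0"
  shows "norm_L2 (\<lambda>x. lap (stepf N y) x - stepf N (grid_lap N y) x) \<le> 4 * K / real N * norm_L2 (stepf N y)"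
proof -
  let ?f = "stepf N y"
  let ?g = "\<lambda>x. (real (cell N x) + 1) / real N"
  have f: "L2 ?f" by (rule stepf_L2[OF N])
  have pw: "\<bar>lap ?f x - stepf N (grid_lap N y) x\<bar> \<le> 2 * K / real N * (\<bar>?f x\<bar> + norm_L2 ?f)" if x: "x \<in> {0..1}" for x
  proof -
    let ?d = "\<lambda>t. ?f x - ?f t"
    have d: "L2 ?d" by (rule L2_diff[OF L2_const f])
    have gx: "?g x \<in> {0..1}" using grid_in_unit[OF cell_bounds(1)[OF N x]] .
    have "(\<integral>t. w (?g x) (?g t) * ?d t \<partial>unit_measure)
      = (\<integral>t. w (?g x) (?g t) * (y (cell N x) - y (cell N t)) \<partial>unit_measure)"
      by (rule unit_integral_cong) (simp only: stepf_cell[OF N x] stepf_cell[OF N])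
    also have "\<dots> = stepf N (grid_lap N y) x"
      unfolding stepf_cell[OF N x] grid_lap_def
      by (rule integral_cell[OF N, of "\<lambda>b. w (?g x) ((real b + 1) / real N) * (y (cell N x) - y b)"])
    finally have s: "stepf N (grid_lap N y) x = (\<integral>t. w (?g x) (?g t) * ?d t \<partial>unit_measure)" by (rule sym)
    have l: "lap ?f x = (\<integral>t. w x t * ?d t \<partial>unit_measure)" by (simp add: graphon_lap_def)
    have wm: "(\<lambda>t. w (?g x) (?g t)) \<in> borel_measurable unit_measure"
    proof -
      have "stepf N (\<lambda>b. w (?g x) ((real b + 1) / real N)) \<in> borel_measurable unit_measure"
        by (rule stepf_measurable[OF N])
      then show ?thesis
        by (subst (asm) measurable_cong[where g = "\<lambda>t. w (?g x) (?g t)"]) (simp_all add: stepf_cell[OF N])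
    qed
    have wb: "\<bar>w (?g x) (?g t)\<bar> \<le> 1" if "t \<in> {0..1}" for t
      by (rule w_abs[OF gx grid_in_unit[OF cell_bounds(1)[OF N that]]])
    have i1: "integrable unit_measure (\<lambda>t. w x t * ?d t)"
      by (rule L2_integrable[OF L2_w_mult[OF x d]])
    have i2: "integrable unit_measure (\<lambda>t. w (?g x) (?g t) * ?d t)"
      by (rule L2_integrable[OF L2_mult_bounded[OF d wm wb]])
    have "lap ?f x - stepf N (grid_lap N y) x = (\<integral>t. (w x t - w (?g x) (?g t)) * ?d t \<partial>unit_measure)"
      unfolding s l using i1 i2 by (simp add: left_diff_distrib)
    also have "\<bar>\<dots>\<bar> \<le> 2 * K / real N * norm_L2 ?d"
    proof (rule integral_bounded_mult_le[OF d])
      show "(\<lambda>t. w x t - w (?g x) (?g t)) \<in> borel_measurable unit_measure"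
        by (rule borel_measurable_diff[OF w_slice_measurable[OF x] wm])
      fix t :: real assume t: "t \<in> {0..1}"
      have "\<bar>w x t - w (?g x) (?g t)\<bar> \<le> K * (\<bar>x - ?g x\<bar> + \<bar>t - ?g t\<bar>)"
        by (rule w_lipschitz[OF x t gx grid_in_unit[OF cell_bounds(1)[OF N t]]])
      also have "\<dots> \<le> K * (1 / real N + 1 / real N)"
        using cell_bounds(2)[OF N x] cell_bounds(2)[OF N t] K_pos by (intro mult_left_mono add_mono) auto
      finally show "\<bar>w x t - w (?g x) (?g t)\<bar> \<le> 2 * K / real N" by (simp add: mult.commute)
    qed
    also have "\<dots> \<le> 2 * K / real N * (\<bar>?f x\<bar> + norm_L2 ?f)"
      using norm_L2_triangle_diff[OF L2_const f, of "?f x"] K_pos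
      by (intro mult_left_mono) (auto simp: norm_L2_const)
    finally show ?thesis .
  qed
  have af: "L2 (\<lambda>x. \<bar>?f x\<bar>)" using f by (auto simp: L2_def)
  have rf: "L2 (\<lambda>x. \<bar>?f x\<bar> + norm_L2 ?f)" by (rule L2_add[OF af L2_const])
  have "norm_L2 (\<lambda>x. lap ?f x - stepf N (grid_lap N y) x) \<le> norm_L2 (\<lambda>x. 2 * K / real N * (\<bar>?f x\<bar> + norm_L2 ?f))"
  proof (rule norm_L2_mono[OF L2_diff[OF lap_L2[OF f] stepf_L2[OF N]] L2_cmult[OF rf]])
    fix x :: real assume x: "x \<in> {0..1}"
    show "\<bar>lap ?f x - stepf N (grid_lap N y) x\<bar> \<le> \<bar>2 * K / real N * (\<bar>?f x\<bar> + norm_L2 ?f)\<bar>"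
      using order_trans[OF pw[OF x] abs_ge_self] .
  qed
  also have "\<dots> = 2 * K / real N * norm_L2 (\<lambda>x. \<bar>?f x\<bar> + norm_L2 ?f)"
    unfolding norm_L2_cmult using K_pos by simp
  also have "\<dots> \<le> 2 * K / real N * (norm_L2 (\<lambda>x. \<bar>?f x\<bar>) + norm_L2 (\<lambda>_. norm_L2 ?f))"
    using K_pos by (intro mult_left_mono norm_L2_triangle af L2_const) auto
  also have "norm_L2 (\<lambda>x. \<bar>?f x\<bar>) = norm_L2 ?f" by (simp add: norm_L2_def inner_L2_def)
  also have "2 * K / real N * (norm_L2 ?f + norm_L2 (\<lambda>_. norm_L2 ?f)) = 4 * K / real N * norm_L2 ?f"
    by (simp add: norm_L2_const)
  finally show ?thesis .
qed

end

section \<open>The Laplacian of the random graph\<close>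

definition lap_entry :: "nat \<Rightarrow> (nat \<times> nat \<Rightarrow> bool) \<Rightarrow> nat \<Rightarrow> nat \<Rightarrow> real" where
  "lap_entry N E a b = (if a = b then (\<Sum>c<N. adj E (a + 1) (c + 1)) else - adj E (a + 1) (b + 1))"

lemma adj_sym: "adj E i j = adj E j i"
  by (simp add: adj_def min.commute max.commute)

lemma laplacian_matrix_lap_entry: "N > 0 \<Longrightarrow> laplacian_matrix N (lap_entry N E)"
proof
  fix a b assume "a < N" "b < N"
  show "lap_entry N E a b = lap_entry N E b a" by (simp add: lap_entry_def adj_sym)
next
  fix a assume a: "a < N"
  have "(\<Sum>b<N. lap_entry N E a b) = lap_entry N E a a + (\<Sum>b\<in>{..<N} - {a}. - adj E (a + 1) (b + 1))"
    using a by (subst sum.remove[of _ a]) (auto simp: lap_entry_def intro!: sum.cong)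
  also have "(\<Sum>b\<in>{..<N} - {a}. - adj E (a + 1) (b + 1)) = (\<Sum>b<N. - adj E (a + 1) (b + 1))"
    by (intro sum.mono_neutral_left) (auto simp: adj_def)
  finally show "(\<Sum>b<N. lap_entry N E a b) = 0" by (simp add: lap_entry_def sum_negf)
qed

lemma graph_laplacian_eq: "N > 0 \<Longrightarrow> graph_laplacian N E = laplacian_matrix.A N (lap_entry N E)"
  by (subst laplacian_matrix.A_def[OF laplacian_matrix_lap_entry])
     (auto simp: graph_laplacian_def lap_entry_def intro!: cong_mat)

lemma Lop_lap_entry:
  assumes N: "N > 0" and a: "a < N"
  shows "laplacian_matrix.Lop N (lap_entry N E) y a = (\<Sum>c<N. adj E (a + 1) (c + 1) * (y a - y c))"
proof -
  have aa: "adj E (a + 1) (a + 1) = 0" by (simp add: adj_def)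
  have "(\<Sum>b<N. lap_entry N E a b * y b)
    = lap_entry N E a a * y a + (\<Sum>b\<in>{..<N} - {a}. lap_entry N E a b * y b)"
    using a by (subst sum.remove[of _ a]) auto
  also have "(\<Sum>b\<in>{..<N} - {a}. lap_entry N E a b * y b) = (\<Sum>b\<in>{..<N} - {a}. - (adj E (a + 1) (b + 1) * y b))"
    by (intro sum.cong) (auto simp: lap_entry_def)
  also have "\<dots> = (\<Sum>b<N. - (adj E (a + 1) (b + 1) * y b))"
    using aa by (intro sum.mono_neutral_left) auto
  finally show ?thesis
    unfolding laplacian_matrix.Lop_def[OF laplacian_matrix_lap_entry[OF N]]
    by (simp add: lap_entry_def sum_distrib_right sum_negf right_diff_distrib sum_subtractf)
qed

context lipschitz_graphon
begin

definition edge_prob :: "nat \<Rightarrow> real \<Rightarrow> nat \<times> nat \<Rightarrow> real" where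
  "edge_prob N \<rho> = (\<lambda>(i, j). \<rho> * w (real i / real N) (real j / real N))"

lemma bernoulli_graph_edge_prob:
  assumes "0 \<le> \<rho>" "\<rho> \<le> 1"
  shows "bernoulli_graph N (edge_prob N \<rho>) \<rho>"
proof
  fix e assume "e \<in> edge_slots N"
  then obtain i j where e: "e = (i, j)" "1 \<le> i" "i < j" "j \<le> N" by (auto simp: edge_slots_def)
  then have ij: "real i / real N \<in> {0..1}" "real j / real N \<in> {0..1}" by (auto simp: divide_le_eq)
  show "0 \<le> edge_prob N \<rho> e" using assms w_nonneg[OF ij] by (simp add: e edge_prob_def)
  show "edge_prob N \<rho> e \<le> \<rho>" using assms w_le_1[OF ij] by (simp add: e edge_prob_def mult_left_le)
qed (use assms in auto)

lemma random_graph_eq: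
  assumes "0 \<le> \<rho>" "\<rho> \<le> 1"
  shows "random_graph N \<rho> w = bernoulli_graph.P N (edge_prob N \<rho>)"
  unfolding random_graph_def bernoulli_graph.P_def[OF bernoulli_graph_edge_prob[OF assms]]
  by (simp add: edge_prob_def case_prod_unfold)

text \<open>Each adjacency entry is its mean plus a centred entry. The centred parts form exactly
  the two noise terms controlled by \<open>good\<close>, and the means form the sampled
  Laplacian.\<close>

lemma Lop_decompose:
  assumes N: "N > 0" and \<rho>: "0 \<le> \<rho>" "\<rho> \<le> 1" and a: "a < N"
  shows "laplacian_matrix.Lop N (lap_entry N E) y a
    = bernoulli_graph.rowsum N (edge_prob N \<rho>) E a * y a
      - (\<Sum>c<N. bernoulli_graph.H (edge_prob N \<rho>) E a c * y c) + \<rho> * real N * grid_lap N y a"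
proof -
  interpret bernoulli_graph N "edge_prob N \<rho>" \<rho> by (rule bernoulli_graph_edge_prob[OF \<rho>])
  let ?w = "\<lambda>c. w ((real a + 1) / real N) ((real c + 1) / real N)"
  have "adj E (a + 1) (c + 1) * (y a - y c) = H E a c * y a - H E a c * y c + \<rho> * (?w c * (y a - y c))"
    if c: "c < N" for c
  proof (cases "a = c")
    case False
    have "edge_prob N \<rho> (slot a c) = \<rho> * ?w c"
      using w_sym[OF grid_in_unit[OF a] grid_in_unit[OF c]]
      by (simp add: edge_prob_def slot_def min_def max_def add.commute)
    moreover have "adj E (a + 1) (c + 1) = of_bool (E (slot a c))"
      using False by (simp add: adj_def slot_def)
    ultimately show ?thesis using False by (simp add: H_def cen_def algebra_simps)
  qed (simp add: H_def)
  then have "(\<Sum>c<N. adj E (a + 1) (c + 1) * (y a - y c))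
    = (\<Sum>c<N. H E a c * y a - H E a c * y c + \<rho> * (?w c * (y a - y c)))"
    by (intro sum.cong) auto
  also have "\<dots> = rowsum E a * y a - (\<Sum>c<N. H E a c * y c) + \<rho> * (\<Sum>c<N. ?w c * (y a - y c))"
    by (simp add: sum.distrib sum_subtractf rowsum_def sum_distrib_right sum_distrib_left)
  finally show ?thesis
    unfolding Lop_lap_entry[OF N a] grid_lap_def using N by simp
qed

lemma Lop_grid_lap_close:
  assumes N: "N > 0" and \<rho>: "0 < \<rho>" "\<rho> \<le> 1" and s: "s \<ge> 0"
    and E: "E \<in> bernoulli_graph.good N (edge_prob N \<rho>) s"
  shows "norm_L2 (stepf N (\<lambda>a. laplacian_matrix.Lop N (lap_entry N E) y a / (\<rho> * real N) - grid_lap N y a))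
    \<le> 2 * s / (\<rho> * real N) * norm_L2 (stepf N y)"
proof -
  interpret bernoulli_graph N "edge_prob N \<rho>" \<rho> by (rule bernoulli_graph_edge_prob) (use \<rho> in auto)
  let ?D = "\<rho> * real N"
  have D: "?D > 0" using N \<rho> by simp
  have E1: "\<bar>rowsum E a\<bar> \<le> s" if "a < N" for a using E that by (simp add: good_def)
  have E2: "(\<Sum>a<N. (\<Sum>b<N. H E a b * y b)\<^sup>2) \<le> s\<^sup>2 * (\<Sum>a<N. (y a)\<^sup>2)" using E by (simp add: good_def)
  let ?r = "\<lambda>a. rowsum E a * y a / ?D" and ?h = "\<lambda>a. (\<Sum>c<N. H E a c * y c) / ?D"
  have n1: "norm_L2 (stepf N ?r) \<le> s / ?D * norm_L2 (stepf N y)"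
  proof (rule norm_stepf_le[OF N])
    have "(\<Sum>a<N. (?r a)\<^sup>2) \<le> (\<Sum>a<N. (s / ?D)\<^sup>2 * (y a)\<^sup>2)"
    proof (intro sum_mono)
      fix a assume "a \<in> {..<N}"
      then have "\<bar>rowsum E a\<bar>\<^sup>2 \<le> s\<^sup>2" using E1[of a] by (intro power_mono) auto
      then show "(?r a)\<^sup>2 \<le> (s / ?D)\<^sup>2 * (y a)\<^sup>2"
        by (auto simp: power_divide power_mult_distrib intro!: divide_right_mono mult_right_mono)
    qed
    then show "(\<Sum>a<N. (?r a)\<^sup>2) \<le> (s / ?D)\<^sup>2 * (\<Sum>a<N. (y a)\<^sup>2)" by (simp add: sum_distrib_left)
  qed (use s D in simp)
  have n2: "norm_L2 (stepf N ?h) \<le> s / ?D * norm_L2 (stepf N y)"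
  proof (rule norm_stepf_le[OF N])
    have "(\<Sum>a<N. (?h a)\<^sup>2) = (\<Sum>a<N. (\<Sum>b<N. H E a b * y b)\<^sup>2) / ?D\<^sup>2"
      by (simp only: power_divide sum_divide_distrib[symmetric])
    also have "\<dots> \<le> s\<^sup>2 * (\<Sum>a<N. (y a)\<^sup>2) / ?D\<^sup>2" using E2 by (rule divide_right_mono) simp
    finally show "(\<Sum>a<N. (?h a)\<^sup>2) \<le> (s / ?D)\<^sup>2 * (\<Sum>a<N. (y a)\<^sup>2)" by (simp add: power_divide)
  qed (use s D in simp)
  have "laplacian_matrix.Lop N (lap_entry N E) y a / ?D - grid_lap N y a = ?r a - ?h a" if "a < N" for a
    unfolding Lop_decompose[OF N less_imp_le[OF \<rho>(1)] \<rho>(2) that] using N \<rho>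
    by (simp add: add_divide_distrib diff_divide_distrib)
  then have "norm_L2 (stepf N (\<lambda>a. laplacian_matrix.Lop N (lap_entry N E) y a / ?D - grid_lap N y a))
    = norm_L2 (\<lambda>x. stepf N ?r x - stepf N ?h x)"
    using cell_bounds(1)[OF N] by (intro norm_L2_cong) (simp add: stepf_cell[OF N])
  also have "\<dots> \<le> norm_L2 (stepf N ?r) + norm_L2 (stepf N ?h)"
    by (rule norm_L2_triangle_diff[OF stepf_L2[OF N] stepf_L2[OF N]])
  finally have *: "norm_L2 (stepf N (\<lambda>a. laplacian_matrix.Lop N (lap_entry N E) y a / ?D - grid_lap N y a))
    \<le> norm_L2 (stepf N ?r) + norm_L2 (stepf N ?h)" .
  have "2 * s / ?D = s / ?D + s / ?D" by simp
  then show ?thesis using * n1 n2 by (simp only: distrib_right)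
qed

text \<open>Noise and discretisation combined. The bound holds for every \<open>y\<close> once
  \<open>E\<close> is good, so it may be applied to a Fiedler vector, which itself depends on
  \<open>E\<close>.\<close>

lemma lap_Lop_close:
  assumes N: "N > 0" and \<rho>: "0 < \<rho>" "\<rho> \<le> 1" and s: "s \<ge> 0"
    and E: "E \<in> bernoulli_graph.good N (edge_prob N \<rho>) s"
  shows "norm_L2 (\<lambda>x. lap (stepf N y) x - stepf N (\<lambda>a. laplacian_matrix.Lop N (lap_entry N E) y a / (\<rho> * real N)) x)
    \<le> (2 * s / (\<rho> * real N) + 4 * K / real N) * norm_L2 (stepf N y)"
proof -
  let ?G = "\<lambda>a. laplacian_matrix.Lop N (lap_entry N E) y a / (\<rho> * real N)"
  have "norm_L2 (\<lambda>x. lap (stepf N y) x - stepf N ?G x)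
    = norm_L2 (\<lambda>x. (lap (stepf N y) x - stepf N (grid_lap N y) x) - stepf N (\<lambda>a. ?G a - grid_lap N y a) x)"
    by (intro norm_L2_cong) (simp add: stepf_cell[OF N])
  also have "\<dots> \<le> norm_L2 (\<lambda>x. lap (stepf N y) x - stepf N (grid_lap N y) x)
      + norm_L2 (stepf N (\<lambda>a. ?G a - grid_lap N y a))"
    by (intro norm_L2_triangle_diff L2_diff lap_L2 stepf_L2 N)
  finally show ?thesis
    using lap_stepf_close[OF N, of y] Lop_grid_lap_close[OF N \<rho> s E, of y] unfolding distrib_right by linarith
qed

end

section \<open>Perturbation\<close>

context robinson_graphon
begin

lemma Lop_form_close:
  assumes N: "N > 0" and \<rho>: "0 < \<rho>" "\<rho> \<le> 1" and s: "s \<ge> 0"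
    and E: "E \<in> bernoulli_graph.good N (edge_prob N \<rho>) s"
  shows "\<bar>inner_L2 (lap (stepf N y)) (stepf N y)
      - laplacian_matrix.dot N (laplacian_matrix.Lop N (lap_entry N E) y) y / (\<rho> * real N) / real N\<bar>
    \<le> (2 * s / (\<rho> * real N) + 4 * K / real N) * inner_L2 (stepf N y) (stepf N y)"
proof -
  interpret G: laplacian_matrix N "lap_entry N E" by (rule laplacian_matrix_lap_entry[OF N])
  let ?f = "stepf N y" and ?g = "stepf N (\<lambda>a. G.Lop y a / (\<rho> * real N))"
  have "inner_L2 ?g ?f = G.dot (G.Lop y) y / (\<rho> * real N) / real N"
    unfolding inner_stepf[OF N] G.dot_def by (simp add: sum_divide_distrib)
  moreover have "inner_L2 (lap ?f) ?f - inner_L2 ?g ?f = inner_L2 (\<lambda>x. lap ?f x - ?g x) ?f"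
    by (rule inner_L2_diff_left[symmetric]) (intro lap_L2 stepf_L2 N)+
  moreover have "\<bar>inner_L2 (\<lambda>x. lap ?f x - ?g x) ?f\<bar> \<le> norm_L2 (\<lambda>x. lap ?f x - ?g x) * norm_L2 ?f"
    by (intro L2_Cauchy_Schwarz L2_diff lap_L2 stepf_L2 N)
  moreover have "norm_L2 (\<lambda>x. lap ?f x - ?g x) * norm_L2 ?f
    \<le> (2 * s / (\<rho> * real N) + 4 * K / real N) * norm_L2 ?f * norm_L2 ?f"
    by (intro mult_right_mono lap_Lop_close[OF N \<rho> s E]) simp
  ultimately show ?thesis unfolding mult.assoc norm_L2_sq[unfolded power2_eq_square] by simp
qed

text \<open>Sampling costs \<open>C / N\<close>. Since \<open>principal\<close> has mean zero, the
  mean of the samples is also at most \<open>C / N\<close>; subtracting it makes the vector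
  admissible for the Rayleigh bound and doubles the error.\<close>

lemma sampled_principal:
  assumes C: "C \<ge> 0" "\<And>x y. x \<in> {0..1} \<Longrightarrow> y \<in> {0..1} \<Longrightarrow> \<bar>principal x - principal y\<bar> \<le> C * \<bar>x - y\<bar>"
    and N: "N > 0"
  obtains y where "(\<Sum>a<N. y a) = 0" "norm_L2 (\<lambda>x. stepf N y x - principal x) \<le> 2 * C / real N"
proof -
  let ?p = "\<lambda>a. principal ((real a + 1) / real N)"
  define m where "m = (\<Sum>a<N. ?p a) / real N"
  have close: "\<bar>stepf N ?p x - principal x\<bar> \<le> C / real N" if x: "x \<in> {0..1}" for x
  proof -
    have "\<bar>stepf N ?p x - principal x\<bar> \<le> C * \<bar>(real (cell N x) + 1) / real N - x\<bar>"
      unfolding stepf_cell[OF N x] by (rule C(2)[OF grid_in_unit[OF cell_bounds(1)[OF N x]] x])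
    also have "\<dots> \<le> C * (1 / real N)"
      using cell_bounds(2)[OF N x] C(1) by (intro mult_left_mono) (simp_all add: abs_minus_commute)
    finally show ?thesis by simp
  qed
  let ?d = "\<lambda>x. stepf N ?p x - principal x"
  have d: "L2 ?d" by (intro L2_diff stepf_L2 N principal_L2)
  have nd: "norm_L2 ?d \<le> C / real N" by (rule norm_L2_sup[OF d close])
  have "m = inner_L2 ?d (\<lambda>_. 1)"
    using inner_L2_diff_left[OF stepf_L2[OF N] principal_L2 L2_const[of 1], of ?p] mean_stepf[OF N, of ?p] principal_mean
    by (simp add: m_def)
  then have m: "\<bar>m\<bar> \<le> C / real N"
    using L2_Cauchy_Schwarz[OF d L2_const[of 1]] nd by (simp add: norm_L2_const)
  show ?thesis
  proof (rule that[of "\<lambda>a. ?p a - m"])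
    show "(\<Sum>a<N. ?p a - m) = 0" using N by (simp add: sum_subtractf m_def)
    have "norm_L2 (\<lambda>x. stepf N (\<lambda>a. ?p a - m) x - principal x) = norm_L2 (\<lambda>x. ?d x - m)"
      by (rule norm_L2_cong) (simp add: stepf_cell[OF N])
    also have "\<dots> \<le> norm_L2 ?d + norm_L2 (\<lambda>_. m)" by (rule norm_L2_triangle_diff[OF d L2_const])
    finally show "norm_L2 (\<lambda>x. stepf N (\<lambda>a. ?p a - m) x - principal x) \<le> 2 * C / real N"
      using nd m by (simp add: norm_L2_const)
  qed
qed

text \<open>The error of the Rayleigh quotient at an eigenfunction is quadratic.\<close>

lemma form_near_principal:
  assumes f: "L2 f" and \<delta>: "norm_L2 (\<lambda>x. f x - principal x) \<le> \<delta>" "\<delta> \<le> 1 / 2"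
  shows "inner_L2 (lap f) f \<le> (bottom + 8 * \<delta>\<^sup>2) * inner_L2 f f" "inner_L2 f f > 0"
proof -
  let ?e = "\<lambda>x. f x - principal x"
  note p = principal_L2
  have e: "L2 ?e" by (rule L2_diff[OF f p])
  have "norm_L2 principal \<le> norm_L2 f + norm_L2 ?e"
    using norm_L2_triangle_diff[OF f e] by simp
  then have nf: "1 / 2 \<le> norm_L2 f" using \<delta> principal(2) by simp
  from power_mono[OF this, of 2] have ff: "1 / 4 \<le> inner_L2 f f"
    unfolding norm_L2_sq by (simp add: power2_eq_square)
  then show "inner_L2 f f > 0" by simp
  have 1: "inner_L2 (lap ?e) ?e = inner_L2 (lap f) ?e - bottom * inner_L2 ?e principal"
  proof -
    have "inner_L2 (lap ?e) ?e = inner_L2 (\<lambda>x. lap f x - lap principal x) ?e"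
      by (rule inner_L2_cong) (simp_all add: lap_diff[OF f p])
    also have "\<dots> = inner_L2 (lap f) ?e - inner_L2 (lap principal) ?e"
      by (intro inner_L2_diff_left lap_L2 f p e)
    also have "inner_L2 (lap principal) ?e = inner_L2 (lap ?e) principal"
      using lap_symmetric[OF p e] by (simp add: inner_L2_commute)
    finally show ?thesis using inner_lap_principal[OF e] by simp
  qed
  have 2: "inner_L2 (lap f) ?e = inner_L2 (lap f) f - bottom * inner_L2 f principal"
    using inner_L2_diff_right[OF f p lap_L2[OF f]] inner_lap_principal[OF f] by simp
  have 3: "inner_L2 ?e principal = inner_L2 f principal - 1"
    using inner_L2_diff_left[OF f p p] principal_inner by simp
  have 4: "inner_L2 ?e ?e = inner_L2 f f - 2 * inner_L2 f principal + 1"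
    using inner_L2_square_add[OF f p, of "-1"] principal_inner by simp
  \<comment> \<open>For the form of \<open>L - bottom\<close> the eigenfunction drops out, so the
    value at \<open>f\<close> equals the value at the difference \<open>?e\<close>. The bound
    \<open>inner_L2 f f >= 1 / 4\<close> then turns 2 into 8.\<close>
  have "inner_L2 (lap f) f = bottom * inner_L2 f f + inner_L2 (lap ?e) ?e - bottom * inner_L2 ?e ?e"
    unfolding 1 2 3 4 by (simp add: algebra_simps)
  also have "\<dots> \<le> bottom * inner_L2 f f + 2 * (norm_L2 ?e)\<^sup>2"
    using lap_form_le(1)[OF e] mult_nonneg_nonneg[OF less_imp_le[OF bottom_pos] inner_L2_self_nonneg[of ?e]] by simp
  also have "(norm_L2 ?e)\<^sup>2 \<le> \<delta>\<^sup>2" using \<delta>(1) by (rule power_mono) simp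
  also have "2 * \<delta>\<^sup>2 \<le> 8 * \<delta>\<^sup>2 * inner_L2 f f"
    using mult_left_mono[OF ff, of "8 * \<delta>\<^sup>2"] by simp
  finally show "inner_L2 (lap f) f \<le> (bottom + 8 * \<delta>\<^sup>2) * inner_L2 f f" by (simp add: distrib_right)
qed

text \<open>An argument of Davis-Kahan type. The part \<open>f'\<close> of \<open>f\<close>
  orthogonal to \<open>principal\<close> lies above the gap while \<open>l\<close> uses only half of
  it, so \<open>gap / 2 * norm f' <= r\<close>. The sign condition excludes the opposite
  eigenfunction and gives
  \<open>\<bar>f - \<phi>\<bar>\<^sup>2 <= 2 * \<bar>f'\<bar>\<^sup>2\<close>; the root of 2 is
  rounded up to \<open>3 / 2\<close>.\<close>

lemma approximate_eigenfunction_close: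
  assumes f: "L2 f" "norm_L2 f = 1" "inner_L2 f (\<lambda>_. 1) = 0"
    and l: "l \<le> bottom + gap / 2" and r: "norm_L2 (\<lambda>x. lap f x - l * f x) \<le> r"
    and \<phi>: "L2 \<phi>" "AE x in unit_measure. \<phi> x = c * principal x" "c = 1 \<or> c = - 1" "inner_L2 \<phi> f \<ge> 0"
  shows "norm_L2 (\<lambda>x. f x - \<phi> x) \<le> 3 * r / gap"
proof -
  note p = principal_L2
  let ?t = "inner_L2 f principal"
  define f' where "f' = (\<lambda>x. f x - ?t * principal x)"
  have f': "L2 f'" unfolding f'_def by (intro L2_diff f L2_cmult p)
  have ff: "inner_L2 f f = 1" using f(2) norm_L2_sq[of f] by simp
  have f'p: "inner_L2 f' principal = 0" unfolding f'_def
    by (simp add: inner_L2_diff_left[OF f(1) L2_cmult[OF p] p] inner_L2_cmult_left principal_inner)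
  have f'1: "inner_L2 f' (\<lambda>_. 1) = 0" unfolding f'_def
    by (simp add: inner_L2_diff_left[OF f(1) L2_cmult[OF p] L2_const] inner_L2_cmult_left f(3) principal_mean)
  have orth: "inner_L2 g f' = inner_L2 (\<lambda>x. g x - a * principal x) f'" if "L2 g" for g a
    using f'p inner_L2_commute[of f' principal]
    by (simp add: inner_L2_diff_left[OF that L2_cmult[OF p] f'] inner_L2_cmult_left)
  have ff': "inner_L2 f f' = inner_L2 f' f'" using orth[OF f(1), of ?t] by (simp add: f'_def)
  have n2: "(norm_L2 f')\<^sup>2 = 1 - ?t\<^sup>2"
    unfolding norm_L2_sq using inner_L2_square_add[OF f(1) p, of "- ?t"] ff principal_inner
    by (simp add: f'_def power2_eq_square)
  have "inner_L2 (lap f') f' = inner_L2 (\<lambda>x. lap f x - (?t * bottom) * principal x) f'"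
    by (rule inner_L2_cong)
       (simp_all add: f'_def lap_diff[OF f(1) L2_cmult[OF p]] lap_cmult[OF p] bottom_eigenfnD(3)[OF principal(1)])
  also have "\<dots> = inner_L2 (lap f) f'" using orth[OF lap_L2[OF f(1)]] by simp
  also have "\<dots> = inner_L2 (\<lambda>x. lap f x - l * f x) f' + l * inner_L2 f' f'"
    using inner_L2_diff_left[OF lap_L2[OF f(1)] L2_cmult[OF f(1)] f', of l] ff' by (simp add: inner_L2_cmult_left)
  finally have eq: "inner_L2 (lap f') f' = inner_L2 (\<lambda>x. lap f x - l * f x) f' + l * inner_L2 f' f'" .
  have "inner_L2 (\<lambda>x. lap f x - l * f x) f' \<le> norm_L2 (\<lambda>x. lap f x - l * f x) * norm_L2 f'"
    using L2_Cauchy_Schwarz[OF L2_diff[OF lap_L2[OF f(1)] L2_cmult[OF f(1)]] f', of l] by simp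
  also have "\<dots> \<le> r * norm_L2 f'" using r by (rule mult_right_mono) simp
  finally have b: "inner_L2 (\<lambda>x. lap f x - l * f x) f' \<le> r * norm_L2 f'" .
  have "(bottom + gap) * (norm_L2 f')\<^sup>2 \<le> r * norm_L2 f' + l * (norm_L2 f')\<^sup>2"
    using gap(3)[OF f' f'1 f'p] eq b by (simp add: norm_L2_sq)
  also have "l * (norm_L2 f')\<^sup>2 \<le> (bottom + gap / 2) * (norm_L2 f')\<^sup>2" using l by (rule mult_right_mono) simp
  finally have "(gap / 2 * norm_L2 f') * norm_L2 f' \<le> r * norm_L2 f'"
    by (simp add: algebra_simps power2_eq_square)
  then have n: "gap * norm_L2 f' \<le> 2 * r"
  proof (cases "norm_L2 f' = 0")
    case True
    then show ?thesis using order_trans[OF norm_L2_nonneg r] by simp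
  next
    case False
    then have "norm_L2 f' > 0" using norm_L2_nonneg[of f'] by linarith
    then show ?thesis using \<open>(gap / 2 * norm_L2 f') * norm_L2 f' \<le> r * norm_L2 f'\<close> by simp
  qed
  have c2: "c\<^sup>2 = 1" using \<phi>(3) by auto
  have "inner_L2 \<phi> f = inner_L2 (\<lambda>x. c * principal x) f"
    by (rule inner_L2_AE[OF \<phi>(2) _ \<phi>(1) f(1) L2_cmult[OF p] f(1)]) simp
  also have "\<dots> = c * ?t" by (simp add: inner_L2_cmult_left inner_L2_commute)
  finally have ct: "c * ?t \<ge> 0" using \<phi>(4) by simp
  have ct2: "(c * ?t)\<^sup>2 = ?t\<^sup>2" using c2 by (simp add: power_mult_distrib)
  have AE: "AE x in unit_measure. f x - \<phi> x = f x + (- c) * principal x"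
    using \<phi>(2) by eventually_elim simp
  have "(norm_L2 (\<lambda>x. f x - \<phi> x))\<^sup>2 = inner_L2 (\<lambda>x. f x + (- c) * principal x) (\<lambda>x. f x + (- c) * principal x)"
    unfolding norm_L2_sq by (rule inner_L2_AE[OF AE AE]) (intro L2_diff L2_add L2_cmult f(1) \<phi>(1) p)+
  also have "\<dots> = 2 * (1 - c * ?t)"
    unfolding inner_L2_square_add[OF f(1) p] using ff c2 principal_inner by simp
  also have "\<dots> \<le> 2 * ((1 - c * ?t) * (1 + c * ?t))"
  proof -
    have "(c * ?t)\<^sup>2 \<le> 1\<^sup>2" using n2 zero_le_power2[of "norm_L2 f'"] ct2 by simp
    then have "c * ?t \<le> 1" using power2_le_imp_le[of "c * ?t" 1] by simp
    then show ?thesis using ct mult_left_mono[of 1 "1 + c * ?t" "1 - c * ?t"] by simp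
  qed
  also have "(1 - c * ?t) * (1 + c * ?t) = (norm_L2 f')\<^sup>2"
  proof -
    have "(1 - c * ?t) * (1 + c * ?t) = 1 - (c * ?t)\<^sup>2" by (simp add: algebra_simps power2_eq_square)
    then show ?thesis using n2 ct2 by simp
  qed
  also have "2 * (norm_L2 f')\<^sup>2 \<le> (3 / 2 * norm_L2 f')\<^sup>2"
    by (simp add: power_mult_distrib power_divide)
  finally have "(norm_L2 (\<lambda>x. f x - \<phi> x))\<^sup>2 \<le> (3 / 2 * norm_L2 f')\<^sup>2" .
  then have "norm_L2 (\<lambda>x. f x - \<phi> x) \<le> 3 / 2 * norm_L2 f'"
    by (rule power2_le_imp_le) simp
  also have "\<dots> \<le> 3 * r / gap" using n gap(1) by (simp add: field_simps)
  finally show ?thesis .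
qed

text \<open>The deterministic half of the theorem. The number \<open>r\<close> bounds the total
  operator error; \<open>r <= bottom / 2\<close> keeps the graph form positive on vectors of mean
  zero, and the two bounds by \<open>gap / 4\<close> place the rescaled Fiedler value in the lower
  half of the gap.\<close>

lemma good_subset_fiedler_close_event:
  assumes C: "C \<ge> 0" "\<And>x y. x \<in> {0..1} \<Longrightarrow> y \<in> {0..1} \<Longrightarrow> \<bar>principal x - principal y\<bar> \<le> C * \<bar>x - y\<bar>"
    and N: "N > 0" and \<rho>: "0 < \<rho>" "\<rho> \<le> 1" and s: "s \<ge> 0"
    and r: "2 * s / (\<rho> * real N) + 4 * K / real N \<le> r" "r \<le> bottom / 2" "r \<le> gap / 4"
    and \<delta>: "2 * C / real N \<le> 1 / 2" "8 * (2 * C / real N)\<^sup>2 \<le> gap / 4"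
    and \<phi>: "fiedler_function w \<phi>" "norm_L2 \<phi> = 1"
  shows "bernoulli_graph.good N (edge_prob N \<rho>) s \<subseteq> fiedler_close_event N \<phi> (3 * r / gap)"
proof
  fix E assume E: "E \<in> bernoulli_graph.good N (edge_prob N \<rho>) s"
  interpret G: laplacian_matrix N "lap_entry N E" by (rule laplacian_matrix_lap_entry[OF N])
  let ?D = "\<rho> * real N"
  have D: "?D > 0" and N': "real N > 0" using N \<rho> by simp_all
  obtain c where c: "c = 1 \<or> c = - 1" "L2 \<phi>" "AE x in unit_measure. \<phi> x = c * principal x"
    using fiedler_function_principal[OF \<phi>] by blast
  have form: "\<bar>inner_L2 (lap (stepf N y)) (stepf N y) - G.dot (G.Lop y) y / ?D / real N\<bar>
    \<le> r * inner_L2 (stepf N y) (stepf N y)" for y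
    by (rule order_trans[OF Lop_form_close[OF N \<rho> s E] mult_right_mono[OF r(1)]]) simp
  have dot: "G.dot y y = real N * inner_L2 (stepf N y) (stepf N y)" for y
    unfolding inner_stepf[OF N] G.dot_def using N by simp
  \<comment> \<open>Half of the coercivity of the graphon form survives the perturbation; this
    supplies the positive \<open>\<kappa>\<close> needed to recognise the second eigenvalue.\<close>
  have lower: "?D * (bottom / 2) * G.dot y y \<le> G.dot (G.Lop y) y" if "(\<Sum>a<N. y a) = 0" for y
  proof -
    let ?f = "stepf N y"
    have "inner_L2 ?f (\<lambda>_. 1) = 0" using that mean_stepf[OF N, of y] by simp
    then have "bottom * inner_L2 ?f ?f \<le> inner_L2 (lap ?f) ?f"
      by (rule bottom_le_form[OF stepf_L2[OF N]])
    moreover have "r * inner_L2 ?f ?f \<le> bottom / 2 * inner_L2 ?f ?f" by (rule mult_right_mono[OF r(2)]) simp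
    ultimately have "bottom / 2 * inner_L2 ?f ?f \<le> G.dot (G.Lop y) y / ?D / real N"
      using form[of y] by linarith
    then have "bottom / 2 * inner_L2 ?f ?f * real N * ?D \<le> G.dot (G.Lop y) y"
      unfolding pos_le_divide_eq[OF D] pos_le_divide_eq[OF N'] .
    then show ?thesis unfolding dot by (simp only: mult_ac)
  qed
  have \<kappa>: "?D * (bottom / 2) > 0" using D bottom_pos by simp
  obtain y where y: "(\<Sum>a<N. y a) = 0" "norm_L2 (\<lambda>x. stepf N y x - principal x) \<le> 2 * C / real N"
    using sampled_principal[OF C N] by blast
  note near = form_near_principal[OF stepf_L2[OF N] y(2) \<delta>(1)]
  have "norm_L2 (\<lambda>x. step_fun N v x - \<phi> x) \<le> 3 * r / gap"
    if v: "fiedler_vector (graph_laplacian N E) v" "norm_L2 (step_fun N v) = 1" "inner_L2 \<phi> (step_fun N v) \<ge> 0" for v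
  proof -
    obtain l where l: "second_smallest_eigenvalue G.A l" and ev: "eigenvector G.A v l"
      using v(1) unfolding fiedler_vector_def graph_laplacian_eq[OF N] by blast
    note bounds = G.second_smallest_eigenvalue_bounds[OF \<kappa> lower l]
    let ?u = "\<lambda>a. vec_index v a"
    let ?f = "stepf N ?u"
    have "l * (real N * inner_L2 (stepf N y) (stepf N y)) \<le> G.dot (G.Lop y) y"
      using bounds(2)[OF _ y(1)] by (simp add: dot)
    then have "l * (real N * inner_L2 (stepf N y) (stepf N y)) / ?D / real N \<le> G.dot (G.Lop y) y / ?D / real N"
      using D N' by (intro divide_right_mono less_imp_le[OF D] less_imp_le[OF N'])
    moreover have "l / ?D * inner_L2 (stepf N y) (stepf N y)
      = l * (real N * inner_L2 (stepf N y) (stepf N y)) / ?D / real N" using N' by simp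
    ultimately have "l / ?D * inner_L2 (stepf N y) (stepf N y) \<le> G.dot (G.Lop y) y / ?D / real N" by simp
    also have "\<dots> \<le> inner_L2 (lap (stepf N y)) (stepf N y) + r * inner_L2 (stepf N y) (stepf N y)"
      using form[of y] by linarith
    also have "\<dots> \<le> (bottom + 8 * (2 * C / real N)\<^sup>2 + r) * inner_L2 (stepf N y) (stepf N y)"
      using near(1) by (simp add: distrib_right)
    finally have "l / ?D \<le> bottom + 8 * (2 * C / real N)\<^sup>2 + r"
      using near(2) by (rule mult_right_le_imp_le)
    \<comment> \<open>One quarter of the gap pays for sampling the eigenfunction, the other for the
      operator error.\<close>
    then have l': "l / ?D \<le> bottom + gap / 2" using \<delta>(2) r(3) by linarith
    have "(\<Sum>a<N. ?u a) = 0" by (rule G.eigenvector_mean_zero[OF ev bounds(1)])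
    then have mean: "inner_L2 ?f (\<lambda>_. 1) = 0" using mean_stepf[OF N, of ?u] by simp
    have n: "norm_L2 ?f = 1" using v(2) by (simp add: step_fun_eq_stepf)
    have "norm_L2 (\<lambda>x. lap ?f x - l / ?D * ?f x)
      = norm_L2 (\<lambda>x. lap ?f x - stepf N (\<lambda>a. G.Lop ?u a / ?D) x)"
      by (rule norm_L2_cong) (simp add: stepf_cell[OF N] G.eigenvectorD(2)[OF ev] cell_bounds(1)[OF N])
    also have "\<dots> \<le> (2 * s / ?D + 4 * K / real N) * norm_L2 ?f" by (rule lap_Lop_close[OF N \<rho> s E])
    also have "\<dots> \<le> r" using n r(1) by simp
    finally have "norm_L2 (\<lambda>x. lap ?f x - l / ?D * ?f x) \<le> r" .
    moreover have "inner_L2 \<phi> ?f \<ge> 0" using v(3) by (simp add: step_fun_eq_stepf)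
    ultimately show ?thesis
      unfolding step_fun_eq_stepf
      by (rule approximate_eigenfunction_close[OF stepf_L2[OF N] n mean l' _ c(2,3,1)])
  qed
  then show "E \<in> fiedler_close_event N \<phi> (3 * r / gap)" by (simp add: fiedler_close_event_def)
qed

end

section \<open>Choice of the moment order and of the threshold\<close>

lemma tail_terms_le:
  fixes x :: real
  assumes x: "x \<ge> 1" and \<kappa>: "\<kappa> > 0" and k: "k = nat \<lceil>L\<rceil>" "L \<ge> 0"
    and L: "(L + 2)\<^sup>2 \<le> x powr \<kappa>"
    and e1: "ln (4 * x) + 1 - x powr \<kappa> \<le> - L"
    and e2: "(1 + \<kappa> - \<kappa> * L) * ln x + ln 2 \<le> - L"
  shows "x * (2 * exp (1 - x powr \<kappa>)) + x * (x powr (- 2 * \<kappa>)) ^ k * real (Suc k) ^ (2 * k + 2) \<le> exp (- L)"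
proof -
  \<comment> \<open>Of the factor 4 in \<open>e1\<close>, one 2 comes from the two-sided tail and
    the other leaves room for the second summand.\<close>
  have "x * (2 * exp (1 - x powr \<kappa>)) = exp (ln (4 * x) + 1 - x powr \<kappa>) / 2"
    using x by (simp add: exp_add exp_diff)
  also have "\<dots> \<le> exp (- L) / 2" using e1 by simp
  finally have t1: "x * (2 * exp (1 - x powr \<kappa>)) \<le> exp (- L) / 2" .
  have kL: "real k \<ge> L" "real k \<le> L + 1" using k by linarith+
  \<comment> \<open>Each moment order gains \<open>x powr (- 2 * \<kappa>)\<close>. Half of this
    pays for the walk count through \<open>(k + 1)\<^sup>2 <= x powr \<kappa>\<close>, and about
    \<open>k\<close> factors \<open>x powr (- \<kappa>)\<close> remain.\<close>
  have "(real (Suc k))\<^sup>2 \<le> (L + 2)\<^sup>2" using kL by (intro power_mono) auto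
  then have "((real (Suc k))\<^sup>2) ^ Suc k \<le> (x powr \<kappa>) ^ Suc k" using L by (intro power_mono) auto
  also have "((real (Suc k))\<^sup>2) ^ Suc k = real (Suc k) ^ (2 * k + 2)"
    unfolding power_mult[symmetric] by simp
  also have "(x powr \<kappa>) ^ Suc k = x powr (\<kappa> * (real k + 1))"
    using x by (simp add: powr_power mult.commute add.commute del: power_Suc)
  finally have "x * (x powr (- 2 * \<kappa>)) ^ k * real (Suc k) ^ (2 * k + 2)
    \<le> x * (x powr (- 2 * \<kappa>)) ^ k * x powr (\<kappa> * (real k + 1))"
    using x by (intro mult_left_mono) auto
  also have p: "(x powr (- 2 * \<kappa>)) ^ k = x powr (- 2 * \<kappa> * real k)"
    using x by (simp add: powr_power mult_ac)
  also have "x * x powr (- 2 * \<kappa> * real k) * x powr (\<kappa> * (real k + 1))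
    = x powr 1 * x powr (- 2 * \<kappa> * real k) * x powr (\<kappa> * (real k + 1))" using x by simp
  also have "\<dots> = x powr (1 + \<kappa> - \<kappa> * real k)"
    unfolding powr_add[symmetric] by (rule arg_cong[where f = "(powr) x"]) (simp add: algebra_simps)
  also have "\<dots> \<le> x powr (1 + \<kappa> - \<kappa> * L)" using x \<kappa> kL by (intro powr_mono) auto
  also have "\<dots> = exp ((1 + \<kappa> - \<kappa> * L) * ln x + ln 2) / 2"
    using x by (simp add: powr_def exp_add)
  also have "\<dots> \<le> exp (- L) / 2" using e2 by simp
  finally show ?thesis using t1 unfolding p by linarith
qed

context robinson_graphon
begin

lemma eventually_fiedler_close:
  assumes \<tau>: "0 \<le> \<tau>" "\<tau> < 1" and \<eta>: "0 < \<eta>" "\<eta> < (1 - \<tau>) / 3" and \<gamma>: "\<gamma> > 1"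
    and \<phi>: "fiedler_function w \<phi>" "norm_L2 \<phi> = 1"
  shows "\<forall>\<^sub>F N in sequentially. measure_pmf.prob (random_graph N (real N powr (- \<tau>)) w)
    (fiedler_close_event N \<phi> (3 * (2 + 4 * K) / gap * real N powr (- 3 * \<eta> / 2))) \<ge> 1 - eps_gamma \<gamma> N"
proof -
  \<comment> \<open>The exponent of \<open>s / sqrt (N * \<rho>)\<close>, that is
    \<open>(1 - \<tau> - 3 * \<eta> / 2) - (1 - \<tau>) / 2\<close>; its positivity is the
    hypothesis on \<open>\<eta>\<close>.\<close>
  define \<kappa> where "\<kappa> = (1 - \<tau> - 3 * \<eta>) / 2"
  have \<kappa>: "\<kappa> > 0" using \<eta> by (simp add: \<kappa>_def)
  \<comment> \<open>Ensures that the discretisation error, of order \<open>1 / N\<close>, is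
    dominated by the target rate.\<close>
  have \<eta>1: "3 * \<eta> / 2 \<le> 1" using \<eta> \<tau> by simp
  obtain C where C: "C \<ge> 0" "\<And>x y. x \<in> {0..1} \<Longrightarrow> y \<in> {0..1} \<Longrightarrow> \<bar>principal x - principal y\<bar> \<le> C * \<bar>x - y\<bar>"
    using bottom_eigenfn_lipschitz[OF principal(1)] by blast
  have small: "\<forall>\<^sub>F x in at_top. f x \<le> d" if "(f \<longlongrightarrow> 0) at_top" "d > 0" for f :: "real \<Rightarrow> real" and d
    using order_tendstoD(2)[OF that] by (rule eventually_mono) simp
  have C0: "((\<lambda>x. 2 * C / x) \<longlongrightarrow> 0) at_top" by (rule real_tendsto_divide_at_top[OF tendsto_const filterlim_ident])
  have "((\<lambda>x. 8 * (2 * C / x)\<^sup>2) \<longlongrightarrow> 8 * 0\<^sup>2) at_top" by (intro tendsto_intros C0)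
  then have C2: "((\<lambda>x. 8 * (2 * C / x)\<^sup>2) \<longlongrightarrow> 0) at_top" by simp
  have r: "((\<lambda>x. (2 + 4 * K) * x powr (- 3 * \<eta> / 2)) \<longlongrightarrow> 0) at_top"
    using \<eta>(1) by (intro tendsto_mult_right_zero tendsto_neg_powr filterlim_ident) simp
  have "\<forall>\<^sub>F x :: real in at_top. 2 * C / x \<le> 1 / 2" by (rule small[OF C0]) simp
  moreover have "\<forall>\<^sub>F x :: real in at_top. 8 * (2 * C / x)\<^sup>2 \<le> gap / 4"
    by (rule small[OF C2]) (use gap in simp)
  moreover have "\<forall>\<^sub>F x in at_top. (2 + 4 * K) * x powr (- 3 * \<eta> / 2) \<le> bottom / 2"
    by (rule small[OF r]) (use bottom_pos in simp)
  moreover have "\<forall>\<^sub>F x in at_top. (2 + 4 * K) * x powr (- 3 * \<eta> / 2) \<le> gap / 4"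
    by (rule small[OF r]) (use gap in simp)
  moreover have "\<forall>\<^sub>F x :: real in at_top. x \<ge> 3" by (rule eventually_ge_at_top)
  moreover have "\<forall>\<^sub>F x :: real in at_top. (ln x powr \<gamma> + 2)\<^sup>2 \<le> x powr \<kappa>" using \<gamma> \<kappa> by real_asymp
  moreover have "\<forall>\<^sub>F x :: real in at_top. ln (4 * x) + 1 - x powr \<kappa> \<le> - (ln x powr \<gamma>)" using \<gamma> \<kappa> by real_asymp
  moreover have "\<forall>\<^sub>F x :: real in at_top. (1 + \<kappa> - \<kappa> * ln x powr \<gamma>) * ln x + ln 2 \<le> - (ln x powr \<gamma>)"
    using \<gamma> \<kappa> by real_asymp
  ultimately have "\<forall>\<^sub>F x :: real in at_top. 2 * C / x \<le> 1 / 2 \<and> 8 * (2 * C / x)\<^sup>2 \<le> gap / 4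
    \<and> (2 + 4 * K) * x powr (- 3 * \<eta> / 2) \<le> bottom / 2 \<and> (2 + 4 * K) * x powr (- 3 * \<eta> / 2) \<le> gap / 4
    \<and> x \<ge> 3 \<and> (ln x powr \<gamma> + 2)\<^sup>2 \<le> x powr \<kappa> \<and> ln (4 * x) + 1 - x powr \<kappa> \<le> - (ln x powr \<gamma>)
    \<and> (1 + \<kappa> - \<kappa> * ln x powr \<gamma>) * ln x + ln 2 \<le> - (ln x powr \<gamma>)"
    by eventually_elim simp
  from eventually_compose_filterlim[OF this filterlim_real_sequentially] show ?thesis
  proof eventually_elim
    case (elim N)
    let ?x = "real N" and ?\<rho> = "real N powr (- \<tau>)"
    \<comment> \<open>The target rate \<open>N powr (- 3 * \<eta> / 2)\<close> multiplied by the
      scale \<open>N * \<rho>\<close> of the degrees.\<close>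
    define s where "s = ?x powr (1 - \<tau> - 3 * \<eta> / 2)"
    define k where "k = nat \<lceil>ln ?x powr \<gamma>\<rceil>"
    let ?r = "(2 + 4 * K) * ?x powr (- 3 * \<eta> / 2)"
    have N: "N > 0" and x: "?x \<ge> 1" "?x > 0" using elim by auto
    have \<rho>: "0 < ?\<rho>" "?\<rho> \<le> 1" using x \<tau> by (auto simp: powr_le_one_le powr_minus_divide ge_one_powr_ge_zero)
    have D: "?x * ?\<rho> = ?x powr (1 - \<tau>)"
      using x powr_add[of ?x 1 "- \<tau>"] by simp
    have s: "s > 0" using x by (simp add: s_def)
    interpret bernoulli_graph N "edge_prob N ?\<rho>" ?\<rho>
      by (rule bernoulli_graph_edge_prob) (use \<rho> in auto)
    have sD: "s / (?\<rho> * ?x) = ?x powr (- 3 * \<eta> / 2)"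
      unfolding mult.commute[of ?\<rho>] D s_def powr_diff[symmetric] by simp
    have rr: "2 * s / (?\<rho> * ?x) + 4 * K / ?x \<le> ?r"
    proof -
      have "1 / ?x = ?x powr (- 1)" using x by (simp add: powr_minus_divide)
      also have "\<dots> \<le> ?x powr (- 3 * \<eta> / 2)" using x \<eta>1 by (intro powr_mono) auto
      finally have "4 * K * (1 / ?x) \<le> 4 * K * ?x powr (- 3 * \<eta> / 2)"
        using K_pos by (intro mult_left_mono) auto
      moreover have "2 * s / (?\<rho> * ?x) = 2 * ?x powr (- 3 * \<eta> / 2)" using sD by simp
      ultimately show ?thesis by (simp only: distrib_right times_divide_eq_right mult_1_right)
    qed
    have sub: "good s \<subseteq> fiedler_close_event N \<phi> (3 * ?r / gap)"
    proof (rule good_subset_fiedler_close_event[where C = C])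
      show "\<And>x y. x \<in> {0..1} \<Longrightarrow> y \<in> {0..1} \<Longrightarrow> \<bar>principal x - principal y\<bar> \<le> C * \<bar>x - y\<bar>" by (fact C(2))
    qed (use C(1) N \<rho> less_imp_le[OF s] rr elim \<phi> in simp_all)
    have "?x > 1" using elim by linarith
    then have "ln ?x > 0" by (rule ln_gt_zero)
    then have "ln ?x powr \<gamma> > 0" by simp
    then have k: "k > 0" "ln ?x powr \<gamma> \<ge> 0" by (simp_all add: k_def)
    have sq: "s / sqrt (?x * ?\<rho>) = ?x powr \<kappa>"
      unfolding D powr_half_sqrt[OF powr_ge_zero, symmetric] powr_powr s_def powr_diff[symmetric]
      by (rule arg_cong[where f = "(powr) ?x"]) (simp add: \<kappa>_def field_simps)
    have "(?x * ?\<rho>) ^ k / s ^ (2 * k) = ((?x * ?\<rho>) / s\<^sup>2) ^ k" unfolding power_mult power_divide ..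
    also have "(?x * ?\<rho>) / s\<^sup>2 = ?x powr (- 2 * \<kappa>)"
    proof -
      have "s\<^sup>2 = ?x powr (2 * (1 - \<tau> - 3 * \<eta> / 2))" using x by (simp add: s_def powr_power mult.commute)
      then show ?thesis
        unfolding D by (simp only: powr_diff[symmetric]) (rule arg_cong[where f = "(powr) ?x"], simp add: \<kappa>_def field_simps)
    qed
    finally have tk: "(?x * ?\<rho>) ^ k / s ^ (2 * k) = (?x powr (- 2 * \<kappa>)) ^ k" .
    have "?x * (?x * ?\<rho>) ^ k * real (Suc k) ^ (2 * k + 2) / s ^ (2 * k)
      = ?x * ((?x * ?\<rho>) ^ k / s ^ (2 * k)) * real (Suc k) ^ (2 * k + 2)" by simp
    then have tail: "?x * (2 * exp (1 - s / sqrt (?x * ?\<rho>)))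
        + ?x * (?x * ?\<rho>) ^ k * real (Suc k) ^ (2 * k + 2) / s ^ (2 * k) \<le> exp (- (ln ?x powr \<gamma>))"
      unfolding tk sq using tail_terms_le[OF x(1) \<kappa> k_def k(2)] elim by simp
    have "1 \<le> ?x * ?\<rho>" unfolding D using x \<tau> by (intro ge_one_powr_ge_zero) auto
    from prob_good[OF this k(1) s] tail have "1 - exp (- (ln ?x powr \<gamma>)) \<le> measure_pmf.prob P (good s)"
      by linarith
    also have "\<dots> \<le> measure_pmf.prob P (fiedler_close_event N \<phi> (3 * ?r / gap))"
      using sub by (intro measure_pmf.finite_measure_mono) auto
    also have "P = random_graph N ?\<rho> w" by (rule random_graph_eq[symmetric]) (use \<rho> in auto)
    also have "3 * ?r / gap = 3 * (2 + 4 * K) / gap * ?x powr (- 3 * \<eta> / 2)" by simp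
    finally show ?case unfolding eps_gamma_def .
  qed
qed

end

theorem mainTheorem9:
  fixes w :: "real \<Rightarrow> real \<Rightarrow> real" and K :: real
  assumes graphon: "graphon w"
    and robinson: "robinsonian w"
    and A1: "K > 0"
        "\<forall>x\<in>{0..1}. \<forall>y\<in>{0..1}. \<forall>x'\<in>{0..1}. \<forall>y'\<in>{0..1}.
           \<bar>w x y - w x' y'\<bar> \<le> K * (\<bar>x - x'\<bar> + \<bar>y - y'\<bar>)"
    and A2: "\<forall>x\<in>{0..1}. AE y in lebesgue_on {0..1}.
               \<exists>D. ((\<lambda>t. w t y) has_real_derivative D) (at x within {0..1}) \<and> D \<noteq> 0"
    and A3: "\<exists>d'. (\<forall>x\<in>{0..1}. (graphon_degree w has_real_derivative d' x) (at x within {0..1}))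
               \<and> countable {x\<in>{0..1}. d' x = 0}"
    and A4: "(INF f\<in>{f. L2 f \<and> (\<integral>x. f x \<partial>lebesgue_on {0..1}) = 0 \<and> inner_L2 f f = 1}.
                inner_L2 (graphon_lap w f) f)
             < (INF x\<in>{0..1}. graphon_degree w x)"
  shows "(\<exists>C>0. \<forall>\<tau> \<eta> \<phi> \<epsilon>.
            0 \<le> \<tau> \<and> \<tau> < 1 \<and> 0 < \<eta> \<and> \<eta> < (1 - \<tau>) / 3 \<and>
            fiedler_function w \<phi> \<and> norm_L2 \<phi> = 1 \<and> 0 < \<epsilon> \<and> \<epsilon> < 1 \<longrightarrow>
            (\<exists>N0::nat. \<forall>N\<ge>N0.
               measure_pmf.prob (random_graph N (real N powr (- \<tau>)) w)
                 (fiedler_close_event N \<phi> (C * real N powr (- 3 * \<eta> / 2))) \<ge> 1 - \<epsilon>))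
       \<and> (\<exists>C'>0. \<forall>\<tau> \<eta> \<phi> \<gamma>.
            0 \<le> \<tau> \<and> \<tau> < 1 \<and> 0 < \<eta> \<and> \<eta> < (1 - \<tau>) / 3 \<and>
            fiedler_function w \<phi> \<and> norm_L2 \<phi> = 1 \<and> \<gamma> > 1 \<longrightarrow>
            (\<exists>N0::nat. \<forall>N\<ge>N0.
               measure_pmf.prob (random_graph N (real N powr (- \<tau>)) w)
                 (fiedler_close_event N \<phi> (C' * real N powr (- 3 * \<eta> / 2)))
               \<ge> 1 - eps_gamma \<gamma> N))"
proof -
  interpret lipschitz_graphon w K
    using graphon A1 by unfold_locales (auto simp: graphon_def)
  interpret robinson_graphon w K
    using robinson A2 A4 by unfold_locales (simp_all add: bottom_def)
  \<comment> \<open>Built from \<open>K\<close> and \<open>gap\<close> only, so the same constant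
    serves all \<open>\<tau>\<close>, \<open>\<eta>\<close> and \<open>\<phi>\<close>, and both
    claims.\<close>
  let ?C = "3 * (2 + 4 * K) / gap"
  have C: "?C > 0" using A1(1) gap(1) by simp
  show ?thesis
  proof (intro conjI exI[of _ ?C] allI impI C; elim conjE)
    fix \<tau> \<eta> \<epsilon> :: real and \<phi> :: "real \<Rightarrow> real"
    assume *: "0 \<le> \<tau>" "\<tau> < 1" "0 < \<eta>" "\<eta> < (1 - \<tau>) / 3" "fiedler_function w \<phi>" "norm_L2 \<phi> = 1"
      and \<epsilon>: "0 < \<epsilon>" "\<epsilon> < 1"
    \<comment> \<open>A fixed confidence level follows from the quantitative statement with exponent
      2, whose failure probability tends to zero.\<close>
    have "(\<lambda>N. eps_gamma 2 N) \<longlonglongrightarrow> 0" unfolding eps_gamma_def by real_asymp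
    then have "\<forall>\<^sub>F N in sequentially. eps_gamma 2 N < \<epsilon>" using \<epsilon>(1) by (rule order_tendstoD)
    moreover have "\<forall>\<^sub>F N in sequentially. measure_pmf.prob (random_graph N (real N powr (- \<tau>)) w)
      (fiedler_close_event N \<phi> (?C * real N powr (- 3 * \<eta> / 2))) \<ge> 1 - eps_gamma 2 N"
      by (rule eventually_fiedler_close[OF *(1-4) _ *(5,6)]) simp
    ultimately have "\<forall>\<^sub>F N in sequentially. measure_pmf.prob (random_graph N (real N powr (- \<tau>)) w)
      (fiedler_close_event N \<phi> (?C * real N powr (- 3 * \<eta> / 2))) \<ge> 1 - \<epsilon>"
      by eventually_elim linarith
    then show "\<exists>N0::nat. \<forall>N\<ge>N0. measure_pmf.prob (random_graph N (real N powr (- \<tau>)) w)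
      (fiedler_close_event N \<phi> (?C * real N powr (- 3 * \<eta> / 2))) \<ge> 1 - \<epsilon>"
      by (simp only: eventually_sequentially)
  next
    fix \<tau> \<eta> \<gamma> :: real and \<phi> :: "real \<Rightarrow> real"
    assume *: "0 \<le> \<tau>" "\<tau> < 1" "0 < \<eta>" "\<eta> < (1 - \<tau>) / 3" "fiedler_function w \<phi>" "norm_L2 \<phi> = 1" "\<gamma> > 1"
    show "\<exists>N0::nat. \<forall>N\<ge>N0. measure_pmf.prob (random_graph N (real N powr (- \<tau>)) w)
      (fiedler_close_event N \<phi> (?C * real N powr (- 3 * \<eta> / 2))) \<ge> 1 - eps_gamma \<gamma> N"
      using eventually_fiedler_close[OF *(1-4,7,5,6)] by (simp only: eventually_sequentially)
  qed
qed

end
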